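(* Let $(x,u)$ on $[0,t_f]$ be an optimal solution of the time-optimal problem (P) described in the context, with associated costates $\lambda$, and assume that chattering occurs on a left-side neighborhood of $t_\infty$, where $t_\infty\in(0,t_f)$ is the limit time. Then there exist $t_0<t_\infty$ and a state constraint $s\in\{1,\dots,n\}\times\{\pm1\}$ such that $s$ is the unique state constraint that is active for some $t\in[t_0,t_\infty]$. Furthermore: 1. $1<|s|<n$. 2. There exists a sequence $\{t_i\}_{i=1}^\infty\subset(t_0,t_\infty)$, increasing monotonically and converging to $t_\infty$, such that on $(t_0,t_\infty)$ the constraint $s$ is active exactly at the points of $\{t_i\}_{i=1}^\infty$ and inactive elsewhere. Moreover $\{t_i\}_{i=1}^\infty$ is the set of junction times. 3. $\mathrm{sgn}(x_{|s|}(t))=\mathrm{sgn}(s)$ for all $t\in[t_0,t_\infty]$. 4. For every $|s|<k\le n$, both $\mathrm{sgn}(x_k(t))$ and $\mathrm{sgn}(\lambda_k(t))$ are constant for $t\in(t_0,t_\infty)$. 5. For all $1\le k\le|s|$ and $i\ge1$, on $(t_i,t_{i+1})$ the function $\lambda_k$ has at most $|s|-k+1$ roots and $u$ switches at most $|s|$ times. 6. For all $1\le k\le|s|$ and $t\in(t_0,t_\infty)$: (a) $\lambda_k$ crosses $0$ infinitely many times during $(t,t_\infty)$; and for every $i\ge1$, $\mathrm{sgn}(s)\lambda_{|s|}$ increases monotonically on $(t_i,t_{i+1})$ and jumps decreasingly at $t_i$. (b) $\sup_{\tau\in[t,t_\infty]}|x_k(\tau)-x_k(t_\infty)|=\mathcal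 O((t_\infty-t)^k)$ and $\sup_{\tau\in[t,t_\infty]}|\lambda_k(\tau)|=\mathcal O((t_\infty-t)^{|s|-k+1})$. (c) For $1\le k<|s|$, $\lim_{t\to t_\infty^-}x_k(t)=x_k(t_\infty)=0$; $\lim_{t\to t_\infty^-}x_{|s|}(t)=x_{|s|}(t_\infty)=M_{|s|}\,\mathrm{sgn}(s)$; and for $1\le k\le|s|$, $\lim_{t\to t_\infty^-}\lambda_k(t)=\lambda_k(t_\infty)=0$. The analogous conclusions hold if chattering occurs on a right-side neighborhood of $t_\infty$, with $t_0>t_\infty$, the interval $[t_0,t_\infty]$ replaced by $[t_\infty,t_0]$, $\{t_i\}$ decreasing monotonically to $t_\infty$, intervals $(t_i,t_{i+1})$ replaced by $(t_{i+1},t_i)$, $(t,t_\infty)$ by $(t_\infty,t)$, $t_\infty-t$ by $t-t_\infty$, and left limits by right limits.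
   Context: Problem (P) of order $n\ge1$: given $M_0\in(0,\infty)$, $M_1,\dots,M_n\in(0,\infty]$ and $x_0,x_f\in\mathbb R^n$, minimize the free terminal time $t_f$ subject to $\dot x_k=x_{k-1}$ ($1<k\le n$), $\dot x_1=u$ on $[0,t_f]$, $x(0)=x_0$, $x(t_f)=x_f$, $|x_k(t)|\le M_k$ ($1\le k\le n$) and $|u(t)|\le M_0$ on $[0,t_f]$. Costates (Pontryagin's principle with state constraints): along an optimal solution there are a constant $\lambda_0\ge0$, costates $\lambda=(\lambda_k)_{k=1}^n$ and multipliers $\eta_k\ge0$ with $\eta_k(|x_k|-M_k)=0$, such that $(\lambda_0,\lambda(t))\neq0$; $\dot\lambda_k=-\lambda_{k+1}-\eta_k\,\mathrm{sgn}(x_k)$ for $k<n$ and $\dot\lambda_n=-\eta_n\,\mathrm{sgn}(x_n)$; the Hamiltonian $\lambda_0+\lambda_1u+\sum_{k=2}^n\lambda_kx_{k-1}+\sum_{k=1}^n\eta_k(|x_k|-M_k)$ is identically $0$ and is minimized in $u\in[-M_0,M_0]$. The control is normalized as $u=-M_0\,\mathrm{sgn}(\lambda_1)$ with $\mathrm{sgn}(0)=0$ (this holds a.e.). The costates may jump only at times $t_1$ where some $|x_k|$ is tangent to $M_k$ (i.e. $|x_k(t_1)|=M_k$, $|x_k|<M_k$ in a deleted neighborhood) or where the trajectory enters or leaves an arc $\{|x_k|\equiv M_k\}$; then $\lambda(t_1^+)-\lambda(t_1^-)=\mu\,\mathrm{sgn}(x_k)e_k$ for some $\mu\le0$. ($\lambda_1$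 is continuous.) A state constraint is $s=(k,a)\in\{1,\dots,n\}\times\{\pm1\}$, with $|s|=k$, $\mathrm{sgn}(s)=a$; it denotes the inequality $\mathrm{sgn}(s)\,x_{|s|}\le M_{|s|}$ and is active at $t$ if equality holds at $t$. A junction time is a time at which a state constraint switches between active and inactive (active at that time and inactive in a one-sided deleted neighborhood); the costate is allowed, but not required, to jump at a junction time, so "jumps decreasingly at $t_i$" means $\mathrm{sgn}(s)\lambda_{|s|}(t_i^+)\le\mathrm{sgn}(s)\lambda_{|s|}(t_i^-)$. A switch of $u$ is a time at which $u$ jumps. Chattering occurs on a left-side neighborhood of $t_\infty$ with limit time $t_\infty$ if, for some $\bar t<t_\infty$, $u$ has infinitely many switches in $(\bar t,t_\infty)$ and these accumulate exactly at $t_\infty$ (right-side: analogously on $(t_\infty,\bar t)$). The value $\lambda_k(t_\infty)$ is understood as the one-sided limit at $t_\infty$.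
   Formalization: Uniqueness of s on the closed interval between t_0 and t_∞ fails as worded: at t_∞ itself a constraint s' with |s'| ≥ |s|+2 may be tangent. The formal claim is uniqueness for all t ≠ t_∞, and at t_∞ only among constraints with |s'| ≤ |s|+1. *)

theory Defs
  imports "HOL-Analysis.Analysis" "HOL-Library.Landau_Symbols"
begin

text \<open>A vector in \<open>\<real>\<^sup>n\<close> is a function on the indices \<open>1,\<dots>,n\<close>; a trajectory is
  written \<open>x k t\<close> for \<open>x\<^sub>k(t)\<close>. Controls only matter up to null sets.\<close>

definition feasible ::
  "nat \<Rightarrow> real \<Rightarrow> (nat \<Rightarrow> ereal) \<Rightarrow> (nat \<Rightarrow> real) \<Rightarrow> (nat \<Rightarrow> real) \<Rightarrow>
   real \<Rightarrow> (nat \<Rightarrow> real \<Rightarrow> real) \<Rightarrow> (real \<Rightarrow> real) \<Rightarrow> bool" where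
  "feasible n M0 M x0 xf tf x u \<longleftrightarrow>
     0 \<le> tf \<and>
     u \<in> borel_measurable (lebesgue_on {0..tf}) \<and>
     (\<forall>t\<in>{0..tf}. (u has_integral (x 1 t - x 1 0)) {0..t}) \<and>
     (\<forall>k\<in>{1<..n}. \<forall>t\<in>{0..tf}. (x k has_real_derivative x (k - 1) t) (at t within {0..tf})) \<and>
     (\<forall>k\<in>{1..n}. x k 0 = x0 k \<and> x k tf = xf k) \<and>
     (\<forall>k\<in>{1..n}. \<forall>t\<in>{0..tf}. ereal \<bar>x k t\<bar> \<le> M k) \<and>
     (\<forall>t\<in>{0..tf}. \<bar>u t\<bar> \<le> M0)"

definition optimal ::
  "nat \<Rightarrow> real \<Rightarrow> (nat \<Rightarrow> ereal) \<Rightarrow> (nat \<Rightarrow> real) \<Rightarrow> (nat \<Rightarrow> real) \<Rightarrow>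
   real \<Rightarrow> (nat \<Rightarrow> real \<Rightarrow> real) \<Rightarrow> (real \<Rightarrow> real) \<Rightarrow> bool" where
  "optimal n M0 M x0 xf tf x u \<longleftrightarrow>
     feasible n M0 M x0 xf tf x u \<and>
     (\<forall>tf' x' u'. feasible n M0 M x0 xf tf' x' u' \<longrightarrow> tf \<le> tf')"

text \<open>A state constraint \<open>s = (k, a)\<close> has \<open>|s| = fst s\<close> and \<open>sgn(s) = snd s\<close>.\<close>

definition state_constraints :: "nat \<Rightarrow> (nat \<times> real) set" where
  "state_constraints n = {1..n} \<times> {1, -1}"

definition active :: "(nat \<Rightarrow> ereal) \<Rightarrow> (nat \<Rightarrow> real \<Rightarrow> real) \<Rightarrow> nat \<times> real \<Rightarrow> real \<Rightarrow> bool" where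
  "active M x s t \<longleftrightarrow> ereal (snd s * x (fst s) t) = M (fst s)"

definition junction :: "(nat \<Rightarrow> ereal) \<Rightarrow> (nat \<Rightarrow> real \<Rightarrow> real) \<Rightarrow> nat \<times> real \<Rightarrow> real \<Rightarrow> bool" where
  "junction M x s t \<longleftrightarrow> active M x s t \<and>
     ((\<forall>\<^sub>F \<tau> in at_left t. \<not> active M x s \<tau>) \<or> (\<forall>\<^sub>F \<tau> in at_right t. \<not> active M x s \<tau>))"

text \<open>Times at which \<open>\<lambda>\<^sub>k\<close> may jump. The first two alternatives are the junction times, among
  them the points of tangency; the last two are the end points of arcs \<open>|x\<^sub>k| \<equiv> M\<^sub>k\<close>.\<close>

definition may_jump :: "(nat \<Rightarrow> ereal) \<Rightarrow> (nat \<Rightarrow> real \<Rightarrow> real) \<Rightarrow> nat \<Rightarrow> real \<Rightarrow> bool" where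
  "may_jump M x k t \<longleftrightarrow>
     (let A = (\<lambda>\<tau>. ereal \<bar>x k \<tau>\<bar> = M k) in
       A t \<and>
       ((\<forall>\<^sub>F \<tau> in at_left t. \<not> A \<tau>) \<or>
        (\<forall>\<^sub>F \<tau> in at_right t. \<not> A \<tau>) \<or>
        (\<forall>\<^sub>F \<tau> in at_left t. A \<tau>) \<and> \<not> (\<forall>\<^sub>F \<tau> in at_right t. A \<tau>) \<or>
        (\<forall>\<^sub>F \<tau> in at_right t. A \<tau>) \<and> \<not> (\<forall>\<^sub>F \<tau> in at_left t. A \<tau>)))"

text \<open>Where \<open>M\<^sub>k = \<infinity>\<close>, \<open>real_of_ereal (M k)\<close> is \<open>0\<close>; complementarity forces \<open>\<eta>\<^sub>k = 0\<close> there,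
  so the term vanishes as it should.\<close>

definition hamiltonian ::
  "nat \<Rightarrow> (nat \<Rightarrow> ereal) \<Rightarrow> real \<Rightarrow> (nat \<Rightarrow> real) \<Rightarrow> (nat \<Rightarrow> real) \<Rightarrow> (nat \<Rightarrow> real) \<Rightarrow> real \<Rightarrow> real" where
  "hamiltonian n M lam0 lam eta x u =
     lam0 + lam 1 * u + (\<Sum>k=2..n. lam k * x (k - 1))
       + (\<Sum>k=1..n. eta k * (\<bar>x k\<bar> - real_of_ereal (M k)))"

text \<open>The costate equation and the jump condition are combined into one integrated equation, since
  jump times may accumulate. It says that \<open>\<lambda>\<^sub>k\<close> is of locally bounded variation on \<open>(0, t\<^sub>f)\<close>, has
  the derivative \<open>-\<lambda>\<^sub>k\<^sub>+\<^sub>1 - \<eta>\<^sub>k sgn x\<^sub>k\<close> apart from its jumps (\<open>\<lambda>\<^sub>n\<^sub>+\<^sub>1 = 0\<close>), and that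
  \<open>\<lambda>\<^sub>k(t+) - \<lambda>\<^sub>k(t-) = \<mu>\<^sub>k(t) sgn x\<^sub>k(t)\<close>. At a jump the value of \<open>\<lambda>\<^sub>k\<close> is the right limit.\<close>

definition costates ::
  "nat \<Rightarrow> real \<Rightarrow> (nat \<Rightarrow> ereal) \<Rightarrow> real \<Rightarrow> (nat \<Rightarrow> real \<Rightarrow> real) \<Rightarrow> (real \<Rightarrow> real) \<Rightarrow>
   (nat \<Rightarrow> real \<Rightarrow> real) \<Rightarrow> bool" where
  "costates n M0 M tf x u lam \<longleftrightarrow>
     (\<exists>lam0 eta mu.
       0 \<le> lam0 \<and>
       (\<forall>k\<in>{1..n}. \<forall>t\<in>{0<..<tf}.
          0 \<le> eta k t \<and> ereal (eta k t) * (ereal \<bar>x k t\<bar> - M k) = 0) \<and>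
       (\<forall>t\<in>{0<..<tf}. lam0 \<noteq> 0 \<or> (\<exists>k\<in>{1..n}. lam k t \<noteq> 0)) \<and>
       (\<forall>k\<in>{1..n}. \<forall>t\<in>{0<..<tf}. mu k t \<le> 0 \<and> (mu k t \<noteq> 0 \<longrightarrow> may_jump M x k t)) \<and>
       (\<forall>k\<in>{1..n}. \<forall>a b. 0 < a \<and> a \<le> b \<and> b < tf \<longrightarrow>
          (\<exists>I J.
             ((\<lambda>\<tau>. (if k < n then lam (k + 1) \<tau> else 0) + eta k \<tau> * sgn (x k \<tau>))
                has_integral I) {a..b} \<and>
             ((\<lambda>\<tau>. mu k \<tau> * sgn (x k \<tau>)) has_sum J) {a<..b} \<and>
             lam k b - lam k a = - I + J)) \<and>
       continuous_on {0<..<tf} (lam 1) \<and>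
       (AE t in lebesgue_on {0<..<tf}.
          let H = hamiltonian n M lam0 (\<lambda>k. lam k t) (\<lambda>k. eta k t) (\<lambda>k. x k t) in
            H (u t) = 0 \<and> (\<forall>v\<in>{-M0..M0}. H (u t) \<le> H v)) \<and>
       (AE t in lebesgue_on {0<..<tf}. u t = - M0 * sgn (lam 1 t)))"

text \<open>Jumps are understood modulo null sets, as \<open>u\<close> is: a control with values in
  \<open>{-M\<^sub>0, 0, M\<^sub>0}\<close> does not jump at \<open>t\<close> iff it is almost everywhere constant near \<open>t\<close>. In
  particular an isolated zero of \<open>\<lambda>\<^sub>1\<close> without change of sign is not a switch.\<close>

definition switch :: "(real \<Rightarrow> real) \<Rightarrow> real \<Rightarrow> bool" where
  "switch u t \<longleftrightarrow> \<not> (\<exists>c. \<exists>e>0. AE \<tau> in lebesgue_on {t - e<..<t + e}. u \<tau> = c)"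

text \<open>Both sides are treated at once: \<open>open_segment a b\<close> is \<open>(a, b)\<close> or \<open>(b, a)\<close>.\<close>

definition chattering_from :: "(real \<Rightarrow> real) \<Rightarrow> real \<Rightarrow> real \<Rightarrow> bool" where
  "chattering_from u tb tinf \<longleftrightarrow>
     infinite {\<tau> \<in> open_segment tb tinf. switch u \<tau>} \<and>
     (\<forall>t\<in>open_segment tb tinf. finite {\<tau> \<in> open_segment tb t. switch u \<tau>})"

definition chattering_left :: "(real \<Rightarrow> real) \<Rightarrow> real \<Rightarrow> bool" where
  "chattering_left u tinf \<longleftrightarrow> (\<exists>tb<tinf. chattering_from u tb tinf)"

definition chattering_right :: "(real \<Rightarrow> real) \<Rightarrow> real \<Rightarrow> bool" where
  "chattering_right u tinf \<longleftrightarrow> (\<exists>tb>tinf. chattering_from u tb tinf)"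

text \<open>Sign change, possibly across a jump of \<open>f\<close>.\<close>

definition crosses_zero :: "(real \<Rightarrow> real) \<Rightarrow> real \<Rightarrow> bool" where
  "crosses_zero f t \<longleftrightarrow>
     (\<forall>\<^sub>F \<tau> in at_left t. f \<tau> < 0) \<and> (\<forall>\<^sub>F \<tau> in at_right t. f \<tau> > 0) \<or>
     (\<forall>\<^sub>F \<tau> in at_left t. f \<tau> > 0) \<and> (\<forall>\<^sub>F \<tau> in at_right t. f \<tau> < 0)"

text \<open>Uniqueness of \<open>s\<close>. The clause \<open>t \<noteq> tinf \<or> fst s' \<le> fst s + 1\<close> cannot be dropped: at the
  single time \<open>tinf\<close> a constraint of index at least \<open>|s| + 2\<close> may be tangent by coincidence.
  For instance, extend a chattering solution of order \<open>4\<close> with \<open>s = (3, -1)\<close> and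
  \<open>M\<^sub>4 = \<infinity>\<close> by \<open>x\<^sub>5\<close> and \<open>\<lambda>\<^sub>5 = 0\<close>, shift \<open>x\<^sub>4\<close> so that it vanishes at \<open>tinf\<close>, restrict to a
  short interval around \<open>tinf\<close> (so that \<open>x\<^sub>5\<close> is maximal at \<open>tinf\<close>), shift \<open>x\<^sub>5\<close> to be positive, and put
  \<open>M\<^sub>5 = x\<^sub>5(tinf)\<close>.\<close>

definition only_active ::
  "nat \<Rightarrow> (nat \<Rightarrow> ereal) \<Rightarrow> (nat \<Rightarrow> real \<Rightarrow> real) \<Rightarrow> real \<Rightarrow> real \<Rightarrow> nat \<times> real \<Rightarrow> bool" where
  "only_active n M x tinf t0 s \<longleftrightarrow>
     s \<in> state_constraints n \<and>
     (\<exists>t\<in>closed_segment t0 tinf. active M x s t) \<and>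
     (\<forall>s'\<in>state_constraints n. \<forall>t\<in>closed_segment t0 tinf.
        active M x s' t \<and> (t \<noteq> tinf \<or> fst s' \<le> fst s + 1) \<longrightarrow> s' = s)"

text \<open>Here \<open>F\<close> is the filter \<open>t \<rightarrow> tinf\<close> from the side of \<open>t0\<close>, \<open>ts i\<close> is \<open>t\<^sub>i\<^sub>+\<^sub>1\<close>, and the value
  \<open>\<lambda>\<^sub>k(tinf)\<close> is the limit of \<open>\<lambda>\<^sub>k\<close> along \<open>F\<close>. The \<open>bdd_above\<close> conditions are there because the
  supremum of an unbounded set of reals is unspecified.\<close>

definition chattering_structure ::
  "nat \<Rightarrow> (nat \<Rightarrow> ereal) \<Rightarrow> (nat \<Rightarrow> real \<Rightarrow> real) \<Rightarrow> (real \<Rightarrow> real) \<Rightarrow> (nat \<Rightarrow> real \<Rightarrow> real) \<Rightarrow>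
   real \<Rightarrow> real \<Rightarrow> nat \<times> real \<Rightarrow> (nat \<Rightarrow> real) \<Rightarrow> bool" where
  "chattering_structure n M x u lam tinf t0 s ts \<longleftrightarrow>
     (let m = fst s; a = snd s; T = open_segment t0 tinf; F = at tinf within T;
          lam_end = (\<lambda>k. (lam k)(tinf := Lim F (lam k)))
      in
       1 < m \<and> m < n \<and>
       range ts \<subseteq> T \<and> ts \<longlonglongrightarrow> tinf \<and>
       {t \<in> T. active M x s t} = range ts \<and>
       {t \<in> T. \<exists>s'\<in>state_constraints n. junction M x s' t} = range ts \<and>
       (\<forall>t\<in>closed_segment t0 tinf. sgn (x m t) = a) \<and>
       (\<forall>k\<in>{m<..n}. (\<lambda>t. sgn (x k t)) constant_on T \<and> (\<lambda>t. sgn (lam k t)) constant_on T) \<and>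
       (\<forall>i. (\<forall>k\<in>{1..m}.
               finite {t \<in> open_segment (ts i) (ts (Suc i)). lam k t = 0} \<and>
               card {t \<in> open_segment (ts i) (ts (Suc i)). lam k t = 0} \<le> m - k + 1) \<and>
            finite {t \<in> open_segment (ts i) (ts (Suc i)). switch u t} \<and>
            card {t \<in> open_segment (ts i) (ts (Suc i)). switch u t} \<le> m) \<and>
       (\<forall>k\<in>{1..m}. \<forall>t\<in>T. infinite {\<tau> \<in> open_segment t tinf. crosses_zero (lam k) \<tau>}) \<and>
       (\<forall>i. strict_mono_on (open_segment (ts i) (ts (Suc i))) (\<lambda>t. a * lam m t) \<and>
            (\<exists>l r. (lam m \<longlongrightarrow> l) (at_left (ts i)) \<and> (lam m \<longlongrightarrow> r) (at_right (ts i)) \<and>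
                   a * r \<le> a * l)) \<and>
       (\<forall>k\<in>{1..m}.
          (\<forall>t\<in>T. bdd_above ((\<lambda>\<tau>. \<bar>x k \<tau> - x k tinf\<bar>) ` closed_segment t tinf) \<and>
                 bdd_above ((\<lambda>\<tau>. \<bar>lam_end k \<tau>\<bar>) ` closed_segment t tinf)) \<and>
          (\<lambda>t. SUP \<tau>\<in>closed_segment t tinf. \<bar>x k \<tau> - x k tinf\<bar>)
             \<in> O[F](\<lambda>t. \<bar>tinf - t\<bar> ^ k) \<and>
          (\<lambda>t. SUP \<tau>\<in>closed_segment t tinf. \<bar>lam_end k \<tau>\<bar>)
             \<in> O[F](\<lambda>t. \<bar>tinf - t\<bar> ^ (m - k + 1))) \<and>
       (\<forall>k\<in>{1..<m}. (x k \<longlongrightarrow> 0) F \<and> x k tinf = 0) \<and>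
       (x m \<longlongrightarrow> real_of_ereal (M m) * a) F \<and> x m tinf = real_of_ereal (M m) * a \<and>
       (\<forall>k\<in>{1..m}. (lam k \<longlongrightarrow> 0) F \<and> lam_end k tinf = 0))"

end

theory Submission
  imports Defs
begin

text \<open>If no constraint were active arbitrarily close to \<open>t\<^sub>\<infinity>\<close>, then \<open>\<lambda>\<^sub>n, \<dots>, \<lambda>\<^sub>1\<close> would in turn have
  constant sign near \<open>t\<^sub>\<infinity>\<close>, and \<open>u\<close> would not switch. If \<open>|x\<^sub>m| = M\<^sub>m\<close> at times that accumulate at
  \<open>t\<^sub>\<infinity>\<close>, Rolle's theorem gives \<open>x\<^sub>k(t\<^sub>\<infinity>) = 0\<close> for \<open>k < m\<close>; hence \<open>m\<close> is unique. Above \<open>m\<close> all signs are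
  constant by the same integration argument, and \<open>a \<lambda>\<^sub>m\<^sub>+\<^sub>1\<close> (with \<open>a = sgn x\<^sub>m(t\<^sub>\<infinity>)\<close>) must have the sign that lets \<open>a \<lambda>\<^sub>m\<close> increase between
  the contacts, since otherwise \<open>\<lambda>\<^sub>m\<close> would be monotone and again \<open>u\<close> would not switch.

  The key point is that an excursion between two contacts cannot start from a rest point, where
  \<open>x\<^sub>k\<close> and \<open>\<lambda>\<^sub>k\<close> vanish for \<open>k < m\<close>: there \<open>\<lambda>\<^sub>m\<close> changes sign at most once, this pattern is inherited by
  \<open>\<lambda>\<^sub>m\<^sub>-\<^sub>1, \<dots>, \<lambda>\<^sub>1, u, x\<^sub>1, \<dots>, x\<^sub>m\<^sub>-\<^sub>1\<close>, and a function with this pattern that starts and ends at \<open>0\<close> has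
  one sign, so \<open>x\<^sub>m\<close> does not return. This excludes arcs, as well as accumulation of contacts elsewhere
  than at \<open>t\<^sub>\<infinity>\<close>. A quantitative version of the argument bounds \<open>\<lambda>\<^sub>m\<close> by a multiple of \<open>|t - t\<^sub>\<infinity>|\<close>,
  and integration yields the other orders of magnitude.\<close>

section \<open>Integrals and sign patterns\<close>

text \<open>Jumps and multipliers of the active costate act in one direction only: after
  normalisation of signs, \<open>L m\<close> can drop abruptly but rises at most at the rate
  \<open>C\<close>. The upper bound \<open>L m s \<le> C * s\<close> follows at once from the sign
  changes near the limit; the lower bound is the hard half. Measuring time by the distance
  \<open>s\<close> from the limit reverses the jumps on the left side, and the factor
  \<open>sg\<close> in \<open>L m\<close> reverses them back, so one set of inequalities serves both
  sides. The excursion argument is used in two directions. From a rest point it runs towards the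
  limit, because only there a further contact to return to is guaranteed; this is done by reflecting
  \<open>s\<close>. For the lower bound it runs away from the limit, towards a contact
  \<open>a0\<close> fixed beforehand. There the start is not at rest, but a drive of size
  \<open>l\<close> acting much longer than \<open>e\<close> overrides starting values of size
  \<open>2 * l * e ^ i\<close>. One factor \<open>R\<close> of elapsed time settles the signs of the
  costates, a second one those of the states; hence \<open>R * R\<close> in the constant
  \<open>K\<close>.\<close>

lemma negligible_countable:
  fixes N :: "real set"
  assumes "countable N"
  shows "negligible N"
  using assms countable_imp_null_set_lborel[of N]
  by (auto simp: negligible_iff_null_sets intro: null_sets_completionI)

text \<open>A nonnegative function with integral zero vanishes almost everywhere, which would make
  the interval negligible. The exceptional set \<open>N\<close> later absorbs contacts, at which the
  sign of the costate is not controlled.\<close>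

lemma has_integral_pos:
  fixes g :: "real \<Rightarrow> real"
  assumes "(g has_integral I) {a..b}" "a < b" "negligible N"
    and pos: "\<And>t. t \<in> {a<..<b} - N \<Longrightarrow> 0 < g t"
  shows "0 < I"
proof -
  define h where "h t = (if t \<in> {a<..<b} - N then g t else 0)" for t
  have N': "negligible (N \<union> {a, b})" using assms by auto
  have h: "(h has_integral I) {a..b}"
    by (rule has_integral_spike[OF N' _ assms(1)]) (auto simp: h_def)
  have h0: "0 \<le> h t" for t using pos[of t] by (auto simp: h_def)
  have "0 \<le> I" using has_integral_nonneg[OF h] h0 by auto
  moreover have "I \<noteq> 0"
  proof
    assume "I = 0"
    have "h absolutely_integrable_on {a..b}"
      using h h0 by (intro nonnegative_absolutely_integrable_1) (auto simp: integrable_on_def)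
    then have hi: "integrable (lebesgue_on {a..b}) h"
      by (simp add: integrable_restrict_space set_integrable_def)
    have "integral\<^sup>L (lebesgue_on {a..b}) h = 0"
      using h \<open>I = 0\<close> hi by (simp add: lebesgue_integral_eq_integral integral_unique)
    then have "AE t in lebesgue_on {a..b}. h t = 0"
      using integral_nonneg_eq_0_iff_AE[OF hi] h0 by simp
    then have "AE t in lebesgue. t \<in> {a..b} \<longrightarrow> h t = 0"
      by (simp add: AE_restrict_space_iff)
    then obtain Z where Z: "Z \<in> null_sets lebesgue" "{t. \<not> (t \<in> {a..b} \<longrightarrow> h t = 0)} \<subseteq> Z"
      by (auto simp: eventually_ae_filter)
    then have "negligible (Z \<union> (N \<union> {a, b}))"
      using N' by (auto simp: negligible_iff_null_sets)
    moreover have "{a..b} \<subseteq> Z \<union> (N \<union> {a, b})"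
    proof
      fix t assume "t \<in> {a..b}"
      then show "t \<in> Z \<union> (N \<union> {a, b})"
        using Z(2) pos[of t] by (cases "t \<in> {a<..<b} - N") (auto simp: h_def)
    qed
    ultimately have "negligible {a..b}" by (rule negligible_subset)
    then show False using \<open>a < b\<close> negligible_interval(1)[of a b] by (auto simp: box_eq_empty)
  qed
  ultimately show ?thesis by simp
qed

text \<open>At most one change of sign, from plus to minus, up to a null set. Since \<open>c\<close>
  may be an end point, a constant sign is included.\<close>

definition plus_minus :: "(real \<Rightarrow> real) \<Rightarrow> real \<Rightarrow> real \<Rightarrow> bool" where
  "plus_minus g p q \<longleftrightarrow> (\<exists>c\<in>{p..q}. \<exists>N. negligible N \<and>
     (\<forall>t\<in>{p<..<c} - N. 0 < g t) \<and> (\<forall>t\<in>{c<..<q} - N. g t < 0))"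

lemma plus_minus_cong:
  assumes "plus_minus f p q" "\<And>t. t \<in> {p<..<q} \<Longrightarrow> 0 < f t \<Longrightarrow> 0 < g t"
    "\<And>t. t \<in> {p<..<q} \<Longrightarrow> f t < 0 \<Longrightarrow> g t < 0"
  shows "plus_minus g p q"
proof -
  obtain c N where c: "c \<in> {p..q}" "negligible N" "\<forall>t\<in>{p<..<c} - N. 0 < f t"
    "\<forall>t\<in>{c<..<q} - N. f t < 0"
    using assms(1) unfolding plus_minus_def by blast
  have "\<forall>t\<in>{p<..<c} - N. 0 < g t" "\<forall>t\<in>{c<..<q} - N. g t < 0"
    using c assms(2,3) by auto
  then show ?thesis using c(1,2) unfolding plus_minus_def by blast
qed

text \<open>No continuity is assumed: the change of sign sits at the supremum of the points where
  \<open>g\<close> is positive, and strict decrease keeps \<open>g\<close> from vanishing on an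
  interval beyond it.\<close>

lemma strict_antimono_plus_minus:
  assumes "p \<le> c" "c \<le> q" "\<And>t. t \<in> {p<..c} \<Longrightarrow> 0 < g t"
    and dec: "\<And>s t. c < s \<Longrightarrow> s < t \<Longrightarrow> t < q \<Longrightarrow> g t < g s"
  shows "plus_minus g p q"
proof -
  \<comment> \<open>Adding \<open>c\<close> keeps \<open>S\<close> nonempty when
    \<open>c = q\<close>.\<close>
  define S where "S = {t \<in> {c..<q}. t = c \<or> 0 < g t} \<union> {c}"
  define e where "e = Sup S"
  have bdd: "bdd_above S" by (rule bdd_aboveI[of _ q]) (use assms in \<open>auto simp: S_def\<close>)
  have ne: "S \<noteq> {}" by (auto simp: S_def)
  have "c \<le> e" unfolding e_def by (rule cSup_upper[OF _ bdd]) (auto simp: S_def)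
  moreover have "e \<le> q" unfolding e_def by (rule cSup_least[OF ne]) (use assms in \<open>auto simp: S_def\<close>)
  moreover have "0 < g t" if "t \<in> {p<..<e}" for t
  proof (cases "t \<le> c")
    case False
    have "t < Sup S" using that by (simp add: e_def)
    then obtain s where "s \<in> S" "t < s" using less_cSup_iff[OF ne bdd] by auto
    then have "0 < g s" "s < q" using False by (auto simp: S_def)
    then show ?thesis using dec[of t s] False \<open>t < s\<close> by auto
  qed (use assms that in auto)
  moreover have "g t < 0" if t: "t \<in> {e<..<q}" for t
  proof -
    define r where "r = (e + t) / 2"
    have r: "e < r" "r < t" using t by (auto simp: r_def)
    have "r \<notin> S" using cSup_upper[OF _ bdd, of r] r by (auto simp: e_def)
    then have "g r \<le> 0" using r t \<open>c \<le> e\<close> by (auto simp: S_def)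
    then show ?thesis using dec[of r t] r t \<open>c \<le> e\<close> by auto
  qed
  ultimately show ?thesis using \<open>p \<le> c\<close> unfolding plus_minus_def
    by (intro bexI[of _ e] exI[of _ "{}"]) auto
qed

text \<open>\<open>F\<close> starts at a nonnegative value, rises and then falls, so it can change
  sign only once, while falling. If it ends at zero, the falling part lies above zero as
  well.\<close>

lemma plus_minus_primitive:
  fixes F g :: "real \<Rightarrow> real"
  assumes int: "\<And>a b. p \<le> a \<Longrightarrow> a \<le> b \<Longrightarrow> b \<le> q \<Longrightarrow> (g has_integral F b - F a) {a..b}"
    and pm: "plus_minus g p q" and F: "0 \<le> F p"
  shows "plus_minus F p q"
    and "F q = 0 \<Longrightarrow> t \<in> {p<..<q} \<Longrightarrow> 0 < F t"
proof -
  obtain c N where c: "c \<in> {p..q}" and N: "negligible N"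
    and pos: "\<And>t. t \<in> {p<..<c} - N \<Longrightarrow> 0 < g t"
    and neg: "\<And>t. t \<in> {c<..<q} - N \<Longrightarrow> g t < 0"
    using pm unfolding plus_minus_def by blast
  have inc: "F a < F b" if "p \<le> a" "a < b" "b \<le> c" for a b
    using has_integral_pos[OF int[of a b] _ N] pos that c by fastforce
  have dec: "F b < F a" if "c \<le> a" "a < b" "b \<le> q" for a b
    using has_integral_pos[OF has_integral_neg[OF int[of a b]] _ N] neg that c by fastforce
  have p: "0 < F t" if "t \<in> {p<..c}" for t using inc[of p t] F that by auto
  show "plus_minus F p q"
    by (rule strict_antimono_plus_minus[of p c]) (use c p dec in auto)
  show "0 < F t" if "F q = 0" "t \<in> {p<..<q}"
    using p[of t] dec[of t q] that by (cases "t \<le> c") auto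
qed

text \<open>For the value \<open>0\<close> at \<open>p\<close>, this says that an arc on which \<open>Y m\<close> vanishes cannot be followed
  by an excursion \<open>(p, q)\<close>: with at most one switch, \<open>Y (m - 1)\<close> and \<open>Y m\<close> cannot both return.\<close>

lemma no_excursion:
  fixes Y L :: "nat \<Rightarrow> real \<Rightarrow> real"
  assumes m: "1 \<le> m" and M0: "0 < M0" and pq: "p < q"
    and Y0: "\<And>t. Y 0 t = - M0 * sgn (L 1 t)"
    and Y_int: "\<And>k a b. k \<in> {1..m} \<Longrightarrow> p \<le> a \<Longrightarrow> a \<le> b \<Longrightarrow> b \<le> q \<Longrightarrow>
      (Y (k - 1) has_integral Y k b - Y k a) {a..b}"
    and L_int: "\<And>k a b. k \<in> {1..<m} \<Longrightarrow> p \<le> a \<Longrightarrow> a \<le> b \<Longrightarrow> b \<le> q \<Longrightarrow>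
      (L (Suc k) has_integral L k a - L k b) {a..b}"
    and Lm: "plus_minus (\<lambda>t. - L m t) p q"
    and Lp: "\<And>k. k \<in> {1..<m} \<Longrightarrow> (-1) ^ (m - k) * L k p \<le> 0"
    and Yp: "\<And>k. k \<in> {1..m} \<Longrightarrow> 0 \<le> (-1) ^ (m - 1) * Y k p"
    and Yle: "\<And>t. t \<in> {p..q} \<Longrightarrow> Y m t \<le> 0" and Yq: "Y m q = 0"
    and Yq': "2 \<le> m \<Longrightarrow> Y (m - 1) q = 0"
  shows False
proof -
  \<comment> \<open>The alternating sign absorbs the minus in the costate equation, so every step of
    the induction is again a primitive with a nonnegative initial value.\<close>
  have L: "plus_minus (\<lambda>t. - ((-1) ^ j * L (m - j) t)) p q" if "j < m" for j
    using that
  proof (induction j)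
    case 0 then show ?case using Lm by simp
  next
    case (Suc j)
    have eq: "Suc (m - Suc j) = m - j" using Suc.prems by auto
    have k: "m - Suc j \<in> {1..<m}" "m - (m - Suc j) = Suc j" using Suc.prems by auto
    show ?case
    proof (rule plus_minus_primitive(1)[OF _ Suc.IH])
      show "0 \<le> - ((-1) ^ Suc j * L (m - Suc j) p)" using Lp[OF k(1)] unfolding k(2) by simp
    next
      fix a b assume "p \<le> a" "a \<le> b" "b \<le> q"
      then have "(L (m - j) has_integral L (m - Suc j) a - L (m - Suc j) b) {a..b}"
        using L_int[OF k(1), of a b] eq by simp
      from has_integral_mult_right[OF this, of "- ((-1) ^ j)"]
      show "((\<lambda>t. - ((-1) ^ j * L (m - j) t)) has_integral
          - ((-1) ^ Suc j * L (m - Suc j) b) - - ((-1) ^ Suc j * L (m - Suc j) a)) {a..b}"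
        by (simp add: algebra_simps)
    qed (use Suc.prems in auto)
  qed
  \<comment> \<open>The pattern of \<open>L 1\<close> passes to \<open>Y 0\<close> through the sign
    law; from there on no further sign enters, as \<open>Y k\<close> is a plain primitive of
    \<open>Y (k - 1)\<close>.\<close>
  have Y: "plus_minus (\<lambda>t. (-1) ^ (m - 1) * Y k t) p q" if "k < m" for k
    using that
  proof (induction k)
    case 0
    have "plus_minus (\<lambda>t. - ((-1) ^ (m - 1) * L 1 t)) p q" using L[of "m - 1"] m by simp
    then show ?case
      by (rule plus_minus_cong)
        (use M0 in \<open>auto simp: Y0 sgn_if minus_one_power_iff split: if_splits\<close>)
  next
    case (Suc k)
    show ?case
    proof (rule plus_minus_primitive(1)[OF _ Suc.IH])
      fix a b assume "p \<le> a" "a \<le> b" "b \<le> q"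
      then have "(Y k has_integral Y (Suc k) b - Y (Suc k) a) {a..b}"
        using Y_int[of "Suc k" a b] Suc.prems by simp
      from has_integral_mult_right[OF this, of "(-1) ^ (m - 1)"]
      show "((\<lambda>t. (-1) ^ (m - 1) * Y k t) has_integral
          (-1) ^ (m - 1) * Y (Suc k) b - (-1) ^ (m - 1) * Y (Suc k) a) {a..b}"
        by (simp add: algebra_simps)
    qed (use Suc.prems Yp in auto)
  qed
  have int: "((\<lambda>t. (-1) ^ (m - 1) * Y (k - 1) t) has_integral
          (-1) ^ (m - 1) * Y k b - (-1) ^ (m - 1) * Y k a) {a..b}"
    if "k \<in> {1..m}" "p \<le> a" "a \<le> b" "b \<le> q" for k a b
    using has_integral_mult_right[OF Y_int[OF that], of "(-1) ^ (m - 1)"] by (simp add: algebra_simps)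
  show False
  proof (cases "m = 1")
    \<comment> \<open>For \<open>m = 1\<close> the function below \<open>Y m\<close> is the control,
      which need not return to zero; here the sign of \<open>Y 1\<close> itself contradicts
      \<open>Yle\<close>.\<close>
    case True
    have "0 < (-1) ^ (m - 1) * Y 1 ((p + q) / 2)"
      by (rule plus_minus_primitive(2)[OF _ Y[of 0]]) (use int[of 1] Yp[of 1] Yq True pq in auto)
    then show False using Yle[of "(p + q) / 2"] pq True by auto
  next
    \<comment> \<open>Since \<open>Y (m - 1)\<close> returns to zero, it has one sign throughout,
      and \<open>Y m\<close> moves strictly away from zero instead of returning.\<close>
    case False
    have "0 < (-1) ^ (m - 1) * Y (m - 1) t" if "t \<in> {p<..<q}" for t
      by (rule plus_minus_primitive(2)[OF _ Y[of "m - 1 - 1"]])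
        (use int[of "m - 1"] Yp[of "m - 1"] Yq' False m that in auto)
    then have "0 < (-1) ^ (m - 1) * Y m q - (-1) ^ (m - 1) * Y m p"
      using has_integral_pos[OF int[of m p q] pq negligible_empty] m pq by auto
    then show False using Yp[of m] Yq m by auto
  qed
qed

text \<open>Starting values of order \<open>B * e ^ i\<close> contribute only lower order terms to
  an \<open>i\<close>-fold primitive driven by \<open>h\<close>. The factor \<open>real i\<close>
  makes the loss the derivative of \<open>B * e * s ^ i\<close>, so that the induction integrates it
  exactly.\<close>

lemma iterated_integral_lower_bound:
  fixes W :: "nat \<Rightarrow> real \<Rightarrow> real"
  assumes e: "0 < e" and B: "0 \<le> B"
    and int: "\<And>i a b. i < j \<Longrightarrow> e \<le> a \<Longrightarrow> a \<le> b \<Longrightarrow> b \<le> S \<Longrightarrow>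
      (W i has_integral W (Suc i) b - W (Suc i) a) {a..b}"
    and W0: "\<And>s. s \<in> {e..S} \<Longrightarrow> h \<le> W 0 s"
    and We: "\<And>i. i \<in> {1..j} \<Longrightarrow> - B * e ^ i \<le> W i e"
    and "i \<le> j" "s \<in> {e..S}"
  shows "h * (s - e) ^ i / fact i - real i * B * e * s ^ (i - 1) \<le> W i s"
  using \<open>i \<le> j\<close> \<open>s \<in> {e..S}\<close>
proof (induction i arbitrary: s)
  case 0 then show ?case using W0 by simp
next
  case (Suc i)
  \<comment> \<open>The primitive of the bound at level \<open>i\<close>, normalised so that its
    value at \<open>e\<close> is the assumed lower bound for \<open>W (Suc i) e\<close>.\<close>
  define P where "P r = h * (r - e) ^ Suc i / fact (Suc i) - B * e * r ^ i" for r
  have dP: "(P has_real_derivative h * (r - e) ^ i / fact i - i * B * e * r ^ (i - 1)) (at r within X)" for r X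
    unfolding P_def
    by (auto intro!: derivative_eq_intros simp del: power_Suc)
  have "((\<lambda>r. h * (r - e) ^ i / fact i - i * B * e * r ^ (i - 1)) has_integral P s - P e) {e..s}"
    by (rule fundamental_theorem_of_calculus)
      (use Suc.prems dP in \<open>auto simp: has_real_derivative_iff_has_vector_derivative[symmetric]\<close>)
  moreover have "(W i has_integral W (Suc i) s - W (Suc i) e) {e..s}"
    using int[of i e s] Suc.prems by auto
  ultimately have "P s - P e \<le> W (Suc i) s - W (Suc i) e"
    by (rule has_integral_le) (use Suc in auto)
  moreover have "- B * e ^ Suc i \<le> W (Suc i) e" using We[of "Suc i"] Suc.prems by auto
  moreover have "P e = - B * e ^ Suc i" by (simp add: P_def)
  ultimately have "P s \<le> W (Suc i) s" by simp
  moreover have "0 \<le> i * B * e * s ^ i" using e B Suc.prems by auto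
  ultimately show ?case by (simp add: P_def algebra_simps del: fact_Suc power_Suc)
qed

text \<open>For \<open>s\<close> at least \<open>2 * e\<close> the main term is at least
  \<open>h * (s / 2) ^ i / fact i\<close>, and the loss is smaller by a factor of order
  \<open>e / s\<close>, which is at most \<open>1 / R\<close>. The condition on \<open>R\<close> is
  stated for \<open>j\<close> so that one \<open>R\<close> serves all levels.\<close>

lemma iterated_integral_pos:
  fixes W :: "nat \<Rightarrow> real \<Rightarrow> real"
  assumes e: "0 < e" and B: "0 \<le> B" and h: "0 < h"
    and int: "\<And>i a b. i < j \<Longrightarrow> e \<le> a \<Longrightarrow> a \<le> b \<Longrightarrow> b \<le> S \<Longrightarrow>
      (W i has_integral W (Suc i) b - W (Suc i) a) {a..b}"
    and W0: "\<And>s. s \<in> {e..S} \<Longrightarrow> h \<le> W 0 s"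
    and We: "\<And>i. i \<in> {1..j} \<Longrightarrow> - B * e ^ i \<le> W i e"
    and R: "2 \<le> R" "2 ^ j * fact j * real j * B < h * R"
    and i: "i \<le> j" and s: "R * e \<le> s" "s \<le> S"
  shows "0 < W i s"
proof -
  have "2 * e \<le> R * e" using e R by auto
  then have "2 * e \<le> s" using s by linarith
  then have es: "2 * e \<le> s" "0 < s" using e by linarith+
  have lb: "h * (s - e) ^ i / fact i - real i * B * e * s ^ (i - 1) \<le> W i s"
    by (rule iterated_integral_lower_bound[OF e B int W0 We i]) (use es s e in auto)
  show ?thesis
  proof (cases i)
    case 0 then show ?thesis using lb h by simp
  next
    case (Suc l)
    have "real i * B * (2 ^ i * fact i) \<le> real j * B * (2 ^ j * fact j)"
      using i B by (intro mult_mono power_increasing fact_mono) auto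
    also have "\<dots> < h * R" using R by (simp add: algebra_simps)
    finally have "real i * B * (2 ^ i * fact i) * e < h * (R * e)"
      using e by (simp add: algebra_simps)
    also have "\<dots> \<le> h * s" using h s by simp
    finally have *: "real i * B * e < h * s / (2 ^ i * fact i)"
      by (simp add: field_simps)
    have "real i * B * e * s ^ (i - 1) < h * s / (2 ^ i * fact i) * s ^ (i - 1)"
      using * es by (intro mult_strict_right_mono) auto
    also have "\<dots> = h * (s / 2) ^ i / fact i" using Suc by (simp add: power_divide)
    also have "\<dots> \<le> h * (s - e) ^ i / fact i"
      using h es by (intro divide_right_mono mult_left_mono power_mono) auto
    finally show ?thesis using lb by simp
  qed
qed

section \<open>Eventual signs, counting of roots, accumulation of zeros\<close>

definition eventually_const_sgn :: "(real \<Rightarrow> real) \<Rightarrow> bool" where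
  "eventually_const_sgn f \<longleftrightarrow> (\<exists>c. \<forall>\<^sub>F s in at_right 0. sgn (f s) = c)"

lemma eventually_const_sgnI:
  assumes "0 < e" "\<And>s. 0 < s \<Longrightarrow> s < e \<Longrightarrow> sgn (f s) = c"
  shows "eventually_const_sgn f"
  using assms unfolding eventually_const_sgn_def eventually_at_right_field by blast

lemma eventually_const_sgnE:
  assumes "eventually_const_sgn f"
  obtains c e where "0 < e" "\<And>s. 0 < s \<Longrightarrow> s < e \<Longrightarrow> sgn (f s) = c"
  using assms unfolding eventually_const_sgn_def eventually_at_right_field by blast

lemma eventually_const_sgn_mult_iff:
  assumes "c \<noteq> 0"
  shows "eventually_const_sgn (\<lambda>s. c * f s) \<longleftrightarrow> eventually_const_sgn f"
proof
  assume "eventually_const_sgn f"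
  then show "eventually_const_sgn (\<lambda>s. c * f s)"
    by (elim eventually_const_sgnE, intro eventually_const_sgnI) (auto simp: sgn_mult)
next
  assume "eventually_const_sgn (\<lambda>s. c * f s)"
  then obtain d e where e: "0 < e" and *: "\<And>s. 0 < s \<Longrightarrow> s < e \<Longrightarrow> sgn (c * f s) = d"
    by (elim eventually_const_sgnE) blast
  show "eventually_const_sgn f"
  proof (rule eventually_const_sgnI[OF e])
    fix s assume "0 < s" "s < e"
    then have "sgn c * sgn (f s) = d" using * by (simp add: sgn_mult)
    then have "sgn c * (sgn c * sgn (f s)) = sgn c * d" by simp
    moreover have "sgn c * sgn c = 1" using assms by (simp add: sgn_if)
    ultimately show "sgn (f s) = sgn c * d" by (metis mult.assoc mult_1)
  qed
qed

text \<open>A negative value persists towards zero, a zero value does so once negative values are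
  excluded, and otherwise the function is positive throughout.\<close>

lemma mono_eventually_const_sgn:
  assumes e: "0 < e" and mono: "\<And>s t. 0 < s \<Longrightarrow> s \<le> t \<Longrightarrow> t < e \<Longrightarrow> f s \<le> f t"
  shows "eventually_const_sgn f"
proof -
  consider s where "0 < s" "s < e" "f s < 0" | s where "0 < s" "s < e" "f s = 0"
      "\<And>s. 0 < s \<Longrightarrow> s < e \<Longrightarrow> 0 \<le> f s"
    | "\<And>s. 0 < s \<Longrightarrow> s < e \<Longrightarrow> 0 < f s"
    by (metis less_eq_real_def linorder_not_less)
  then show ?thesis
  proof cases
    case 1
    then show ?thesis
      by (intro eventually_const_sgnI[of s _ "-1"]) (use mono[of _ s] in force)+
  next
    case 2
    then show ?thesis
      by (intro eventually_const_sgnI[of s _ 0]) (use mono[of _ s] in force)+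
  next
    case 3
    then show ?thesis by (intro eventually_const_sgnI[of e _ 1] e) auto
  qed
qed

lemma antimono_eventually_const_sgn:
  assumes e: "0 < e" and mono: "\<And>s t. 0 < s \<Longrightarrow> s \<le> t \<Longrightarrow> t < e \<Longrightarrow> f t \<le> f s"
  shows "eventually_const_sgn f"
  using mono_eventually_const_sgn[OF e, of "\<lambda>s. - 1 * f s"] mono
    eventually_const_sgn_mult_iff[of "- 1" f] by simp

text \<open>A primitive of a function of constant sign is monotone. The factor \<open>r\<close>
  carries the orientation of time, and the countable set \<open>N\<close> leaves room for isolated
  exceptions.\<close>

lemma eventually_const_sgn_primitive:
  assumes e: "0 < e" and N: "countable N"
    and sgn: "\<And>s. s \<in> {0<..<e} - N \<Longrightarrow> sgn (g s) = c"
    and int: "\<And>a b. 0 < a \<Longrightarrow> a \<le> b \<Longrightarrow> b < e \<Longrightarrow> (g has_integral r * (F b - F a)) {a..b}"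
    and r: "r \<noteq> 0"
  shows "eventually_const_sgn F"
proof -
  have neg: "negligible N" using N by (rule negligible_countable)
  define h where "h t = (if t \<in> N then 0 else g t)" for t
  have int': "(h has_integral r * (F b - F a)) {a..b}" if "0 < a" "a \<le> b" "b < e" for a b
    by (rule has_integral_spike[OF neg _ int[OF that]]) (auto simp: h_def)
  have "eventually_const_sgn (\<lambda>s. r * F s)"
  proof (cases "0 \<le> c")
    case True
    have "0 \<le> h s" if "s \<in> {0<..<e}" for s
      using sgn[of s] that True by (auto simp: h_def sgn_if split: if_splits)
    then have "0 \<le> r * (F t - F s)" if "0 < s" "s \<le> t" "t < e" for s t
      using has_integral_nonneg[OF int'[OF that]] that by auto
    then show ?thesis by (intro mono_eventually_const_sgn[OF e]) (simp add: algebra_simps)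
  next
    case False
    have "0 \<le> - h s" if "s \<in> {0<..<e}" for s
      using sgn[of s] that False by (auto simp: h_def sgn_if split: if_splits)
    then have "0 \<le> - (r * (F t - F s))" if "0 < s" "s \<le> t" "t < e" for s t
      using has_integral_nonneg[OF has_integral_neg[OF int'[OF that]]] that by auto
    then show ?thesis by (intro antimono_eventually_const_sgn[OF e]) (simp add: algebra_simps)
  qed
  then show ?thesis using r by (simp add: eventually_const_sgn_mult_iff)
qed

text \<open>Rolle's theorem puts a zero of \<open>g\<close> strictly between consecutive zeros of
  \<open>f\<close>, which injects all zeros but the last into those of \<open>g\<close>. As
  finiteness is not known beforehand, arbitrary finite sets of zeros are bounded instead.\<close>

lemma card_zeros_primitive:
  fixes f g :: "real \<Rightarrow> real"
  assumes deriv: "\<And>t. t \<in> {p<..<q} \<Longrightarrow> (f has_real_derivative g t) (at t)"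
    and fin: "finite {t \<in> {p<..<q}. g t = 0}" and card: "card {t \<in> {p<..<q}. g t = 0} \<le> r"
  shows "finite {t \<in> {p<..<q}. f t = 0} \<and> card {t \<in> {p<..<q}. f t = 0} \<le> Suc r"
proof (rule finite_if_finite_subsets_card_bdd)
  fix S assume S: "S \<subseteq> {t \<in> {p<..<q}. f t = 0}" "finite S"
  show "card S \<le> Suc r"
  proof (cases "S = {}")
    case False
    define T where "T = S - {Max S}"
    define nx where "nx z = Min {y \<in> S. z < y}" for z
    have nx: "nx z \<in> S \<and> z < nx z \<and> (\<forall>y\<in>S. z < y \<longrightarrow> nx z \<le> y)" if "z \<in> T" for z
    proof -
      have "z < Max S" using that S Max_ge[of S z] by (auto simp: T_def less_le)
      then have "{y \<in> S. z < y} \<noteq> {}" using S False Max_in by blast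
      then have "nx z \<in> {y \<in> S. z < y}" unfolding nx_def using S by (intro Min_in) auto
      moreover have "nx z \<le> y" if "y \<in> S" "z < y" for y
        unfolding nx_def using S that by (intro Min_le) auto
      ultimately show ?thesis by auto
    qed
    have "\<exists>y. z < y \<and> y < nx z \<and> g y = 0" if "z \<in> T" for z
    proof -
      have "z \<in> {t \<in> {p<..<q}. f t = 0}" "nx z \<in> {t \<in> {p<..<q}. f t = 0}"
        using nx[OF that] that S by (auto simp: T_def)
      then have z: "z \<in> {p<..<q}" "nx z \<in> {p<..<q}" "f z = f (nx z)" "z < nx z"
        using nx[OF that] by auto
      show ?thesis
      proof -
        have "continuous_on {z..nx z} f"
          by (rule continuous_at_imp_continuous_on) (use z in \<open>auto intro!: DERIV_isCont deriv\<close>)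
        moreover have "f differentiable (at y)" if "z < y" "y < nx z" for y
          using deriv[of y] z that real_differentiable_def by auto
        ultimately obtain y where y: "z < y" "y < nx z" "(f has_real_derivative 0) (at y)"
          using Rolle[of z "nx z" f] z by blast
        then have "g y = 0" using DERIV_unique[of f "g y" y 0] deriv[of y] z by auto
        then show ?thesis using y by auto
      qed
    qed
    then have "\<forall>z\<in>T. \<exists>y. z < y \<and> y < nx z \<and> g y = 0" by blast
    from bchoice[OF this] obtain y where
      y: "\<And>z. z \<in> T \<Longrightarrow> z < y z \<and> y z < nx z \<and> g (y z) = 0" by blast
    have lt: "y z < y z'" if "z \<in> T" "z' \<in> T" "z < z'" for z z'
      using y[of z] y[of z'] nx[of z] that by (auto simp: T_def)
    have inj: "inj_on y T"
    proof (rule inj_onI)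
      fix z z' assume "z \<in> T" "z' \<in> T" "y z = y z'"
      then show "z = z'" using lt[of z z'] lt[of z' z] by (cases z z' rule: linorder_cases) auto
    qed
    have "y ` T \<subseteq> {t \<in> {p<..<q}. g t = 0}"
    proof clarify
      fix z assume "z \<in> T"
      then have "z \<in> {p<..<q}" "nx z \<in> {p<..<q}" using nx[of z] S by (auto simp: T_def)
      then show "y z \<in> {p<..<q} \<and> g (y z) = 0" using y[OF \<open>z \<in> T\<close>] by auto
    qed
    then have "card (y ` T) \<le> r" using card_mono[OF fin] card by (meson order_trans)
    then have "card T \<le> r" using inj by (simp add: card_image)
    then show ?thesis using False S by (simp add: T_def card_Diff_singleton)
  qed auto
qed

text \<open>Without a crossing, both one-sided germs at a point have the same sign, so the interval
  is covered by two disjoint open sets and connectedness leaves only one. The value at a point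
  itself is not controlled, but such exceptions are isolated and hence countable.\<close>

lemma no_crossing_sgn_const:
  fixes f :: "real \<Rightarrow> real"
  assumes ab: "a < b"
    and l: "\<And>s. s \<in> {a<..<b} \<Longrightarrow> (\<forall>\<^sub>F t in at_left s. 0 < f t) \<or> (\<forall>\<^sub>F t in at_left s. f t < 0)"
    and r: "\<And>s. s \<in> {a<..<b} \<Longrightarrow> (\<forall>\<^sub>F t in at_right s. 0 < f t) \<or> (\<forall>\<^sub>F t in at_right s. f t < 0)"
    and nc: "\<And>s. s \<in> {a<..<b} \<Longrightarrow> \<not> crosses_zero f s"
  obtains c N where "countable N" "\<And>s. s \<in> {a<..<b} - N \<Longrightarrow> sgn (f s) = c"
proof -
  define P where "P \<sigma> = {s \<in> {a<..<b}. \<forall>\<^sub>F t in at s. sgn (f t) = \<sigma>}" for \<sigma>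
  have cover: "s \<in> P 1 \<union> P (-1)" if "s \<in> {a<..<b}" for s
    using l[OF that] r[OF that] nc[OF that] that
    by (auto simp: P_def crosses_zero_def eventually_at_split sgn_1_pos sgn_1_neg)
  have "open (P \<sigma>)" for \<sigma>
  proof (subst open_subopen, rule ballI)
    fix s assume "s \<in> P \<sigma>"
    then have s: "s \<in> {a<..<b}" and "\<forall>\<^sub>F t in at s. sgn (f t) = \<sigma>" by (auto simp: P_def)
    then obtain S where S: "open S" "s \<in> S" "\<And>t. t \<in> S \<Longrightarrow> t \<noteq> s \<Longrightarrow> sgn (f t) = \<sigma>"
      by (auto simp: eventually_at_topological)
    have "S \<inter> {a<..<b} \<subseteq> P \<sigma>"
    proof
      fix t assume t: "t \<in> S \<inter> {a<..<b}"
      show "t \<in> P \<sigma>"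
      proof (cases "t = s")
        case False
        have "\<forall>\<^sub>F r in at t. sgn (f r) = \<sigma>"
          unfolding eventually_at_topological
          by (rule exI[of _ "S - {s}"]) (use S t False in auto)
        then show ?thesis using t by (auto simp: P_def)
      qed (use \<open>s \<in> P \<sigma>\<close> in auto)
    qed
    moreover have "open (S \<inter> {a<..<b})" using S by auto
    ultimately show "\<exists>T. open T \<and> s \<in> T \<and> T \<subseteq> P \<sigma>" using S s by blast
  qed
  moreover have "P 1 \<inter> P (-1) \<inter> {a<..<b} = {}"
  proof -
    have False if "s \<in> P 1" "s \<in> P (-1)" for s
    proof -
      have "\<forall>\<^sub>F t in at s. sgn (f t) = 1" "\<forall>\<^sub>F t in at s. sgn (f t) = - 1"
        using that by (auto simp: P_def)
      then have "\<forall>\<^sub>F t in at s. False" by eventually_elim simp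
      then show False by simp
    qed
    then show ?thesis by auto
  qed
  moreover have "{a<..<b} \<subseteq> P 1 \<union> P (-1)" using cover by blast
  ultimately have "P 1 \<inter> {a<..<b} = {} \<or> P (-1) \<inter> {a<..<b} = {}"
    using connectedD[OF connected_Ioo[of a b]] by metis
  then obtain \<sigma> where \<sigma>: "\<And>s. s \<in> {a<..<b} \<Longrightarrow> s \<in> P \<sigma>" using cover by blast
  have "{s. sgn (f s) \<noteq> \<sigma>} sparse_in {a<..<b}"
    by (subst sparse_in_eventually_iff) (use \<sigma> in \<open>auto simp: P_def\<close>)
  then have "countable ({a<..<b} \<inter> {s. sgn (f s) \<noteq> \<sigma>})"
    by (intro sparse_imp_countable) auto
  then show thesis by (rule that[of _ \<sigma>]) auto
qed

text \<open>Finiteness above every positive bound provides a largest element below any given one, so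
  the set can be listed from the top downwards. An element missed by the list would have the whole
  injective list above it.\<close>

lemma enumerate_decreasing:
  fixes A :: "real set"
  assumes pos: "\<And>s. s \<in> A \<Longrightarrow> 0 < s" and fin: "\<And>s. 0 < s \<Longrightarrow> finite {t \<in> A. s \<le> t}"
    and acc: "\<And>e. 0 < e \<Longrightarrow> \<exists>s\<in>A. s < e"
  obtains f :: "nat \<Rightarrow> real" where "\<And>i. f (Suc i) < f i" "range f = A" "f \<longlonglongrightarrow> 0"
    "\<And>i t. t \<in> A \<Longrightarrow> t < f i \<Longrightarrow> t \<le> f (Suc i)"
proof -
  have max: "\<exists>r\<in>A. P r \<and> (\<forall>t\<in>A. P t \<longrightarrow> t \<le> r)" if "s \<in> A" "P s" for P s
  proof -
    have f: "finite {t \<in> A. s \<le> t \<and> P t}"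
      by (rule finite_subset[OF _ fin[OF pos[OF that(1)]]]) auto
    have "Max {t \<in> A. s \<le> t \<and> P t} \<in> {t \<in> A. s \<le> t \<and> P t}"
      by (rule Max_in[OF f]) (use that in auto)
    then have m: "Max {t \<in> A. s \<le> t \<and> P t} \<in> A" "s \<le> Max {t \<in> A. s \<le> t \<and> P t}"
      "P (Max {t \<in> A. s \<le> t \<and> P t})" by auto
    have "t \<le> Max {t \<in> A. s \<le> t \<and> P t}" if "t \<in> A" "P t" for t
      using Max_ge[OF f, of t] that m(2) by (cases "s \<le> t") auto
    then show ?thesis using m by blast
  qed
  have "\<exists>f. \<forall>i::nat. (f i \<in> A \<and> (i = 0 \<longrightarrow> (\<forall>t\<in>A. t \<le> f i))) \<and>
      (f (Suc i) < f i \<and> (\<forall>t\<in>A. t < f i \<longrightarrow> t \<le> f (Suc i)))"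
  proof (rule dependent_nat_choice)
    obtain s where "s \<in> A" using acc[of 1] by auto
    then show "\<exists>x. x \<in> A \<and> (0 = (0::nat) \<longrightarrow> (\<forall>t\<in>A. t \<le> x))" using max[of s "\<lambda>_. True"] by blast
  next
    fix x and i :: nat assume "x \<in> A \<and> (i = 0 \<longrightarrow> (\<forall>t\<in>A. t \<le> x))"
    then have "0 < x" using pos by auto
    then obtain s where "s \<in> A" "s < x" using acc by blast
    then show "\<exists>y. (y \<in> A \<and> (Suc i = 0 \<longrightarrow> (\<forall>t\<in>A. t \<le> y))) \<and> y < x \<and> (\<forall>t\<in>A. t < x \<longrightarrow> t \<le> y)"
      using max[of s "\<lambda>t. t < x"] by blast
  qed
  then obtain f where f: "\<And>i. f i \<in> A" "\<And>t. t \<in> A \<Longrightarrow> t \<le> f 0" "\<And>i. f (Suc i) < f i"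
    "\<And>i t. t \<in> A \<Longrightarrow> t < f i \<Longrightarrow> t \<le> f (Suc i)"
    by blast
  have dec: "f j < f i" if "i < j" for i j
    using lift_Suc_mono_less[of "\<lambda>i. - f i" i j] f(3) that by simp
  have range: "range f = A"
  proof (rule equalityI)
    show "A \<subseteq> range f"
    proof
      fix t assume t: "t \<in> A"
      show "t \<in> range f"
      proof (rule ccontr)
        assume no: "t \<notin> range f"
        have ne: "t \<noteq> f i" for i using no by blast
        have "t < f i" for i
        proof (induction i)
          case 0
          show ?case using f(2)[OF t] ne[of 0] by simp
        next
          case (Suc i)
          show ?case using f(4)[OF t Suc] ne[of "Suc i"] by simp
        qed
        then have "range f \<subseteq> {r \<in> A. t \<le> r}" using f(1) by (auto simp: less_imp_le)
        then have "finite (range f)" using fin[OF pos[OF t]] by (rule finite_subset)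
        moreover have "inj f" by (rule linorder_injI) (use dec in force)
        ultimately show False using finite_imageD by blast
      qed
    qed
  qed (use f in auto)
  have "f \<longlonglongrightarrow> 0"
  proof (rule order_tendstoI)
    fix e :: real assume "0 < e"
    then obtain s where "s \<in> A" "s < e" using acc by auto
    then obtain i where "f i < e" using range by auto
    then have "f j < e" if "i \<le> j" for j using dec[of i j] that by (cases "i = j") auto
    then show "\<forall>\<^sub>F j in sequentially. f j < e" by (auto simp: eventually_sequentially)
  next
    fix e :: real assume "e < 0"
    then have "e < f j" for j using pos[OF f(1)[of j]] by simp
    then show "\<forall>\<^sub>F j in sequentially. e < f j" by simp
  qed
  then show thesis using that[of f] f(3,4) range by simp
qed

text \<open>The Rolle point lies strictly between \<open>p\<close> and a nearby point of the level
  set, so it is closer to \<open>p\<close> and different from it.\<close>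

lemma rolle_islimpt:
  fixes f g :: "real \<Rightarrow> real"
  assumes p: "p \<in> {a<..<b}"
    and deriv: "\<And>t. t \<in> {a<..<b} \<Longrightarrow> (f has_real_derivative g t) (at t)"
    and fp: "f p = v" and lim: "p islimpt {t \<in> {a<..<b}. f t = v}"
  shows "p islimpt {t \<in> {a<..<b}. g t = 0}"
  unfolding islimpt_approachable
proof (intro allI impI)
  fix e :: real assume "0 < e"
  then obtain t where t: "t \<in> {a<..<b}" "f t = v" "t \<noteq> p" "dist t p < e"
    using lim unfolding islimpt_approachable by blast
  define l where "l = min t p"
  define h where "h = max t p"
  have lh: "l < h" "l \<in> {a<..<b}" "h \<in> {a<..<b}" "f l = f h" and m: "p = l \<or> p = h" "dist l h < e"
    using t p fp by (auto simp: l_def h_def min_def max_def dist_commute)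
  have "continuous_on {l..h} f"
    by (rule continuous_at_imp_continuous_on) (use lh in \<open>auto intro!: DERIV_isCont deriv\<close>)
  moreover have "f differentiable (at y)" if "l < y" "y < h" for y
    using deriv[of y] lh that real_differentiable_def by auto
  ultimately obtain y where y: "l < y" "y < h" "(f has_real_derivative 0) (at y)"
    using Rolle[of l h f] lh by blast
  then have "g y = 0" using DERIV_unique[of f "g y" y 0] deriv[of y] lh by auto
  then show "\<exists>y\<in>{t \<in> {a<..<b}. g t = 0}. y \<noteq> p \<and> dist y p < e"
    using y lh m by (intro bexI[of _ y]) (auto simp: dist_real_def)
qed

lemma islimpt_level_set:
  fixes f :: "real \<Rightarrow> real"
  assumes "p \<in> {a<..<b}" "continuous_on {a<..<b} f" "p islimpt {t \<in> {a<..<b}. f t = v}"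
  shows "f p = v"
proof -
  obtain h where h: "\<And>n::nat. h n \<in> {t \<in> {a<..<b}. f t = v}" "h \<longlonglongrightarrow> p"
    using assms(3) unfolding islimpt_sequential by blast
  have "isCont f p" using assms(1,2) by (simp add: continuous_on_eq_continuous_at)
  then have "(\<lambda>n. f (h n)) \<longlonglongrightarrow> f p" by (rule isCont_tendsto_compose[OF _ h(2)])
  moreover have "f (h n) = v" for n using h(1)[of n] by simp
  ultimately show ?thesis by (simp add: LIMSEQ_const_iff)
qed

text \<open>Rolle's theorem moves the accumulation down one derivative at a time. For
  \<open>X 1\<close> only continuity is asked, as its derivative will be a merely measurable
  control.\<close>

lemma derivative_chain_islimpt:
  fixes X :: "nat \<Rightarrow> real \<Rightarrow> real"
  assumes p: "p \<in> {a<..<b}" and m: "1 \<le> m"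
    and deriv: "\<And>k t. k \<in> {2..m} \<Longrightarrow> t \<in> {a<..<b} \<Longrightarrow> (X k has_real_derivative X (k - 1) t) (at t)"
    and cont: "continuous_on {a<..<b} (X 1)"
    and lim: "p islimpt {t \<in> {a<..<b}. X m t = v}"
  shows "X m p = v" "k \<in> {1..<m} \<Longrightarrow> X k p = 0"
proof -
  have cont': "continuous_on {a<..<b} (X k)" if "k \<in> {1..m}" for k
  proof (cases "k = 1")
    case False
    then show ?thesis using that
      by (intro continuous_at_imp_continuous_on) (auto intro!: DERIV_isCont deriv)
  qed (use cont in auto)
  show v: "X m p = v" by (rule islimpt_level_set[OF p cont' lim]) (use m in auto)
  have *: "X (m - j) p = (if j = 0 then v else 0) \<and>
      p islimpt {t \<in> {a<..<b}. X (m - j) t = (if j = 0 then v else 0)}" if "j < m" for j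
    using that
  proof (induction j)
    case (Suc j)
    have eq: "m - j - 1 = m - Suc j" by simp
    have l: "p islimpt {t \<in> {a<..<b}. X (m - Suc j) t = 0}"
      by (rule rolle_islimpt[where f = "X (m - j)" and v = "if j = 0 then v else 0"])
        (use p deriv[of "m - j"] Suc eq in auto)
    moreover have "X (m - Suc j) p = 0"
      by (rule islimpt_level_set[OF p cont' l]) (use Suc.prems in auto)
    ultimately show ?case by simp
  qed (use v lim in auto)
  show "X k p = 0" if "k \<in> {1..<m}" using *[of "m - k"] that by auto
qed

section \<open>Regularity of primitives\<close>

lemma primitive_continuous_on:
  fixes F g :: "real \<Rightarrow> real"
  assumes int: "\<And>s t. a \<le> s \<Longrightarrow> s \<le> t \<Longrightarrow> t \<le> b \<Longrightarrow> (g has_integral F t - F s) {s..t}"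
  shows "continuous_on {a..b} F"
proof (cases "a \<le> b")
  case True
  have "continuous_on {a..b} (\<lambda>t. F a + integral {a..t} g)"
    using int[of a b] True
    by (intro continuous_intros indefinite_integral_continuous_1) (auto simp: integrable_on_def)
  then show ?thesis
    by (rule continuous_on_cong[THEN iffD1, rotated -1]) (auto simp: integral_unique[OF int])
qed auto

lemma primitive_continuous_on_Ioo:
  fixes F g :: "real \<Rightarrow> real"
  assumes int: "\<And>s t. a < s \<Longrightarrow> s \<le> t \<Longrightarrow> t < b \<Longrightarrow> (g has_integral F t - F s) {s..t}"
  shows "continuous_on {a<..<b} F"
proof (rule continuous_at_imp_continuous_on, rule ballI)
  fix t assume t: "t \<in> {a<..<b}"
  define l where "l = (a + t) / 2"
  define h where "h = (t + b) / 2"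
  have lh: "a < l" "l < t" "t < h" "h < b" using t by (auto simp: l_def h_def)
  have "continuous_on {l..h} F" by (rule primitive_continuous_on[of _ _ g]) (use int lh in auto)
  then show "isCont F t" using lh
    by (intro continuous_on_interior[of "{l..h}"]) auto
qed

lemma primitive_has_derivative:
  fixes F g :: "real \<Rightarrow> real"
  assumes int: "\<And>s t. a < s \<Longrightarrow> s \<le> t \<Longrightarrow> t < b \<Longrightarrow> (g has_integral F t - F s) {s..t}"
    and cont: "continuous_on {a<..<b} g" and t: "t \<in> {a<..<b}"
  shows "(F has_real_derivative g t) (at t)"
proof -
  define l where "l = (a + t) / 2"
  define h where "h = (t + b) / 2"
  have lh: "a < l" "l < t" "t < h" "h < b" using t by (auto simp: l_def h_def)
  have "continuous_on {l..h} g" by (rule continuous_on_subset[OF cont]) (use lh in auto)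
  then have "((\<lambda>s. integral {l..s} g) has_real_derivative g t) (at t within {l..h})"
    by (rule integral_has_real_derivative) (use lh in auto)
  then have "((\<lambda>s. integral {l..s} g) has_real_derivative g t) (at t)"
    using lh by (simp add: at_within_interior[of t "{l..h}"])
  then have d: "((\<lambda>s. F l + integral {l..s} g) has_real_derivative g t) (at t)"
    by (auto intro!: derivative_eq_intros)
  have "\<forall>\<^sub>F s in nhds t. s \<in> {l<..<h}" using lh by (intro eventually_nhds_in_open) auto
  then have "\<forall>\<^sub>F s in nhds t. F l + integral {l..s} g = F s"
    by eventually_elim (use lh in \<open>auto simp: integral_unique[OF int]\<close>)
  then show ?thesis using d by (simp only: DERIV_cong_ev[OF refl _ refl])
qed

section \<open>The problem near the limit time\<close>

text \<open>The equations are written in the coordinate \<open>s = |t - t\<^sub>\<infinity>|\<close> and with the signs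
  normalised such that the active constraint becomes \<open>Y m \<le> 0\<close>. The jumps and multipliers of
  \<open>\<lambda>\<^sub>|\<^sub>s\<^sub>|\<close> are encoded by \<open>Lm_le\<close>, where \<open>G\<close> is a primitive of the regular part of the derivative.\<close>

locale local_chattering =
  fixes m :: nat and M0 d C :: real and Y L :: "nat \<Rightarrow> real \<Rightarrow> real" and G :: "real \<Rightarrow> real"
  assumes m: "1 \<le> m" and M0: "0 < M0" and d: "0 < d"
    and Y0: "\<And>t. Y 0 t = - M0 * sgn (L 1 t)"
    and Y_zero: "\<And>k. k \<in> {1..m} \<Longrightarrow> Y k 0 = 0"
    and Y_int: "\<And>k a b. k \<in> {1..m} \<Longrightarrow> 0 \<le> a \<Longrightarrow> a \<le> b \<Longrightarrow> b < d \<Longrightarrow>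
      (Y (k - 1) has_integral Y k b - Y k a) {a..b}"
    and Y_le: "\<And>s. 0 < s \<Longrightarrow> s < d \<Longrightarrow> Y m s \<le> 0"
    and L_int: "\<And>k a b. k \<in> {1..<m} \<Longrightarrow> 0 < a \<Longrightarrow> a \<le> b \<Longrightarrow> b < d \<Longrightarrow>
      (L (Suc k) has_integral L k a - L k b) {a..b}"
    and L1_cont: "continuous_on {0<..<d} (L 1)"
    and Lm_le: "\<And>a b. 0 < a \<Longrightarrow> a \<le> b \<Longrightarrow> b < d \<Longrightarrow> L m b - L m a \<le> G b - G a"
    and Lm_eq: "\<And>a b. 0 < a \<Longrightarrow> a \<le> b \<Longrightarrow> b < d \<Longrightarrow> (\<And>s. s \<in> {a..b} \<Longrightarrow> Y m s < 0) \<Longrightarrow>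
      L m b - L m a = G b - G a"
    and G_lip: "\<And>a b. 0 < a \<Longrightarrow> a \<le> b \<Longrightarrow> b < d \<Longrightarrow> \<bar>G b - G a\<bar> \<le> C * (b - a)"
    and G_mono: "(\<forall>a b. 0 < a \<longrightarrow> a < b \<longrightarrow> b < d \<longrightarrow> G a < G b) \<or>
      (\<forall>a b. 0 < a \<longrightarrow> a < b \<longrightarrow> b < d \<longrightarrow> G b \<le> G a)"
    and accumulate: "\<And>e. 0 < e \<Longrightarrow> \<exists>s. 0 < s \<and> s < e \<and> s < d \<and> Y m s = 0"
    and pieces: "\<And>s. 0 < s \<Longrightarrow> s < d \<Longrightarrow> \<exists>e>0. \<exists>c c'.
      (\<forall>t\<in>{s..s + e}. Y 1 t = Y 1 s + c * (t - s)) \<and> (\<forall>t\<in>{s - e..s}. Y 1 t = Y 1 s + c' * (t - s))"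
    and not_const: "\<And>N e c. countable N \<Longrightarrow> 0 < e \<Longrightarrow> e \<le> d \<Longrightarrow>
      (\<And>s. s \<in> {0<..<e} - N \<Longrightarrow> sgn (L 1 s) = c) \<Longrightarrow> False"
begin

lemma Y_cont: "k \<in> {1..m} \<Longrightarrow> continuous_on {0<..<d} (Y k)"
  by (rule primitive_continuous_on_Ioo[of _ _ "Y (k - 1)"]) (use Y_int in auto)

lemma Y_deriv:
  assumes "k \<in> {2..m}" "t \<in> {0<..<d}"
  shows "(Y k has_real_derivative Y (k - 1) t) (at t)"
proof (rule primitive_has_derivative[of 0 d])
  have "k - 1 \<in> {1..m}" using assms by auto
  then show "continuous_on {0<..<d} (Y (k - 1))" by (rule Y_cont)
qed (use assms Y_int[of k] in auto)

lemma L_cont: "k \<in> {1..<m} \<Longrightarrow> continuous_on {0<..<d} (L k)"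
  using primitive_continuous_on_Ioo[of 0 d "L (Suc k)" "\<lambda>t. - L k t"] L_int[of k]
    continuous_on_minus[of "{0<..<d}" "\<lambda>t. - L k t"] by simp

lemma L_deriv:
  assumes "k \<in> {1..<m}" "0 \<le> a" "b \<le> d" "continuous_on {a<..<b} (L (Suc k))" "t \<in> {a<..<b}"
  shows "(L k has_real_derivative - L (Suc k) t) (at t)"
proof -
  have "((\<lambda>t. - L k t) has_real_derivative L (Suc k) t) (at t)"
    by (rule primitive_has_derivative[of a b]) (use assms L_int[of k] in auto)
  then have "((\<lambda>t. - (- L k t)) has_real_derivative - L (Suc k) t) (at t)" by (rule DERIV_minus)
  then show ?thesis by simp
qed

text \<open>A contact is an interior maximum of \<open>Y m\<close>.\<close>

lemma active_stationary:
  assumes s: "0 < s" "s < d" "Y m s = 0" and "2 \<le> m"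
  shows "Y (m - 1) s = 0"
proof (rule DERIV_local_max)
  show "(Y m has_real_derivative Y (m - 1) s) (at s)" using Y_deriv[of m s] assms by auto
  show "0 < min s (d - s)" using s by auto
  show "\<forall>y. \<bar>s - y\<bar> < min s (d - s) \<longrightarrow> Y m y \<le> Y m s" using s Y_le by auto
qed

text \<open>Constant signs descend by integration from \<open>L k\<close> to \<open>L 1\<close>,
  where \<open>not_const\<close> forbids them.\<close>

lemma no_eventually_const_sgn:
  assumes "1 \<le> k" "k \<le> m" "countable N" "0 < e" "\<And>s. s \<in> {0<..<e} - N \<Longrightarrow> sgn (L k s) = c"
  shows False
  using assms
proof (induction k arbitrary: e N c rule: nat_induct_at_least)
  case base
  then show False using not_const[of N "min e d" c] d by auto
next
  case (Suc k)
  have "eventually_const_sgn (L k)"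
    by (rule eventually_const_sgn_primitive[of "min e d" N "L (Suc k)" c "-1"])
      (use Suc d L_int[of k] in auto)
  then obtain c' e' where "0 < e'" "\<And>s. 0 < s \<Longrightarrow> s < e' \<Longrightarrow> sgn (L k s) = c'"
    by (elim eventually_const_sgnE) blast
  then show False using Suc.IH[of "{}" e' c'] Suc.prems by auto
qed

text \<open>In the other alternative of \<open>G_mono\<close>, \<open>Lm_le\<close> makes
  \<open>L m\<close> nonincreasing, hence of constant sign near the limit.\<close>

lemma G_strict_mono:
  assumes "0 < a" "a < b" "b < d"
  shows "G a < G b"
proof (rule ccontr)
  assume "\<not> G a < G b"
  then have "\<forall>a b. 0 < a \<longrightarrow> a < b \<longrightarrow> b < d \<longrightarrow> G b \<le> G a" using G_mono assms by blast
  then have "L m t \<le> L m s" if "0 < s" "s \<le> t" "t < d" for s t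
    using Lm_le[OF that] that by (cases "s = t") (force simp: less_le)+
  then have "eventually_const_sgn (L m)" by (intro antimono_eventually_const_sgn[OF d]) auto
  then obtain c e where "0 < e" "\<And>s. 0 < s \<Longrightarrow> s < e \<Longrightarrow> sgn (L m s) = c"
    by (elim eventually_const_sgnE) blast
  then show False using no_eventually_const_sgn[of m "{}" e c] m by auto
qed

lemma Lm_strict_mono:
  assumes "0 < s" "s < t" "t < d" "\<And>r. r \<in> {s..t} \<Longrightarrow> Y m r < 0"
  shows "L m s < L m t"
  using Lm_eq[of s t] G_strict_mono[of s t] assms by auto

text \<open>Iterated integration of a linear function from a common zero. As \<open>p\<close> may be
  either end point, the formula serves on both sides of such a zero.\<close>

lemma Y_power:
  assumes p: "p \<in> {a..b}" "0 \<le> a" "b < d" and zero: "\<And>k. k \<in> {1..m} \<Longrightarrow> Y k p = 0"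
    and Y1: "\<And>t. t \<in> {a..b} \<Longrightarrow> Y 1 t = c * (t - p)"
    and "1 \<le> k" "k \<le> m" "t \<in> {a..b}"
  shows "Y k t = c * (t - p) ^ k / fact k"
  using \<open>1 \<le> k\<close> \<open>k \<le> m\<close> \<open>t \<in> {a..b}\<close>
proof (induction k arbitrary: t rule: nat_induct_at_least)
  case base
  then show ?case using Y1 by simp
next
  case (Suc k)
  define P where "P r = c * (r - p) ^ Suc k / fact (Suc k)" for r
  have dP: "(P has_real_derivative c * (r - p) ^ k / fact k) (at r within X)" for r X
    unfolding P_def by (auto intro!: derivative_eq_intros simp del: power_Suc)
  have int: "((\<lambda>r. c * (r - p) ^ k / fact k) has_integral P v - P u) {u..v}" if "u \<le> v" for u v
    by (rule fundamental_theorem_of_calculus)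
      (use that dP in \<open>auto simp: has_real_derivative_iff_has_vector_derivative[symmetric]\<close>)
  have *: "Y (Suc k) v - Y (Suc k) u = P v - P u" if "a \<le> u" "u \<le> v" "v \<le> b" for u v
  proof (rule has_integral_unique)
    show "(Y k has_integral Y (Suc k) v - Y (Suc k) u) {u..v}"
      using Y_int[of "Suc k" u v] Suc.prems that p by auto
    show "(Y k has_integral P v - P u) {u..v}"
      by (rule has_integral_eq[OF _ int]) (use that Suc in auto)
  qed
  have "P p = 0" by (simp add: P_def)
  then have "Y (Suc k) t = P t"
    using *[of p t] *[of t p] zero[of "Suc k"] Suc p by (cases "p \<le> t") auto
  then show ?case by (simp add: P_def)
qed

text \<open>By \<open>pieces\<close>, \<open>Y 1\<close> is linear on either side of
  \<open>p\<close>, so at a common zero \<open>Y m\<close> is a monomial on each side: identically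
  zero, or free of further zeros and then negative by \<open>Y_le\<close>.\<close>

lemma locally_zero_or_negative:
  assumes p: "0 < p" "p < d" and zero: "\<And>k. k \<in> {1..m} \<Longrightarrow> Y k p = 0"
  obtains e where "0 < e" "e < p" "p + e < d"
    "(\<forall>t\<in>{p..p + e}. Y m t = 0) \<or> (\<forall>t\<in>{p<..p + e}. Y m t < 0)"
    "(\<forall>t\<in>{p - e..p}. Y m t = 0) \<or> (\<forall>t\<in>{p - e..<p}. Y m t < 0)"
proof -
  obtain e' c c' where e': "0 < e'" "\<And>t. t \<in> {p..p + e'} \<Longrightarrow> Y 1 t = Y 1 p + c * (t - p)"
    "\<And>t. t \<in> {p - e'..p} \<Longrightarrow> Y 1 t = Y 1 p + c' * (t - p)"
    using pieces[OF p] by blast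
  define e where "e = min e' (min p (d - p)) / 2"
  have e: "0 < e" "e < e'" "e < p" "p + e < d" using e' p by (auto simp: e_def min_def field_simps)
  have Y1p: "Y 1 p = 0" using zero m by auto
  have Y1r: "Y 1 t = c * (t - p)" if "t \<in> {p..p + e}" for t
    using e'(2)[of t] that e Y1p by simp
  have Y1l: "Y 1 t = c' * (t - p)" if "t \<in> {p - e..p}" for t
    using e'(3)[of t] that e Y1p by simp
  have r: "Y m t = c * (t - p) ^ m / fact m" if "t \<in> {p..p + e}" for t
    by (rule Y_power[OF _ _ _ zero Y1r m _ that]) (use e p in auto)
  have l: "Y m t = c' * (t - p) ^ m / fact m" if "t \<in> {p - e..p}" for t
    by (rule Y_power[OF _ _ _ zero Y1l m _ that]) (use e p in auto)
  have "(\<forall>t\<in>{p..p + e}. Y m t = 0) \<or> (\<forall>t\<in>{p<..p + e}. Y m t < 0)"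
  proof (cases "c = 0")
    case False
    have "Y m t < 0" if "t \<in> {p<..p + e}" for t
    proof -
      have "Y m t \<noteq> 0" using r[of t] False that by simp
      moreover have "Y m t \<le> 0" by (rule Y_le) (use that e p in auto)
      ultimately show ?thesis by simp
    qed
    then show ?thesis by blast
  qed (use r in simp)
  moreover have "(\<forall>t\<in>{p - e..p}. Y m t = 0) \<or> (\<forall>t\<in>{p - e..<p}. Y m t < 0)"
  proof (cases "c' = 0")
    case False
    have "Y m t < 0" if "t \<in> {p - e..<p}" for t
    proof -
      have "Y m t \<noteq> 0" using l[of t] False that by simp
      moreover have "Y m t \<le> 0" by (rule Y_le) (use that e p in auto)
      ultimately show ?thesis by simp
    qed
    then show ?thesis by blast
  qed (use l in simp)
  ultimately show thesis by (rule that[OF e(1,3,4)])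
qed

section \<open>Rest points and arcs\<close>

definition dead :: "real \<Rightarrow> bool" where
  "dead p \<longleftrightarrow> 0 < p \<and> p < d \<and> (\<forall>k\<in>{1..m}. Y k p = 0) \<and> (\<forall>k\<in>{1..<m}. L k p = 0)"

lemma Y_zero_on_arc:
  assumes ab: "0 < a" "a < b" "b < d" and arc: "\<And>t. t \<in> {a<..<b} \<Longrightarrow> Y m t = 0"
    and "k \<in> {1..m}" "t \<in> {a<..<b}"
  shows "Y k t = 0"
proof -
  have "\<forall>t\<in>{a<..<b}. Y (m - j) t = 0" if "j < m" for j
    using that
  proof (induction j)
    case (Suc j)
    show ?case
    proof
      fix t assume t: "t \<in> {a<..<b}"
      have "(Y (m - j) has_real_derivative Y (m - j - 1) t) (at t)"
        by (rule Y_deriv) (use Suc.prems t ab in auto)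
      moreover have "(Y (m - j) has_real_derivative 0) (at t)"
        by (rule has_field_derivative_transform_within_open[of "\<lambda>_. 0" _ _ "{a<..<b}"])
          (use t Suc in auto)
      ultimately have "Y (m - j - 1) t = 0" by (rule DERIV_unique)
      then show "Y (m - Suc j) t = 0" by simp
    qed
  qed (use arc in auto)
  from this[of "m - k"] show ?thesis using assms by auto
qed

text \<open>A nonzero \<open>L 1\<close> would by continuity hold the control at one of its bounds
  for a while, and \<open>Y 1\<close> would move.\<close>

lemma L1_zero_on_arc:
  assumes ab: "0 < a" "a < b" "b < d" and arc: "\<And>t. t \<in> {a<..<b} \<Longrightarrow> Y 1 t = 0"
    and t: "t \<in> {a<..<b}"
  shows "L 1 t = 0"
proof (rule ccontr)
  assume nz: "L 1 t \<noteq> 0"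
  define \<sigma> where "\<sigma> = sgn (L 1 t)"
  have "isCont (L 1) t" using L1_cont ab t by (simp add: continuous_on_eq_continuous_at)
  then have "isCont (\<lambda>r. \<sigma> * L 1 r) t" by (intro continuous_intros)
  then have "((\<lambda>r. \<sigma> * L 1 r) \<longlongrightarrow> \<sigma> * L 1 t) (nhds t)"
    using tendsto_at_iff_tendsto_nhds[of "\<lambda>r. \<sigma> * L 1 r" t] by (simp add: isCont_def)
  moreover have "0 < \<sigma> * L 1 t" using nz by (simp add: \<sigma>_def sgn_if)
  ultimately have "\<forall>\<^sub>F r in nhds t. 0 < \<sigma> * L 1 r"
    by (rule order_tendstoD(1))
  moreover have "\<forall>\<^sub>F r in nhds t. r \<in> {a<..<b}" using t by (intro eventually_nhds_in_open) auto
  ultimately have "\<forall>\<^sub>F r in nhds t. 0 < \<sigma> * L 1 r \<and> r \<in> {a<..<b}" by (rule eventually_conj)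
  then obtain e where e: "0 < e" "\<And>r. dist r t < e \<Longrightarrow> 0 < \<sigma> * L 1 r \<and> r \<in> {a<..<b}"
    unfolding eventually_nhds_metric by blast
  define h where "h = t + e / 2"
  have th: "t < h" "\<And>r. r \<in> {t..h} \<Longrightarrow> 0 < \<sigma> * L 1 r \<and> r \<in> {a<..<b}"
    using e by (auto simp: h_def dist_real_def)
  have "(Y 0 has_integral Y 1 h - Y 1 t) {t..h}"
    using Y_int[of 1 t h] m th(1) th(2)[of h] th(2)[of t] ab by auto
  then have int: "((\<lambda>r. - \<sigma> * Y 0 r) has_integral - \<sigma> * (Y 1 h - Y 1 t)) {t..h}"
    by (rule has_integral_mult_right)
  have "0 < - \<sigma> * Y 0 r" if "r \<in> {t..h}" for r
    using th(2)[OF that] M0 by (auto simp: Y0 sgn_if zero_less_mult_iff split: if_splits)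
  then have "0 < - \<sigma> * (Y 1 h - Y 1 t)"
    by (intro has_integral_pos[OF int th(1) negligible_empty]) simp
  moreover have "Y 1 h = 0" "Y 1 t = 0" using arc th(1) th(2)[of h] th(2)[of t] by auto
  ultimately show False by simp
qed

text \<open>On an arc the states vanish by differentiating down from \<open>Y m\<close>, the
  costates by differentiating up from \<open>L 1 = 0\<close>. The latter stops before
  \<open>L m\<close>, which may jump; hence \<open>dead\<close> does not mention it. By continuity
  the end points are rest points too, and these are where excursions start.\<close>

lemma dead_on_arc:
  assumes ab: "0 < a" "a < b" "b < d" and arc: "\<And>t. t \<in> {a<..<b} \<Longrightarrow> Y m t = 0"
    and t: "t \<in> {a..b}"
  shows "dead t"
proof -
  have Yk: "Y k t = 0" if "k \<in> {1..m}" "t \<in> {a<..<b}" for k t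
    by (rule Y_zero_on_arc[OF ab arc that])
  have Lk: "\<forall>t\<in>{a<..<b}. L k t = 0" if "1 \<le> k" "k < m" for k
    using that
  proof (induction k rule: nat_induct_at_least)
    case base
    then show ?case using L1_zero_on_arc[OF ab Yk] m by auto
  next
    case (Suc k)
    show ?case
    proof
      fix t assume t: "t \<in> {a<..<b}"
      have "(L k has_real_derivative - L (Suc k) t) (at t)"
        by (rule L_deriv[of k 0 d]) (use Suc t ab L_cont in auto)
      moreover have "(L k has_real_derivative 0) (at t)"
        by (rule has_field_derivative_transform_within_open[of "\<lambda>_. 0" _ _ "{a<..<b}"])
          (use t Suc in auto)
      ultimately have "- L (Suc k) t = 0" by (rule DERIV_unique)
      then show "L (Suc k) t = 0" by simp
    qed
  qed
  have cl: "f t = 0" if "continuous_on {0<..<d} f" "\<And>r. r \<in> {a<..<b} \<Longrightarrow> f r = 0" for f :: "real \<Rightarrow> real"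
  proof -
    have "closure {a<..<b} = {a..b}" using ab by simp
    moreover have "continuous_on {a..b} f" by (rule continuous_on_subset[OF that(1)]) (use ab in auto)
    ultimately show ?thesis
      using continuous_constant_on_closure[of "{a<..<b}" f 0 t] that(2) t by simp
  qed
  have "Y k t = 0" if "k \<in> {1..m}" for k
    by (rule cl[OF Y_cont[OF that] Yk[OF that]])
  moreover have "L k t = 0" if "k \<in> {1..<m}" for k
    by (rule cl[OF L_cont[OF that]]) (use Lk[of k] that in auto)
  ultimately show ?thesis unfolding dead_def using t ab by simp
qed

text \<open>The possibly trivial arc ending at \<open>p0\<close> is followed towards the limit to
  its first point \<open>p\<close>. If it reached the limit, \<open>L 1\<close> would vanish near
  it, against \<open>not_const\<close>. Otherwise \<open>p\<close> is again a rest point with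
  \<open>Y m\<close> negative just below it, and the last contact \<open>q\<close> before
  \<open>p\<close> completes an excursion.\<close>

lemma no_dead: "\<not> dead p0"
proof
  assume "dead p0"
  then have p0: "0 < p0" "p0 < d" "Y m p0 = 0" using m by (auto simp: dead_def)
  define B where "B = {t \<in> {0<..p0}. \<forall>r\<in>{t..p0}. Y m r = 0}"
  define p where "p = Inf B"
  have ne: "p0 \<in> B" using p0 by (auto simp: B_def)
  have bdd: "bdd_below B" by (rule bdd_belowI[of _ 0]) (auto simp: B_def)
  have p: "0 \<le> p" "p \<le> p0"
    unfolding p_def using ne cInf_lower[OF ne bdd] by (auto intro!: cInf_greatest simp: B_def)
  have arc: "Y m r = 0" if "r \<in> {p<..p0}" for r
  proof -
    have "Inf B < r" using that by (simp add: p_def)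
    then obtain t where "t \<in> B" "t < r"
      using cInf_less_iff[OF _ bdd, of r] ne by blast
    then have "\<forall>r\<in>{t..p0}. Y m r = 0" "r \<in> {t..p0}" using that by (auto simp: B_def)
    then show ?thesis by blast
  qed
  show False
  proof (cases "p = 0")
    case True
    have "L 1 s = 0" if s: "s \<in> {0<..<p0}" for s
    proof (rule L1_zero_on_arc[of "s / 2" p0])
      fix t assume "t \<in> {s / 2<..<p0}"
      then show "Y 1 t = 0"
        using Y_zero_on_arc[of "s / 2" p0 1 t, OF _ _ _ arc] s p0 m True by simp
    qed (use s p0 in auto)
    then show False by (intro not_const[of "{}" p0 0]) (use p0 in auto)
  next
    case False
    then have "0 < p" using p by simp
    have "dead p"
    proof (cases "p = p0")
      case False
      show ?thesis by (rule dead_on_arc[of p p0, OF _ _ _ arc]) (use p p0 False \<open>0 < p\<close> in auto)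
    qed (use \<open>dead p0\<close> in simp)
    then have dead: "p < d" "\<And>k. k \<in> {1..m} \<Longrightarrow> Y k p = 0" "\<And>k. k \<in> {1..<m} \<Longrightarrow> L k p = 0"
      by (auto simp: dead_def)
    obtain e where e: "0 < e" "e < p" "p + e < d"
      and left: "(\<forall>t\<in>{p - e..p}. Y m t = 0) \<or> (\<forall>t\<in>{p - e..<p}. Y m t < 0)"
      by (rule locally_zero_or_negative[OF \<open>0 < p\<close> dead(1,2)])
    have neg: "Y m t < 0" if "t \<in> {p - e..<p}" for t
    proof -
      have "\<not> (\<forall>t\<in>{p - e..p}. Y m t = 0)"
      proof
        assume z: "\<forall>t\<in>{p - e..p}. Y m t = 0"
        have "Y m r = 0" if "r \<in> {p - e..p0}" for r
          using z arc that by (cases "r \<le> p") auto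
        then have "p - e \<in> B" using e p by (auto simp: B_def)
        then show False using cInf_lower[OF _ bdd, of "p - e"] e by (simp add: p_def)
      qed
      then show ?thesis using left that by metis
    qed
    \<comment> \<open>Contacts accumulate at the limit, so there is one below \<open>p - e\<close>;
      the largest contact from there up to \<open>p - e\<close> will be the end \<open>q\<close> of
      the excursion.\<close>
    obtain a0 where a0: "0 < a0" "a0 < p - e" "Y m a0 = 0"
      using accumulate[of "p - e"] e by auto
    define K where "K = {a0..p - e} \<inter> Y m -` {0}"
    have "continuous_on {a0..p - e} (Y m)"
      by (rule continuous_on_subset[OF Y_cont]) (use a0 e dead m in auto)
    then have "closed K" unfolding K_def by (rule continuous_closed_preimage) auto
    then have "compact K" using compact_Int_closed[of "{a0..p - e}" K] by (simp add: K_def Int_assoc[symmetric])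
    moreover have "a0 \<in> K" using a0 by (auto simp: K_def)
    ultimately obtain q where q: "q \<in> K" "\<And>t. t \<in> K \<Longrightarrow> t \<le> q"
      using compact_attains_sup[of K] by blast
    have q': "0 < q" "q < p" "Y m q = 0" using q(1) a0 e by (auto simp: K_def)
    have neg': "Y m t < 0" if "t \<in> {q<..<p}" for t
    proof (cases "t \<in> {p - e..<p}")
      case False
      then have "t \<notin> K" "t \<in> {a0..p - e}" using q(2)[of t] that q(1) by (auto simp: K_def)
      then have "Y m t \<noteq> 0" by (auto simp: K_def)
      then show ?thesis using Y_le[of t] that q' dead by (auto simp: less_le)
    qed (rule neg)
    \<comment> \<open>Reflection makes the excursion start at \<open>- p\<close>. The alternating
      signs compensate the change of sign of every derivative, and the additional one in
      \<open>L'\<close> preserves the sign law for \<open>Y' 0\<close>.\<close>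
    define Y' where "Y' k r = (-1) ^ (m + k) * Y k (- r)" for k r
    define L' where "L' k r = (-1) ^ (m + k + 1) * L k (- r)" for k r
    show False
    proof (rule no_excursion[of m M0 "- p" "- q" Y' L'])
      show "Y' 0 t = - M0 * sgn (L' 1 t)" for t
        by (simp add: Y'_def L'_def Y0 sgn_mult minus_one_power_iff)
      show "(Y' (k - 1) has_integral Y' k b - Y' k a) {a..b}"
        if k: "k \<in> {1..m}" and ab: "- p \<le> a" "a \<le> b" "b \<le> - q" for k a b
      proof -
        have "(Y (k - 1) has_integral Y k (- a) - Y k (- b)) {- b..- a}"
          by (rule Y_int) (use k ab q' dead in auto)
        then have "((\<lambda>r. Y (k - 1) (- r)) has_integral Y k (- a) - Y k (- b)) {a..b}"
          using has_integral_reflect_real[of "Y (k - 1)" _ "- a" "- b"] by simp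
        then have "((\<lambda>r. (-1) ^ (m + (k - 1)) * Y (k - 1) (- r)) has_integral
            (-1) ^ (m + (k - 1)) * (Y k (- a) - Y k (- b))) {a..b}"
          by (rule has_integral_mult_right)
        moreover have "(-1) ^ (m + (k - 1)) * (Y k (- a) - Y k (- b)) = Y' k b - Y' k a"
          using k by (cases k) (auto simp: Y'_def algebra_simps)
        ultimately show ?thesis by (simp add: Y'_def[abs_def])
      qed
      show "(L' (Suc k) has_integral L' k a - L' k b) {a..b}"
        if k: "k \<in> {1..<m}" and ab: "- p \<le> a" "a \<le> b" "b \<le> - q" for k a b
      proof -
        have "(L (Suc k) has_integral L k (- b) - L k (- a)) {- b..- a}"
          by (rule L_int) (use k ab q' dead in auto)
        then have "((\<lambda>r. L (Suc k) (- r)) has_integral L k (- b) - L k (- a)) {a..b}"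
          using has_integral_reflect_real[of "L (Suc k)" _ "- a" "- b"] by simp
        then have "((\<lambda>r. (-1) ^ (m + Suc k + 1) * L (Suc k) (- r)) has_integral
            (-1) ^ (m + Suc k + 1) * (L k (- b) - L k (- a))) {a..b}"
          by (rule has_integral_mult_right)
        moreover have "(-1) ^ (m + Suc k + 1) * (L k (- b) - L k (- a)) = L' k a - L' k b"
          by (simp add: L'_def algebra_simps)
        ultimately show ?thesis by (simp only: L'_def[abs_def])
      qed
      have "(-1::real) ^ (m + m + 1) = - 1" by simp
      then have eq: "- L' m t = L m (- t)" for t by (simp only: L'_def)
      \<comment> \<open>\<open>L m\<close> increases on the interval from \<open>q\<close> to
        \<open>p\<close>, so it decreases in reflected time, which already gives the required
        pattern.\<close>
      show "plus_minus (\<lambda>t. - L' m t) (- p) (- q)"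
        unfolding eq
        by (rule strict_antimono_plus_minus[of _ "- p"])
          (use q' dead in \<open>auto intro!: Lm_strict_mono neg'\<close>)
    qed (use m M0 q' dead active_stationary[of q] Y_le in \<open>auto simp: Y'_def L'_def intro!: mult_nonneg_nonpos\<close>)
  qed
qed

section \<open>Isolation of contacts and roots between them\<close>

lemma m_ge_2: "2 \<le> m"
proof (rule ccontr)
  assume "\<not> 2 \<le> m"
  then have "m = 1" using m by simp
  obtain s where "0 < s" "s < d" "Y m s = 0" using accumulate[OF d] by blast
  \<comment> \<open>For \<open>m = 1\<close> the conditions on the costates in \<open>dead\<close>
    are void, so a contact is a rest point.\<close>
  then have "dead s" using \<open>m = 1\<close> unfolding dead_def by auto
  then show False using no_dead by simp
qed

text \<open>An accumulation point of contacts is a common zero of all \<open>Y k\<close>. There the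
  local alternative turns accumulating contacts into an arc, whose end points are rest
  points.\<close>

lemma active_isolated:
  assumes p: "0 < p" "p < d"
  obtains e where "0 < e" "e < p" "p + e < d" "\<And>t. t \<in> {p - e..p + e} \<Longrightarrow> t \<noteq> p \<Longrightarrow> Y m t < 0"
proof -
  have "\<not> p islimpt {t \<in> {0<..<d}. Y m t = 0}"
  proof
    assume l: "p islimpt {t \<in> {0<..<d}. Y m t = 0}"
    have p': "p \<in> {0<..<d}" using p by simp
    have c: "continuous_on {0<..<d} (Y 1)" using Y_cont m by simp
    have zero: "Y k p = 0" if "k \<in> {1..m}" for k
      using derivative_chain_islimpt(1)[OF p' m Y_deriv c l]
        derivative_chain_islimpt(2)[OF p' m Y_deriv c l, of k] that by (cases "k = m") auto
    obtain e where e: "0 < e" "e < p" "p + e < d"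
      and r: "(\<forall>t\<in>{p..p + e}. Y m t = 0) \<or> (\<forall>t\<in>{p<..p + e}. Y m t < 0)"
      and l': "(\<forall>t\<in>{p - e..p}. Y m t = 0) \<or> (\<forall>t\<in>{p - e..<p}. Y m t < 0)"
      by (rule locally_zero_or_negative[OF p zero])
    obtain t where t: "t \<noteq> p" "dist t p < e" "Y m t = 0"
      using l e unfolding islimpt_approachable by blast
    have "t \<in> {p<..p + e} \<or> t \<in> {p - e..<p}"
      using t(1,2) by (auto simp: dist_real_def abs_if split: if_splits)
    then consider "t \<in> {p<..p + e}" | "t \<in> {p - e..<p}" by blast
    then show False
    proof cases
      case 1
      then have "\<forall>t\<in>{p..p + e}. Y m t = 0" using r t by force
      then have "dead p" by (intro dead_on_arc[of p "p + e"]) (use e p in auto)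
      then show False using no_dead by simp
    next
      case 2
      then have "\<forall>t\<in>{p - e..p}. Y m t = 0" using l' t by force
      then have "dead p" by (intro dead_on_arc[of "p - e" p]) (use e p in auto)
      then show False using no_dead by simp
    qed
  qed
  then obtain e' where "0 < e'" "\<not> (\<exists>t\<in>{t \<in> {0<..<d}. Y m t = 0}. t \<noteq> p \<and> dist t p < e')"
    unfolding islimpt_approachable by blast
  then have e': "0 < e'" "\<And>t. t \<in> {0<..<d} \<Longrightarrow> Y m t = 0 \<Longrightarrow> t \<noteq> p \<Longrightarrow> e' \<le> dist t p"
    by (auto simp: not_less)
  define e where "e = min e' (min p (d - p)) / 2"
  have e: "0 < e" "e < e'" "e < p" "p + e < d" using e' p by (auto simp: e_def min_def field_simps)
  show thesis
  proof (rule that[OF e(1,3,4)])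
    fix t assume t: "t \<in> {p - e..p + e}" "t \<noteq> p"
    then have "t \<in> {0<..<d}" "dist t p < e'" using e p by (auto simp: dist_real_def)
    then show "Y m t < 0" using e'(2)[of t] t Y_le[of t] by (auto simp: less_le)
  qed
qed

lemma finite_active:
  assumes "0 < a" "b < d"
  shows "finite {t \<in> {a..b}. Y m t = 0}"
proof (rule ccontr)
  assume inf: "infinite {t \<in> {a..b}. Y m t = 0}"
  obtain p where p: "p \<in> {a..b}" "p islimpt {t \<in> {a..b}. Y m t = 0}"
    using Heine_Borel_imp_Bolzano_Weierstrass[OF compact_Icc inf] by blast
  have "0 < p" "p < d" using p(1) assms by auto
  then obtain e where e: "0 < e" "\<And>t. t \<in> {p - e..p + e} \<Longrightarrow> t \<noteq> p \<Longrightarrow> Y m t < 0"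
    by (rule active_isolated) (rule that)
  obtain t where t: "t \<noteq> p" "dist t p < e" "Y m t = 0"
    using p(2) e unfolding islimpt_approachable by blast
  then have "t \<in> {p - e..p + e}" by (auto simp: dist_real_def)
  then show False using e(2)[of t] t by simp
qed

lemma L_cont_between:
  assumes pq: "0 \<le> p" "q \<le> d" and neg: "\<And>t. t \<in> {p<..<q} \<Longrightarrow> Y m t < 0"
    and k: "k \<in> {1..m}"
  shows "continuous_on {p<..<q} (L k)"
  proof (cases "k = m")
    case True
    have "continuous_on {p<..<q} (L m)"
    proof (rule continuous_at_imp_continuous_on, rule ballI)
      fix t assume t: "t \<in> {p<..<q}"
      have lip: "dist (L m s) (L m t) \<le> C * dist s t" if s: "s \<in> {p<..<q}" for s
        using Lm_eq[of s t] Lm_eq[of t s] G_lip[of s t] G_lip[of t s] s t pq neg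
        by (cases "s \<le> t") (auto simp: dist_real_def)
      have "((\<lambda>s. C * dist s t) \<longlongrightarrow> C * dist t t) (at t)" by (intro tendsto_intros)
      then have l0: "((\<lambda>s. C * dist s t) \<longlongrightarrow> 0) (at t)" by simp
      have "\<forall>\<^sub>F s in at t. s \<in> {p<..<q}" using t by (intro eventually_at_in_open') auto
      then have "\<forall>\<^sub>F s in at t. dist (L m s) (L m t) \<le> C * dist s t" by eventually_elim (rule lip)
      then have "((\<lambda>s. dist (L m s) (L m t)) \<longlongrightarrow> 0) (at t)"
        by (intro tendsto_sandwich[OF _ _ tendsto_const l0]) auto
      then show "isCont (L m) t" unfolding isCont_def by (subst tendsto_dist_iff)
    qed
    then show ?thesis using True by simp
  next
    case False
    then show ?thesis using k pq by (intro continuous_on_subset[OF L_cont]) auto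
  qed

text \<open>Between two active points, \<open>L m\<close> is strictly increasing, and Rolle's theorem gives one more
  root for each integration.\<close>

lemma card_zeros_L:
  assumes pq: "0 \<le> p" "p < q" "q \<le> d" and neg: "\<And>t. t \<in> {p<..<q} \<Longrightarrow> Y m t < 0"
    and k: "k \<in> {1..m}"
  shows "finite {t \<in> {p<..<q}. L k t = 0}" "card {t \<in> {p<..<q}. L k t = 0} \<le> m - k + 1"
proof -
  have mono: "L m s < L m t" if "p < s" "s < t" "t < q" for s t
    by (rule Lm_strict_mono) (use that pq neg in auto)
  have cont: "continuous_on {p<..<q} (L k)" if "k \<in> {1..m}" for k
    by (rule L_cont_between[OF pq(1,3) neg that])
  have "finite {t \<in> {p<..<q}. L (m - j) t = 0} \<and> card {t \<in> {p<..<q}. L (m - j) t = 0} \<le> Suc j"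
    if "j < m" for j
    using that
  proof (induction j)
    case 0
    have "s = t" if "s \<in> {t \<in> {p<..<q}. L m t = 0}" "t \<in> {t \<in> {p<..<q}. L m t = 0}" for s t
      using mono[of s t] mono[of t s] that by (cases s t rule: linorder_cases) auto
    then have sub: "{t \<in> {p<..<q}. L m t = 0} \<subseteq> {SOME t. t \<in> {t \<in> {p<..<q}. L m t = 0}}"
      by (metis (no_types, lifting) singletonI someI subsetI)
    show ?case using card_mono[OF _ sub] finite_subset[OF sub] by simp
  next
    case (Suc j)
    have eq: "Suc (m - Suc j) = m - j" using Suc.prems by auto
    show ?case
    proof (rule card_zeros_primitive)
      fix t assume "t \<in> {p<..<q}"
      then show "(L (m - Suc j) has_real_derivative - L (m - j) t) (at t)"
        using L_deriv[of "m - Suc j" p q t] cont[of "m - j"] Suc.prems pq eq by auto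
    qed (use Suc in auto)
  qed
  note * = this[of "m - k"]
  have "m - (m - k) = k" "m - k < m" using k by auto
  with * have "finite {t \<in> {p<..<q}. L k t = 0} \<and> card {t \<in> {p<..<q}. L k t = 0} \<le> Suc (m - k)"
    by simp
  then show "finite {t \<in> {p<..<q}. L k t = 0}" "card {t \<in> {p<..<q}. L k t = 0} \<le> m - k + 1"
    by simp_all
qed

end

lemma nonvanishing_sign:
  fixes f :: "real \<Rightarrow> real"
  assumes "continuous_on {p<..<q} f" "\<And>t. t \<in> {p<..<q} \<Longrightarrow> f t \<noteq> 0"
  shows "(\<forall>t\<in>{p<..<q}. 0 < f t) \<or> (\<forall>t\<in>{p<..<q}. f t < 0)"
proof (rule ccontr)
  assume "\<not> ?thesis"
  then obtain s t where st: "s \<in> {p<..<q}" "t \<in> {p<..<q}" "f s \<le> 0" "0 \<le> f t" by force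
  have "connected (f ` {p<..<q})" using assms(1) by (rule connected_continuous_image) simp
  then have "{f s..f t} \<subseteq> f ` {p<..<q}" using st by (intro connected_contains_Icc) auto
  then have "0 \<in> f ` {p<..<q}" using st by auto
  then show False using assms(2) by auto
qed

text \<open>Next to an end point there is an interval without zeros, reaching to the nearest zero or
  to the other end point.\<close>

lemma finite_zeros_germs:
  fixes f :: "real \<Rightarrow> real"
  assumes pq: "p < q" and cont: "continuous_on {p<..<q} f" and fin: "finite {t \<in> {p<..<q}. f t = 0}"
  shows "(\<forall>\<^sub>F t in at_right p. 0 < f t) \<or> (\<forall>\<^sub>F t in at_right p. f t < 0)"
    and "(\<forall>\<^sub>F t in at_left q. 0 < f t) \<or> (\<forall>\<^sub>F t in at_left q. f t < 0)"
proof -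
  define Z where "Z = insert p (insert q {t \<in> {p<..<q}. f t = 0})"
  have Z: "finite Z" "\<And>z. z \<in> Z \<Longrightarrow> p \<le> z \<and> z \<le> q" using fin pq by (auto simp: Z_def)
  define r where "r = Min (Z - {p})"
  have "r \<in> Z - {p}" unfolding r_def using Z(1) pq by (intro Min_in) (auto simp: Z_def)
  then have r: "p < r" "r \<le> q" using Z(2)[of r] by auto
  have "f t \<noteq> 0" if "t \<in> {p<..<r}" for t
  proof
    assume "f t = 0"
    then have "t \<in> Z - {p}" using that r by (auto simp: Z_def)
    then have "r \<le> t" unfolding r_def using Z(1) by (intro Min_le) auto
    then show False using that by simp
  qed
  moreover have "continuous_on {p<..<r} f" by (rule continuous_on_subset[OF cont]) (use r in auto)
  ultimately have "(\<forall>t\<in>{p<..<r}. 0 < f t) \<or> (\<forall>t\<in>{p<..<r}. f t < 0)" by (intro nonvanishing_sign)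
  then show "(\<forall>\<^sub>F t in at_right p. 0 < f t) \<or> (\<forall>\<^sub>F t in at_right p. f t < 0)"
    using r(1) unfolding eventually_at_right_field by (metis greaterThanLessThan_iff)
  define l where "l = Max (Z - {q})"
  have "l \<in> Z - {q}" unfolding l_def using Z(1) pq by (intro Max_in) (auto simp: Z_def)
  then have l: "p \<le> l" "l < q" using Z(2)[of l] by auto
  have "f t \<noteq> 0" if "t \<in> {l<..<q}" for t
  proof
    assume "f t = 0"
    then have "t \<in> Z - {q}" using that l by (auto simp: Z_def)
    then have "t \<le> l" unfolding l_def using Z(1) by (intro Max_ge) auto
    then show False using that by simp
  qed
  moreover have "continuous_on {l<..<q} f" by (rule continuous_on_subset[OF cont]) (use l in auto)
  ultimately have "(\<forall>t\<in>{l<..<q}. 0 < f t) \<or> (\<forall>t\<in>{l<..<q}. f t < 0)" by (intro nonvanishing_sign)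
  then show "(\<forall>\<^sub>F t in at_left q. 0 < f t) \<or> (\<forall>\<^sub>F t in at_left q. f t < 0)"
    using l(2) unfolding eventually_at_left_field by (metis greaterThanLessThan_iff)
qed

section \<open>Sign changes of the costates\<close>

context local_chattering
begin

text \<open>Contacts are isolated and roots between them are finite in number, so on each side of
  \<open>s\<close> there is an interval free of both.\<close>

lemma L_germs:
  assumes s: "0 < s" "s < d" and k: "k \<in> {1..m}"
  shows "(\<forall>\<^sub>F t in at_right s. 0 < L k t) \<or> (\<forall>\<^sub>F t in at_right s. L k t < 0)"
    and "(\<forall>\<^sub>F t in at_left s. 0 < L k t) \<or> (\<forall>\<^sub>F t in at_left s. L k t < 0)"
proof -
  obtain e where e: "0 < e" "e < s" "s + e < d"
    and neg: "\<And>t. t \<in> {s - e..s + e} \<Longrightarrow> t \<noteq> s \<Longrightarrow> Y m t < 0"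
    by (rule active_isolated[OF s], rule that)
  have r: "Y m t < 0" if "t \<in> {s<..<s + e}" for t using neg that e by simp
  have l: "Y m t < 0" if "t \<in> {s - e<..<s}" for t using neg that e by simp
  show "(\<forall>\<^sub>F t in at_right s. 0 < L k t) \<or> (\<forall>\<^sub>F t in at_right s. L k t < 0)"
    by (rule finite_zeros_germs(1)[OF _ L_cont_between[OF _ _ r k] card_zeros_L(1)[OF _ _ _ r k]])
      (use e s in auto)
  show "(\<forall>\<^sub>F t in at_left s. 0 < L k t) \<or> (\<forall>\<^sub>F t in at_left s. L k t < 0)"
    by (rule finite_zeros_germs(2)[OF _ L_cont_between[OF _ _ l k] card_zeros_L(1)[OF _ _ _ l k]])
      (use e s in auto)
qed

text \<open>On either side of \<open>s\<close>, up to the next contact, \<open>L m\<close> differs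
  from the continuous \<open>G\<close> by a constant; \<open>Lm_le\<close> across \<open>s\<close>
  compares the two constants.\<close>

lemma Lm_limits:
  assumes s: "0 < s" "s < d"
  obtains l r where "(L m \<longlongrightarrow> l) (at_left s)" "(L m \<longlongrightarrow> r) (at_right s)" "r \<le> l"
proof -
  obtain e where e: "0 < e" "e < s" "s + e < d"
    and neg: "\<And>t. t \<in> {s - e..s + e} \<Longrightarrow> t \<noteq> s \<Longrightarrow> Y m t < 0"
    by (rule active_isolated[OF s], rule that)
  have "(G \<longlongrightarrow> G s) (at s)"
  proof -
    have lip: "dist (G t) (G s) \<le> C * dist t s" if "t \<in> {0<..<d}" for t
      using G_lip[of s t] G_lip[of t s] that s by (cases "s \<le> t") (auto simp: dist_real_def)
    have "((\<lambda>t. C * dist t s) \<longlongrightarrow> C * dist s s) (at s)" by (intro tendsto_intros)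
    then have l0: "((\<lambda>t. C * dist t s) \<longlongrightarrow> 0) (at s)" by simp
    have "\<forall>\<^sub>F t in at s. t \<in> {0<..<d}" using s by (intro eventually_at_in_open') auto
    then have "\<forall>\<^sub>F t in at s. dist (G t) (G s) \<le> C * dist t s" by eventually_elim (rule lip)
    then have "((\<lambda>t. dist (G t) (G s)) \<longlongrightarrow> 0) (at s)"
      by (intro tendsto_sandwich[OF _ _ tendsto_const l0]) auto
    then show ?thesis by (subst tendsto_dist_iff)
  qed
  then have Gl: "(G \<longlongrightarrow> G s) (at_left s)" and Gr: "(G \<longlongrightarrow> G s) (at_right s)"
    by (auto intro: tendsto_within_subset)
  define p where "p = s - e"
  define q where "q = s + e"
  have "\<forall>\<^sub>F t in at_left s. t \<in> {p<..<s}" using e by (intro eventually_at_left_real) (simp add: p_def)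
  moreover have "L m p - G p + G t = L m t" if "t \<in> {p<..<s}" for t
  proof -
    have "L m t - L m p = G t - G p" by (rule Lm_eq) (use that e s neg in \<open>auto simp: p_def\<close>)
    then show ?thesis by simp
  qed
  ultimately have "\<forall>\<^sub>F t in at_left s. L m p - G p + G t = L m t" by (simp add: eventually_mono)
  moreover have "((\<lambda>t. L m p - G p + G t) \<longlongrightarrow> L m p - G p + G s) (at_left s)"
    by (intro tendsto_intros Gl)
  ultimately have l: "(L m \<longlongrightarrow> L m p - G p + G s) (at_left s)" by (rule Lim_transform_eventually[rotated])
  have "\<forall>\<^sub>F t in at_right s. t \<in> {s<..<q}" using e by (intro eventually_at_right_real) (simp add: q_def)
  moreover have "L m q - G q + G t = L m t" if "t \<in> {s<..<q}" for t
  proof -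
    have "L m q - L m t = G q - G t" by (rule Lm_eq) (use that e s neg in \<open>auto simp: q_def\<close>)
    then show ?thesis by simp
  qed
  ultimately have "\<forall>\<^sub>F t in at_right s. L m q - G q + G t = L m t" by (simp add: eventually_mono)
  moreover have "((\<lambda>t. L m q - G q + G t) \<longlongrightarrow> L m q - G q + G s) (at_right s)"
    by (intro tendsto_intros Gr)
  ultimately have r: "(L m \<longlongrightarrow> L m q - G q + G s) (at_right s)" by (rule Lim_transform_eventually[rotated])
  show thesis
    by (rule that[OF l r]) (use Lm_le[of p q] e s in \<open>simp add: p_def q_def\<close>)
qed

text \<open>Otherwise \<open>L k\<close> would have constant sign off a countable set, against
  \<open>no_eventually_const_sgn\<close>.\<close>

lemma ex_crossing:
  assumes k: "k \<in> {1..m}" and e: "0 < e"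
  shows "\<exists>s. 0 < s \<and> s < e \<and> s < d \<and> crosses_zero (L k) s"
proof (rule ccontr)
  assume no: "\<not> ?thesis"
  obtain c N where "countable N" "\<And>s. s \<in> {0<..<min e d} - N \<Longrightarrow> sgn (L k s) = c"
  proof (rule no_crossing_sgn_const[of 0 "min e d" "L k"])
    show "0 < min e d" using e d by simp
  qed (use no L_germs[OF _ _ k] in auto)
  then show False using no_eventually_const_sgn[of k N "min e d" c] k e d by auto
qed

lemma infinite_crossings:
  assumes k: "k \<in> {1..m}" and e: "0 < e" "e \<le> d"
  shows "infinite {s \<in> {0<..<e}. crosses_zero (L k) s}" (is "infinite ?A")
proof
  assume fin: "finite ?A"
  define r where "r = Min (insert e ?A)"
  have "r \<in> insert e ?A" unfolding r_def using fin by (intro Min_in) auto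
  then have "0 < r" "r \<le> e" using e by auto
  then obtain s where s: "0 < s" "s < r" "crosses_zero (L k) s" using ex_crossing[OF k] by blast
  then have "r \<le> s" unfolding r_def using fin \<open>r \<le> e\<close> by (intro Min_le) auto
  then show False using s by simp
qed

text \<open>This replaces a zero value of \<open>L k\<close> at the limit, where nothing is known
  about the costates yet: comparison with nearby points of either sign bounds \<open>L k\<close>
  from both sides.\<close>

lemma ex_neg_pos:
  assumes k: "k \<in> {1..m}" and e: "0 < e"
  obtains s t where "0 < s" "s < e" "s < d" "L k s < 0" "0 < t" "t < e" "t < d" "0 < L k t"
proof -
  obtain s where s: "0 < s" "s < e" "s < d" "crosses_zero (L k) s" using ex_crossing[OF k e] by blast
  have l: "\<forall>\<^sub>F t in at_left s. 0 < t \<and> t < e \<and> t < d"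
    using eventually_at_left_real[OF s(1)] by eventually_elim (use s in auto)
  have "s < min e d" using s by simp
  from eventually_at_right_real[OF this] have r: "\<forall>\<^sub>F t in at_right s. 0 < t \<and> t < e \<and> t < d"
    by eventually_elim (use s in auto)
  have ex: "\<exists>t. P t \<and> 0 < t \<and> t < e \<and> t < d" if "(\<forall>\<^sub>F t in at_left s. P t) \<or> (\<forall>\<^sub>F t in at_right s. P t)" for P
    using that
  proof
    assume "\<forall>\<^sub>F t in at_left s. P t"
    then have "\<forall>\<^sub>F t in at_left s. P t \<and> 0 < t \<and> t < e \<and> t < d" using l by (rule eventually_conj)
    then show ?thesis using eventually_happens trivial_limit_at_left_real by blast
  next
    assume "\<forall>\<^sub>F t in at_right s. P t"
    then have "\<forall>\<^sub>F t in at_right s. P t \<and> 0 < t \<and> t < e \<and> t < d" using r by (rule eventually_conj)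
    then show ?thesis using eventually_happens trivial_limit_at_right_real by blast
  qed
  have "\<exists>t. L k t < 0 \<and> 0 < t \<and> t < e \<and> t < d" "\<exists>t. 0 < L k t \<and> 0 < t \<and> t < e \<and> t < d"
    by (rule ex; use s(4) in \<open>auto simp: crosses_zero_def\<close>)+
  then show thesis using that by blast
qed

section \<open>Orders of magnitude near the limit\<close>

lemma Y_bound:
  assumes "k \<le> m" "0 \<le> s" "s < d"
  shows "\<bar>Y k s\<bar> \<le> M0 * s ^ k"
  using assms
proof (induction k arbitrary: s)
  case 0
  then show ?case using M0 by (auto simp: Y0 sgn_if abs_mult)
next
  case (Suc k)
  have "norm (Y (Suc k) s - Y (Suc k) 0) \<le> (M0 * s ^ k) * measure lborel {0..s}"
  proof (rule has_integral_bound_real[of _ "{}"])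
    show "(Y k has_integral Y (Suc k) s - Y (Suc k) 0) {0..s}" using Y_int[of "Suc k" 0 s] Suc.prems by auto
    show "norm (Y k t) \<le> M0 * s ^ k" if "t \<in> {0..s} - {}" for t
    proof -
      have "\<bar>Y k t\<bar> \<le> M0 * t ^ k" using Suc that by auto
      also have "\<dots> \<le> M0 * s ^ k" using M0 that by (intro mult_left_mono power_mono) auto
      finally show ?thesis by simp
    qed
  qed (use M0 Suc in auto)
  then show ?case using Y_zero[of "Suc k"] Suc.prems by (simp add: algebra_simps)
qed

lemma C_pos: "0 < C"
proof -
  have "0 < G (d / 2) - G (d / 3)" using G_strict_mono[of "d / 3" "d / 2"] d by simp
  also have "\<dots> \<le> \<bar>G (d / 2) - G (d / 3)\<bar>" by simp
  also have "\<dots> \<le> C * (d / 2 - d / 3)" by (rule G_lip) (use d in auto)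
  finally show ?thesis using d by (simp add: zero_less_mult_iff)
qed

text \<open>The estimate is one-sided because \<open>L m\<close> may drop at contacts but rises only
  through \<open>G\<close>.\<close>

lemma Lm_upper_lip:
  assumes "0 < a" "a \<le> b" "b < d"
  shows "L m b \<le> L m a + C * (b - a)"
  using Lm_le[OF assms] G_lip[OF assms] by linarith

lemma Lm_upper:
  assumes s: "0 < s" "s < d"
  shows "L m s \<le> C * s"
proof -
  obtain r where r: "0 < r" "r < s" "L m r < 0"
    by (rule ex_neg_pos[of m s]) (use m s that in auto)
  have "L m s \<le> L m r + C * (s - r)" by (rule Lm_upper_lip) (use r s in auto)
  also have "\<dots> \<le> C * s" using r mult_pos_pos[OF C_pos r(1)] by (simp add: algebra_simps)
  finally show ?thesis .
qed

text \<open>\<open>L k\<close> takes both signs before \<open>s\<close>, and its variation there is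
  at most the bound for \<open>L (Suc k)\<close> times \<open>s\<close>, so no starting value is
  needed.\<close>

lemma L_bound_step:
  assumes k: "k \<in> {1..<m}" and e: "e < d" and B: "0 \<le> B"
    and bd: "\<And>s. 0 < s \<Longrightarrow> s \<le> e \<Longrightarrow> \<bar>L (Suc k) s\<bar> \<le> B * s ^ j"
    and s: "0 < s" "s \<le> e"
  shows "\<bar>L k s\<bar> \<le> B * s ^ Suc j"
proof -
  obtain r t where r: "0 < r" "r < s" "L k r < 0" and t: "0 < t" "t < s" "0 < L k t"
    by (rule ex_neg_pos[of k s]) (use k s that in auto)
  have lip: "\<bar>L k s - L k r\<bar> \<le> B * s ^ Suc j" if r: "0 < r" "r < s" for r
  proof -
    have "norm (L k r - L k s) \<le> (B * s ^ j) * measure lborel {r..s}"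
    proof (rule has_integral_bound_real[of _ "{}"])
      show "(L (Suc k) has_integral L k r - L k s) {r..s}" using L_int[OF k, of r s] r s e by auto
      show "norm (L (Suc k) t) \<le> B * s ^ j" if "t \<in> {r..s} - {}" for t
      proof -
        have "\<bar>L (Suc k) t\<bar> \<le> B * t ^ j" using bd[of t] that r s by auto
        also have "\<dots> \<le> B * s ^ j" using B that r by (intro mult_left_mono power_mono) auto
        finally show ?thesis by simp
      qed
    qed (use B s in auto)
    also have "\<dots> \<le> B * s ^ j * s" using r B s by (intro mult_left_mono) auto
    finally show ?thesis by (simp add: abs_minus_commute mult_ac)
  qed
  show ?thesis using lip[OF r(1,2)] lip[OF t(1,2)] r t by linarith
qed

lemma L_bound:
  assumes e: "e < d" and B: "0 \<le> B"
    and bd: "\<And>s. 0 < s \<Longrightarrow> s \<le> e \<Longrightarrow> \<bar>L m s\<bar> \<le> B * s ^ j"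
    and k: "k \<in> {1..m}" and s: "0 < s" "s \<le> e"
  shows "\<bar>L k s\<bar> \<le> B * s ^ (m - k + j)"
proof -
  have "\<forall>s. 0 < s \<and> s \<le> e \<longrightarrow> \<bar>L (m - i) s\<bar> \<le> B * s ^ (i + j)" if "i < m" for i
    using that
  proof (induction i)
    case (Suc i)
    then have "Suc (m - Suc i) = m - i" by auto
    then show ?case
      using L_bound_step[of "m - Suc i" e B "i + j"] Suc e B by auto
  qed (use bd in auto)
  note * = this[of "m - k"]
  have "m - (m - k) = k" "m - k < m" using k by auto
  with * s show ?thesis by simp
qed

text \<open>If \<open>L m\<close> were below \<open>- K e\<close> at \<open>e\<close>, it would stay negative on an interval much longer than
  \<open>e\<close>, along which \<open>L\<close> and \<open>Y\<close> forget their values at \<open>e\<close> and acquire the sign pattern that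
  \<open>no_excursion\<close> forbids before the next active point.\<close>

lemma Lm_lower:
  obtains K s0 where "0 < K" "0 < s0" "s0 < d" "\<And>s. 0 < s \<Longrightarrow> s \<le> s0 \<Longrightarrow> - K * s \<le> L m s"
proof -
  \<comment> \<open>The positive value at \<open>s0\<close> forces \<open>L m\<close> to turn
    positive no later than that, and the contact \<open>a0\<close> ensures that the excursion which
    follows has an end.\<close>
  obtain a0 where a0: "0 < a0" "a0 < d" "Y m a0 = 0" using accumulate[OF d] by blast
  obtain s0 where s0: "0 < s0" "s0 < a0" "s0 < d" "0 < L m s0"
    by (rule ex_neg_pos[of m a0]) (use m a0 that in auto)
  \<comment> \<open>Chosen for both applications of the growth lemma: the ratio of \<open>B\<close>
    to \<open>h\<close> is \<open>4\<close> for the costates, at level \<open>m - 1\<close>, and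
    \<open>1\<close> for the states, at level \<open>m\<close>.\<close>
  define R :: real where "R = 3 + 4 * (2 ^ m * fact m * real m)"
  have R: "2 \<le> R" "4 * (2 ^ m * fact m * real m) < R" by (auto simp: R_def)
  \<comment> \<open>When \<open>l\<close> exceeds \<open>K * e\<close>, the first summand gives
    \<open>R * (R * e) \<le> l / (2 * C)\<close> and the second \<open>C * e < l\<close>.\<close>
  define K where "K = 2 * C * R * R + C"
  have K: "C \<le> K" "0 < K" "2 * C * (R * R) \<le> K" using C_pos R by (auto simp: K_def intro!: add_nonneg_pos)
  have main: "- K * e \<le> L m e" if e: "0 < e" "e \<le> s0" for e
  proof (rule ccontr)
    assume "\<not> - K * e \<le> L m e"
    define l where "l = - L m e"
    have l: "K * e < l" using \<open>\<not> - K * e \<le> L m e\<close> by (simp add: l_def)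
    have "C * e \<le> K * e" "0 < K * e" using K e by (auto intro!: mult_right_mono)
    then have l0: "0 < l" "C * e < l" using l by linarith+
    \<comment> \<open>Rising from \<open>- l\<close> at most at the rate \<open>C\<close>,
      \<open>L m\<close> needs at least the time \<open>l / (2 * C)\<close> to reach
      \<open>- l / 2\<close>.\<close>
    define S where "S = e + l / (2 * C)"
    have low: "L m t \<le> - (l / 2)" if "t \<in> {e..S}" "t < d" for t
    proof -
      have "L m t \<le> L m e + C * (t - e)" by (rule Lm_upper_lip) (use that e in auto)
      also have "\<dots> \<le> - l + C * (l / (2 * C))"
        using that C_pos unfolding l_def S_def by (intro add_mono mult_left_mono) auto
      also have "\<dots> = - (l / 2)" using C_pos by (simp add: field_simps)
      finally show ?thesis .
    qed
    have "S < s0" using low[of s0] s0 e l0 by (force simp: not_less)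
    have "e < S" using l0 C_pos by (simp add: S_def)
    have "R * (R * e) * (2 * C) \<le> K * e" using mult_right_mono[OF K(3), of e] e by (simp add: algebra_simps)
    then have "R * (R * e) * (2 * C) \<le> l" using l by linarith
    then have "R * (R * e) \<le> l / (2 * C)" using C_pos by (simp add: pos_le_divide_eq)
    then have RRS: "R * (R * e) \<le> S" using e by (simp add: S_def)
    have "1 \<le> R" using R by simp
    then have Re: "0 < R * e" "e \<le> R * e" "R * e \<le> R * (R * e)"
      using e mult_right_mono[of 1 R e] mult_right_mono[of 1 R "R * e"] by auto
    \<comment> \<open>With these signs \<open>W\<close> is a chain of iterated primitives over
      \<open>- L m\<close>, which is at least \<open>l / 2\<close> on \<open>{e..S}\<close>.\<close>
    define W where "W i t = - ((-1) ^ i * L (m - i) t)" for i t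
    have W_pos: "0 < W i t" if "i \<le> m - 1" "R * e \<le> t" "t \<le> S" for i t
    proof (rule iterated_integral_pos[where j = "m - 1" and W = W and e = e and B = "2 * l" and h = "l / 2" and S = S and R = R])
      show "(W i has_integral W (Suc i) b - W (Suc i) a) {a..b}"
        if "i < m - 1" "e \<le> a" "a \<le> b" "b \<le> S" for i a b
      proof -
        have "Suc (m - Suc i) = m - i" using that by auto
        then have "(L (m - i) has_integral L (m - Suc i) a - L (m - Suc i) b) {a..b}"
          using L_int[of "m - Suc i" a b] that e \<open>S < s0\<close> s0 by auto
        from has_integral_mult_right[OF this, of "- ((-1) ^ i)"]
        show ?thesis by (simp add: W_def[abs_def] algebra_simps)
      qed
      show "l / 2 \<le> W 0 s" if "s \<in> {e..S}" for s
        using low[OF that] that \<open>S < s0\<close> s0 by (simp add: W_def)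
      \<comment> \<open>From above, \<open>L m\<close> is at most \<open>C * e\<close>. From below,
        it has to reach \<open>- l\<close> at \<open>e\<close> rising at most at the rate
        \<open>C\<close>, so it was not under \<open>- l - C * e\<close> before. Both are within
        \<open>2 * l\<close>.\<close>
      have bd: "\<bar>L m s\<bar> \<le> (2 * l) * s ^ 0" if "0 < s" "s \<le> e" for s
      proof -
        have "L m s \<le> C * s" by (rule Lm_upper) (use that e s0 in auto)
        also have "\<dots> \<le> C * e" using C_pos that by simp
        finally have 1: "L m s \<le> 2 * l" using l0 by simp
        have "L m e \<le> L m s + C * (e - s)" by (rule Lm_upper_lip) (use that e s0 in auto)
        moreover have "C * (e - s) \<le> C * e" using C_pos that by simp
        ultimately have "- (2 * l) \<le> L m s" using l0 by (simp add: l_def)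
        then show ?thesis using 1 by simp
      qed
      show "- (2 * l) * e ^ i \<le> W i e" if "i \<in> {1..m - 1}" for i
      proof -
        have "m - (m - i) = i" using that by auto
        then have "\<bar>L (m - i) e\<bar> \<le> (2 * l) * e ^ i"
          using L_bound[where e = e and B = "2 * l" and j = 0 and k = "m - i" and s = e, OF _ _ bd] that e s0 l0
          by auto
        moreover have "\<bar>W i e\<bar> = \<bar>L (m - i) e\<bar>" by (simp add: W_def abs_mult)
        ultimately show ?thesis by linarith
      qed
      have "2 ^ (m - 1) * fact (m - 1) * real (m - 1) \<le> 2 ^ m * fact m * real m"
        by (intro mult_mono power_increasing fact_mono) auto
      then have "4 * (2 ^ (m - 1) * fact (m - 1) * real (m - 1)) < R" using R(2) by linarith
      then have "4 * (2 ^ (m - 1) * fact (m - 1) * real (m - 1)) * (l / 2) < R * (l / 2)"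
        using l0 by (intro mult_strict_right_mono) auto
      then show "2 ^ (m - 1) * fact (m - 1) * real (m - 1) * (2 * l) < l / 2 * R"
        by (simp add: algebra_simps)
    qed (use that e l0 R in auto)
    \<comment> \<open>From \<open>R * e\<close> on, \<open>L 1\<close> has a settled sign, so the
      control is constant and drives the states; \<open>Y_bound\<close> limits the values from which
      they start.\<close>
    define V where "V k t = (-1) ^ (m - 1) * Y k t" for k t
    have V_pos: "0 < V k t" if "k \<le> m" "R * (R * e) \<le> t" "t \<le> S" for k t
    proof (rule iterated_integral_pos[where j = m and W = V and e = "R * e" and B = M0 and h = M0 and S = S and R = R])
      show "(V i has_integral V (Suc i) b - V (Suc i) a) {a..b}"
        if "i < m" "R * e \<le> a" "a \<le> b" "b \<le> S" for i a b
      proof -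
        have "(Y i has_integral Y (Suc i) b - Y (Suc i) a) {a..b}"
          using Y_int[of "Suc i" a b] that Re e \<open>S < s0\<close> s0 by auto
        from has_integral_mult_right[OF this, of "(-1) ^ (m - 1)"]
        show ?thesis by (simp add: V_def[abs_def] algebra_simps)
      qed
      show "M0 \<le> V 0 s" if "s \<in> {R * e..S}" for s
      proof -
        have "m - (m - 1) = 1" using m by simp
        then have "0 < - ((-1) ^ (m - 1) * L 1 s)" using W_pos[of "m - 1" s] that by (simp add: W_def)
        then show ?thesis using M0
          by (cases "even (m - 1)") (auto simp: V_def Y0 minus_one_power_iff sgn_if split: if_splits)
      qed
      show "- M0 * (R * e) ^ i \<le> V i (R * e)" if "i \<in> {1..m}" for i
      proof -
        have "\<bar>Y i (R * e)\<bar> \<le> M0 * (R * e) ^ i"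
          by (rule Y_bound) (use that Re RRS \<open>S < s0\<close> s0 in auto)
        moreover have "\<bar>V i (R * e)\<bar> = \<bar>Y i (R * e)\<bar>" by (simp add: V_def abs_mult)
        ultimately show ?thesis by linarith
      qed
      have "0 \<le> 2 ^ m * fact m * real m" by simp
      then have "2 ^ m * fact m * real m < R" using R by linarith
      then have "2 ^ m * fact m * real m * M0 < R * M0" using M0 by (rule mult_strict_right_mono)
      then show "2 ^ m * fact m * real m * M0 < M0 * R" by (simp add: mult.commute)
    qed (use that Re M0 R in auto)
    define p where "p = R * (R * e)"
    have p: "0 < p" "p \<le> S" "e \<le> p" using Re RRS e unfolding p_def by linarith+
    \<comment> \<open>The infimum \<open>s1\<close> marks where \<open>L m\<close> first turns
      positive after \<open>S\<close>; drops at intermediate contacts are possible.\<close>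
    define E where "E = {t \<in> {S..s0}. 0 < L m t}"
    define s1 where "s1 = Inf E"
    have ne: "s0 \<in> E" using s0 \<open>S < s0\<close> by (auto simp: E_def)
    have bdd: "bdd_below E" by (rule bdd_belowI[of _ S]) (auto simp: E_def)
    have s1: "S \<le> s1" "s1 \<le> s0"
      unfolding s1_def using ne cInf_lower[OF ne bdd] by (auto intro!: cInf_greatest simp: E_def)
    have below: "L m t \<le> 0" if "t \<in> {S..<s1}" for t
    proof -
      have "t \<notin> E" using cInf_lower[OF _ bdd, of t] that by (auto simp: s1_def)
      then show ?thesis using that s1 by (auto simp: E_def)
    qed
    have s1_notin: "s1 \<notin> E"
    proof
      assume "s1 \<in> E"
      then have pos: "0 < L m s1" by (simp add: E_def)
      then have "S < s1" using s1 low[of S] \<open>e < S\<close> \<open>S < s0\<close> s0 l0 by (cases "s1 = S") auto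
      \<comment> \<open>Stepping back by at most \<open>L m s1 / (2 * C)\<close> lowers
        \<open>L m\<close> by at most half of its value at \<open>s1\<close>, so it would be
        positive already before \<open>s1\<close>.\<close>
      define t where "t = max S (s1 - L m s1 / (2 * C))"
      have t: "S \<le> t" "t < s1" "s1 - t \<le> L m s1 / (2 * C)"
        using pos C_pos \<open>S < s1\<close> by (auto simp: t_def)
      have "L m s1 \<le> L m t + C * (s1 - t)"
        by (rule Lm_upper_lip) (use t p s1 s0 in auto)
      also have "\<dots> \<le> 0 + C * (L m s1 / (2 * C))"
        using below[of t] t C_pos by (intro add_mono mult_left_mono) auto
      also have "\<dots> = L m s1 / 2" using C_pos by simp
      finally show False using pos by simp
    qed
    \<comment> \<open>\<open>s1\<close> may itself be a contact and is removed: \<open>q\<close> has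
      to be the first contact strictly after it.\<close>
    define A where "A = {t \<in> {s1..a0}. Y m t = 0} - {s1}"
    define q where "q = Min A"
    have A: "finite A" "a0 \<in> A"
      unfolding A_def using finite_active[of s1 a0] s1 s0 p a0 by auto
    then have "q \<in> A" unfolding q_def by (intro Min_in) auto
    then have q: "s1 < q" "q \<le> a0" "Y m q = 0" by (auto simp: A_def)
    have free: "Y m t < 0" if "t \<in> {s1<..<q}" for t
    proof -
      have "t \<notin> A" using Min_le[OF A(1), of t] that by (auto simp: q_def)
      then have "Y m t \<noteq> 0" using that q by (auto simp: A_def)
      moreover have "Y m t \<le> 0" by (rule Y_le) (use that q a0 s1 p in auto)
      ultimately show ?thesis by simp
    qed
    have above: "0 < L m t" if t: "t \<in> {s1<..<q}" for t
    proof -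
      have "Inf E < t" using t by (simp add: s1_def)
      then obtain r where r: "r \<in> E" "r < t" using cInf_less_iff[OF _ bdd, of t] ne by blast
      have "s1 \<le> r" using cInf_lower[OF r(1) bdd] by (simp add: s1_def)
      then have "s1 < r" using s1_notin r(1) by (cases "r = s1") auto
      have "L m r < L m t"
        by (rule Lm_strict_mono) (use \<open>s1 < r\<close> r t s1 p q a0 in \<open>auto intro!: free\<close>)
      then show ?thesis using r(1) by (simp add: E_def)
    qed
    \<comment> \<open>Contacts are exempt, since \<open>L m\<close> may vanish there; they go into
      the null set of \<open>plus_minus\<close>. At any other zero beyond \<open>S\<close>,
      \<open>L m\<close> would be strictly increasing and hence positive before
      \<open>s1\<close>.\<close>
    have neg: "L m t < 0" if t: "t \<in> {p..<s1}" "Y m t \<noteq> 0" for t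
    proof (cases "t \<le> S")
      case True
      then show ?thesis using low[of t] t p l0 \<open>S < s0\<close> s0 by auto
    next
      case False
      have "L m t \<noteq> 0"
      proof
        assume z: "L m t = 0"
        have td: "0 < t" "t < d" using t p s1 s0 by auto
        obtain h where h: "0 < h" "\<And>r. r \<in> {t - h..t + h} \<Longrightarrow> r \<noteq> t \<Longrightarrow> Y m r < 0"
          by (rule active_isolated[OF td], rule that)
        define r where "r = min (t + h) ((t + s1) / 2)"
        have r: "t < r" "r \<le> t + h" "r < s1" using h t by (auto simp: r_def min_def field_simps)
        have "Y m t < 0" using Y_le[OF td] t(2) by simp
        have "L m t < L m r"
        proof (rule Lm_strict_mono)
          fix v assume "v \<in> {t..r}"
          then show "Y m v < 0" using h(2)[of v] h(1) r \<open>Y m t < 0\<close> by (cases "v = t") auto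
        qed (use r td s1 s0 in auto)
        then show False using below[of r] r False z by auto
      qed
      moreover have "L m t \<le> 0" using below[of t] t False by auto
      ultimately show ?thesis by simp
    qed
    show False
    proof (rule no_excursion[of m M0 p q Y L])
      show "plus_minus (\<lambda>t. - L m t) p q"
        unfolding plus_minus_def
      proof (intro bexI exI conjI)
        show "negligible {t \<in> {p..s1}. Y m t = 0}"
          using finite_active[of p s1] p s1 s0 by (intro negligible_finite) auto
        show "\<forall>t\<in>{p<..<s1} - {t \<in> {p..s1}. Y m t = 0}. 0 < - L m t" using neg by auto
        show "\<forall>t\<in>{s1<..<q} - {t \<in> {p..s1}. Y m t = 0}. - L m t < 0" using above by auto
        show "s1 \<in> {p..q}" using p s1 q by auto
      qed
      show "(-1) ^ (m - k) * L k p \<le> 0" if k: "k \<in> {1..<m}" for k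
      proof -
        have "m - (m - k) = k" using k by auto
        then have "W (m - k) p = - ((-1) ^ (m - k) * L k p)" by (simp add: W_def)
        moreover have "0 < W (m - k) p" by (rule W_pos) (use k p Re in \<open>auto simp: p_def\<close>)
        ultimately show ?thesis by simp
      qed
      show "0 \<le> (-1) ^ (m - 1) * Y k p" if "k \<in> {1..m}" for k
        using V_pos[of k p] that p by (simp add: V_def p_def)
      show "Y (m - 1) q = 0" if "2 \<le> m"
        by (rule active_stationary) (use q that a0 s1 p in auto)
      show "(Y (k - 1) has_integral Y k b - Y k a) {a..b}"
        if "k \<in> {1..m}" "p \<le> a" "a \<le> b" "b \<le> q" for k a b
        by (rule Y_int) (use that p q a0 in auto)
      show "(L (Suc k) has_integral L k a - L k b) {a..b}"
        if "k \<in> {1..<m}" "p \<le> a" "a \<le> b" "b \<le> q" for k a b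
        by (rule L_int) (use that p q a0 in auto)
      show "Y m t \<le> 0" if "t \<in> {p..q}" for t
        by (rule Y_le) (use that p q a0 in auto)
    qed (use m M0 q p s1 Y0 in auto)
  qed
  show thesis by (rule that[OF K(2) s0(1,3) main])
qed

lemma L_order:
  obtains B e where "0 < B" "0 < e" "e < d"
    "\<And>k s. k \<in> {1..m} \<Longrightarrow> 0 < s \<Longrightarrow> s \<le> e \<Longrightarrow> \<bar>L k s\<bar> \<le> B * s ^ (m - k + 1)"
proof -
  obtain K e where K: "0 < K" "0 < e" "e < d" "\<And>s. 0 < s \<Longrightarrow> s \<le> e \<Longrightarrow> - K * s \<le> L m s"
    by (rule Lm_lower, rule that)
  define B where "B = max K C"
  have B: "0 < B" "K \<le> B" "C \<le> B" using K by (auto simp: B_def)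
  have bd: "\<bar>L m s\<bar> \<le> B * s ^ 1" if "0 < s" "s \<le> e" for s
  proof -
    have "- K * s \<le> L m s" by (rule K(4)[OF that])
    moreover have "L m s \<le> C * s" by (rule Lm_upper) (use that K(3) in auto)
    moreover have "K * s \<le> B * s" "C * s \<le> B * s" using B that by (auto intro!: mult_right_mono)
    ultimately show ?thesis by (simp add: abs_le_iff)
  qed
  show thesis
    by (rule that[OF B(1) K(2,3)]) (rule L_bound[OF K(3) _ bd], use B in auto)
qed

end


section \<open>Change of the time coordinate\<close>

lemma open_image_signed:
  fixes S :: "real set"
  assumes "sg = 1 \<or> sg = -1" "open S"
  shows "open ((\<lambda>s. c + sg * s) ` S)"
  using open_affinity[of S sg c] assms by auto

lemma filtermap_signed:
  fixes c :: real
  assumes "sg = 1 \<or> sg = -1"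
  shows "filtermap (\<lambda>s. c + sg * s) (at s within S) = at (c + sg * s) within (\<lambda>s. c + sg * s) ` S"
proof (rule filtermap_linear_at_within)
  show "bij (\<lambda>s. c + sg * s)"
    by (rule o_bij[of "\<lambda>t. sg * (t - c)"]) (use assms in auto)
qed (use assms open_image_signed in \<open>auto intro!: continuous_intros\<close>)

lemma filtermap_pos: "filtermap (\<lambda>s. c + s) (at_right s) = at_right (c + s)"
  "filtermap (\<lambda>s. c + s) (at_left s) = at_left (c + (s::real))"
proof -
  have "(\<lambda>s. c + s) ` {s<..} = {c + s<..}" "(\<lambda>s. c + s) ` {..<s} = {..<c + s}"
    by (auto intro: image_eqI[of _ _ "_ - c"])
  then show "filtermap (\<lambda>s. c + s) (at_right s) = at_right (c + s)"
    "filtermap (\<lambda>s. c + s) (at_left s) = at_left (c + s)"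
    using filtermap_signed[of 1 c s] by auto
qed

lemma filtermap_neg: "filtermap (\<lambda>s. c - s) (at_right s) = at_left (c - s)"
  "filtermap (\<lambda>s. c - s) (at_left s) = at_right (c - (s::real))"
proof -
  have "(\<lambda>s. c - s) ` {s<..} = {..<c - s}" "(\<lambda>s. c - s) ` {..<s} = {c - s<..}"
    by (auto intro: image_eqI[of _ _ "c - _"])
  then show "filtermap (\<lambda>s. c - s) (at_right s) = at_left (c - s)"
    "filtermap (\<lambda>s. c - s) (at_left s) = at_right (c - s)"
    using filtermap_signed[of "-1" c s] by auto
qed

lemma crosses_zero_signed:
  assumes sg: "sg = 1 \<or> sg = -1"
  shows "crosses_zero f (c + sg * s) \<longleftrightarrow> crosses_zero (\<lambda>s. f (c + sg * s)) s"
  using sg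
proof
  assume "sg = 1"
  have r: "eventually P (at_right (c + s)) \<longleftrightarrow> (\<forall>\<^sub>F s in at_right s. P (c + s))"
    and l: "eventually P (at_left (c + s)) \<longleftrightarrow> (\<forall>\<^sub>F s in at_left s. P (c + s))" for P
    unfolding filtermap_pos[symmetric] by (simp_all add: eventually_filtermap)
  show ?thesis unfolding crosses_zero_def using \<open>sg = 1\<close> by (simp add: r l)
next
  assume "sg = -1"
  have r: "eventually P (at_right (c - s)) \<longleftrightarrow> (\<forall>\<^sub>F s in at_left s. P (c - s))"
    and l: "eventually P (at_left (c - s)) \<longleftrightarrow> (\<forall>\<^sub>F s in at_right s. P (c - s))" for P
    unfolding filtermap_neg[symmetric] by (simp_all add: eventually_filtermap)
  show ?thesis unfolding crosses_zero_def using \<open>sg = -1\<close> by (simp add: r l) blast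
qed

lemma crosses_zero_mult:
  assumes "c \<noteq> 0"
  shows "crosses_zero (\<lambda>s. c * f s) s \<longleftrightarrow> crosses_zero f s"
proof (cases "0 < c")
  case True
  then have "0 < c * r \<longleftrightarrow> 0 < r" "c * r < 0 \<longleftrightarrow> r < 0" for r
    by (auto simp: zero_less_mult_iff mult_less_0_iff)
  then show ?thesis by (simp add: crosses_zero_def)
next
  case False
  then have "0 < c * r \<longleftrightarrow> r < 0" "c * r < 0 \<longleftrightarrow> 0 < r" for r
    using assms by (auto simp: zero_less_mult_iff mult_less_0_iff)
  then show ?thesis by (simp add: crosses_zero_def) blast
qed

lemma AE_lebesgue_onE:
  fixes S :: "real set"
  assumes "AE t in lebesgue_on S. P t" "S \<in> sets lebesgue"
  obtains Z where "negligible Z" "\<And>t. t \<in> S - Z \<Longrightarrow> P t"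
proof -
  have "AE t in lebesgue. t \<in> S \<longrightarrow> P t"
    using assms by (simp add: AE_restrict_space_iff)
  then obtain Z where Z: "Z \<in> null_sets lebesgue" "{t. \<not> (t \<in> S \<longrightarrow> P t)} \<subseteq> Z"
    by (auto simp: eventually_ae_filter)
  then have "negligible Z" by (simp add: negligible_iff_null_sets)
  then show thesis by (rule that) (use Z(2) in auto)
qed

lemma AE_lebesgue_onI:
  fixes S :: "real set"
  assumes "negligible Z" "\<And>t. t \<in> S - Z \<Longrightarrow> P t" "S \<in> sets lebesgue"
  shows "AE t in lebesgue_on S. P t"
proof -
  have "AE t in lebesgue. t \<notin> Z"
    by (rule AE_not_in) (use assms(1) in \<open>simp add: negligible_iff_null_sets\<close>)
  then have "AE t in lebesgue. t \<in> S \<longrightarrow> P t" by eventually_elim (use assms(2) in auto)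
  then show ?thesis using assms(3) by (simp add: AE_restrict_space_iff)
qed

lemma has_integral_signed:
  fixes g F :: "real \<Rightarrow> real"
  assumes sg: "sg = 1 \<or> sg = -1"
    and int: "\<And>t1 t2. l < t1 \<Longrightarrow> t1 \<le> t2 \<Longrightarrow> t2 < h \<Longrightarrow> (g has_integral F t2 - F t1) {t1..t2}"
    and ab: "a \<le> b" "c + sg * a \<in> {l<..<h}" "c + sg * b \<in> {l<..<h}"
  shows "((\<lambda>s. g (c + sg * s)) has_integral sg * (F (c + sg * b) - F (c + sg * a))) {a..b}"
  using sg
proof
  assume "sg = 1"
  then have "(g has_integral F (c + b) - F (c + a)) (cbox (c + a) (c + b))"
    using int[of "c + a" "c + b"] ab by simp
  from has_integral_affinity'[OF this, of 1 c] show ?thesis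
    using \<open>sg = 1\<close> by (simp add: add.commute)
next
  assume "sg = -1"
  then have "(g has_integral F (c - a) - F (c - b)) (cbox (c - b) (c - a))"
    using int[of "c - b" "c - a"] ab by simp
  from has_integral_affinity'[OF this, of 1 c]
  have "((\<lambda>r. g (r + c)) has_integral F (c - a) - F (c - b)) {- b..- a}"
    by simp
  then have "((\<lambda>r. g (- r + c)) has_integral F (c - a) - F (c - b)) {a..b}"
    using has_integral_reflect_real[of "\<lambda>r. g (r + c)" _ "- a" "- b"] by simp
  then show ?thesis using \<open>sg = -1\<close> by (simp add: algebra_simps)
qed

lemma integral_from_base:
  fixes g :: "real \<Rightarrow> real"
  assumes int: "\<And>a b. l < a \<Longrightarrow> a \<le> b \<Longrightarrow> b < h \<Longrightarrow> g integrable_on {a..b}"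
    and c: "l < c" "c < h"
    and G: "\<And>s. G s = (if c \<le> s then integral {c..s} g else - integral {s..c} g)"
    and ab: "l < a" "a \<le> b" "b < h"
  shows "(g has_integral G b - G a) {a..b}"
proof -
  have "integral {a..b} g = G b - G a"
  proof (cases "c \<le> a"; cases "c \<le> b")
    assume "c \<le> a" "c \<le> b"
    then show ?thesis
      using Henstock_Kurzweil_Integration.integral_combine[of c a b g] int[of c b] ab c G by simp
  next
    assume "\<not> c \<le> a" "c \<le> b"
    then show ?thesis
      using Henstock_Kurzweil_Integration.integral_combine[of a c b g] int[of a b] ab c G by simp
  next
    assume "\<not> c \<le> a" "\<not> c \<le> b"
    then show ?thesis
      using Henstock_Kurzweil_Integration.integral_combine[of a b c g] int[of a c] ab c G by simp
  qed (use ab in auto)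
  then show ?thesis using int[OF ab] integrable_integral by metis
qed

section \<open>Reduction to the local problem\<close>

text \<open>The sign \<open>sg\<close> is \<open>-1\<close> for chattering on the left-hand side of \<open>tinf\<close> and \<open>1\<close> on the right.\<close>

locale extremal =
  fixes n :: nat and M0 tf tinf sg tb :: real and M :: "nat \<Rightarrow> ereal"
    and x lam eta mu :: "nat \<Rightarrow> real \<Rightarrow> real" and u :: "real \<Rightarrow> real"
  assumes n: "1 \<le> n" and M0: "0 < M0" and M_pos: "\<And>k. k \<in> {1..n} \<Longrightarrow> 0 < M k"
    and tinf: "0 < tinf" "tinf < tf" and sg: "sg = 1 \<or> sg = -1" and tb: "0 < sg * (tb - tinf)"
    and chatter: "chattering_from u tb tinf"
    and u_int: "\<And>t. t \<in> {0..tf} \<Longrightarrow> (u has_integral x 1 t - x 1 0) {0..t}"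
    and x_deriv: "\<And>k t. k \<in> {1<..n} \<Longrightarrow> t \<in> {0<..<tf} \<Longrightarrow> (x k has_real_derivative x (k - 1) t) (at t)"
    and x_le: "\<And>k t. k \<in> {1..n} \<Longrightarrow> t \<in> {0<..<tf} \<Longrightarrow> ereal \<bar>x k t\<bar> \<le> M k"
    and eta: "\<And>k t. k \<in> {1..n} \<Longrightarrow> t \<in> {0<..<tf} \<Longrightarrow>
      0 \<le> eta k t \<and> ereal (eta k t) * (ereal \<bar>x k t\<bar> - M k) = 0"
    and mu: "\<And>k t. k \<in> {1..n} \<Longrightarrow> t \<in> {0<..<tf} \<Longrightarrow> mu k t \<le> 0 \<and> (mu k t \<noteq> 0 \<longrightarrow> may_jump M x k t)"
    and lam_eq: "\<And>k a b. k \<in> {1..n} \<Longrightarrow> 0 < a \<Longrightarrow> a \<le> b \<Longrightarrow> b < tf \<Longrightarrow>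
      \<exists>I J. ((\<lambda>\<tau>. (if k < n then lam (k + 1) \<tau> else 0) + eta k \<tau> * sgn (x k \<tau>)) has_integral I) {a..b} \<and>
        ((\<lambda>\<tau>. mu k \<tau> * sgn (x k \<tau>)) has_sum J) {a<..b} \<and> lam k b - lam k a = - I + J"
    and lam1_cont: "continuous_on {0<..<tf} (lam 1)"
    and u_eq: "AE t in lebesgue_on {0<..<tf}. u t = - M0 * sgn (lam 1 t)"
begin

definition phi :: "real \<Rightarrow> real" where "phi s = tinf + sg * s"

definition psi :: "real \<Rightarrow> real" where "psi t = sg * (t - tinf)"

text \<open>Keeps \<open>phi\<close> inside \<open>{0<..<tf}\<close> for arguments of both signs, so
  that the state equations hold up to \<open>s = 0\<close>, and positive arguments within the
  segment from \<open>tinf\<close> to \<open>tb\<close>, where switches are controlled.\<close>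

definition d0 :: real where "d0 = min (min tinf (tf - tinf)) (psi tb)"

text \<open>Unsigned, as in the complementarity and jump conditions; the sign of the active
  constraint is found only later.\<close>

definition contact :: "nat \<Rightarrow> real \<Rightarrow> bool" where "contact k t \<longleftrightarrow> ereal \<bar>x k t\<bar> = M k"

lemma psi_phi [simp]: "psi (phi s) = s" and phi_psi [simp]: "phi (psi t) = t"
  and phi_0 [simp]: "phi 0 = tinf"
  using sg by (auto simp: phi_def psi_def)

lemma phi_eq_iff [simp]: "phi s = phi t \<longleftrightarrow> s = t"
  by (metis psi_phi)

lemma d0: "0 < d0" using tinf tb by (simp add: d0_def psi_def)

lemma phi_in: "- d0 < s \<Longrightarrow> s < d0 \<Longrightarrow> phi s \<in> {0<..<tf}"
  using sg by (auto simp: phi_def d0_def)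

lemma in_image_phi: "t \<in> phi ` A \<longleftrightarrow> psi t \<in> A"
  by (metis image_iff phi_psi psi_phi)

lemma open_segment_phi: "open_segment (phi a) (phi b) = phi ` open_segment a b"
proof -
  have "t \<in> open_segment (phi a) (phi b) \<longleftrightarrow> psi t \<in> open_segment a b" for t
    using sg
  proof
    assume "sg = 1"
    then have "phi = (\<lambda>s. tinf + s)" "psi = (\<lambda>t. t - tinf)"
      unfolding phi_def[abs_def] psi_def[abs_def] by simp_all
    then show ?thesis by (cases "a \<le> b") (auto simp: open_segment_eq_real_ivl)
  next
    assume "sg = -1"
    then have "phi = (\<lambda>s. tinf - s)" "psi = (\<lambda>t. tinf - t)"
      unfolding phi_def[abs_def] psi_def[abs_def] by simp_all
    then show ?thesis by (cases "a \<le> b") (auto simp: open_segment_eq_real_ivl)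
  qed
  then show ?thesis by (intro set_eqI) (simp only: in_image_phi)
qed

lemma closed_segment_phi: "closed_segment (phi a) (phi b) = phi ` closed_segment a b"
proof -
  have "t \<in> closed_segment (phi a) (phi b) \<longleftrightarrow> psi t \<in> closed_segment a b" for t
    using sg
  proof
    assume "sg = 1"
    then have "phi = (\<lambda>s. tinf + s)" "psi = (\<lambda>t. t - tinf)"
      unfolding phi_def[abs_def] psi_def[abs_def] by simp_all
    then show ?thesis by (cases "a \<le> b") (auto simp: closed_segment_eq_real_ivl)
  next
    assume "sg = -1"
    then have "phi = (\<lambda>s. tinf - s)" "psi = (\<lambda>t. tinf - t)"
      unfolding phi_def[abs_def] psi_def[abs_def] by simp_all
    then show ?thesis by (cases "a \<le> b") (auto simp: closed_segment_eq_real_ivl)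
  qed
  then show ?thesis by (intro set_eqI) (simp only: in_image_phi)
qed

section \<open>State equations, costate equations and switches in the original time\<close>

lemma u_integral:
  assumes "0 < t1" "t1 \<le> t2" "t2 < tf"
  shows "(u has_integral x 1 t2 - x 1 t1) {t1..t2}"
proof -
  have 1: "(u has_integral x 1 t1 - x 1 0) {0..t1}" "(u has_integral x 1 t2 - x 1 0) {0..t2}"
    using u_int[of t1] u_int[of t2] assms by auto
  then have i: "u integrable_on {0..t2}" by blast
  then have "integral {0..t1} u + integral {t1..t2} u = integral {0..t2} u"
    using Henstock_Kurzweil_Integration.integral_combine[of 0 t1 t2 u] assms by simp
  then have "integral {t1..t2} u = x 1 t2 - x 1 t1" using 1 by (simp add: integral_unique)
  moreover have "u integrable_on {t1..t2}"
    by (rule integrable_subinterval_real[OF i]) (use assms in auto)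
  ultimately show ?thesis using integrable_integral by metis
qed

lemma x1_int:
  assumes "0 < t1" "t1 \<le> t2" "t2 < tf"
  shows "((\<lambda>t. - M0 * sgn (lam 1 t)) has_integral x 1 t2 - x 1 t1) {t1..t2}"
proof -
  obtain Z where Z: "negligible Z" "\<And>t. t \<in> {0<..<tf} - Z \<Longrightarrow> u t = - M0 * sgn (lam 1 t)"
    by (rule AE_lebesgue_onE[OF u_eq]) auto
  show ?thesis
    by (rule has_integral_spike[OF Z(1) _ u_integral[OF assms]]) (use Z(2) assms in force)
qed

lemma x_int:
  assumes "k \<in> {1<..n}" "0 < t1" "t1 \<le> t2" "t2 < tf"
  shows "(x (k - 1) has_integral x k t2 - x k t1) {t1..t2}"
proof (rule fundamental_theorem_of_calculus)
  fix t assume "t \<in> {t1..t2}"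
  then have "(x k has_real_derivative x (k - 1) t) (at t)" using x_deriv assms by auto
  then show "(x k has_vector_derivative x (k - 1) t) (at t within {t1..t2})"
    unfolding has_real_derivative_iff_has_vector_derivative by (rule has_vector_derivative_at_within)
qed (use assms in auto)

lemma x_cont:
  assumes "k \<in> {1..n}"
  shows "continuous_on {0<..<tf} (x k)"
proof (cases "k = 1")
  case True
  have "continuous_on {0<..<tf} (x 1)" by (rule primitive_continuous_on_Ioo[OF u_integral])
  then show ?thesis using True by simp
next
  case False
  then show ?thesis using assms x_int[of k]
    by (intro primitive_continuous_on_Ioo[of _ _ "x (k - 1)"]) auto
qed

text \<open>For \<open>M k = \<infinity>\<close> the product in the complementarity condition is
  infinite unless \<open>eta k t\<close> is zero.\<close>

lemma no_contact:
  assumes k: "k \<in> {1..n}" and t: "t \<in> {0<..<tf}" and c: "\<not> contact k t"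
  shows "eta k t = 0" "mu k t = 0"
proof -
  show "mu k t = 0" using mu[OF k t] c by (auto simp: contact_def may_jump_def Let_def)
  show "eta k t = 0"
    using eta[OF k t] c M_pos[OF k] by (cases "M k") (auto simp: contact_def zero_ereal_def split: if_splits)
qed

lemma lam_int:
  assumes k: "k \<in> {1..n}" and t: "0 < t1" "t1 \<le> t2" "t2 < tf"
    and c: "\<And>t. t \<in> {t1..t2} \<Longrightarrow> \<not> contact k t"
  shows "((\<lambda>\<tau>. if k < n then lam (k + 1) \<tau> else 0) has_integral lam k t1 - lam k t2) {t1..t2}"
proof -
  obtain I J where IJ:
    "((\<lambda>\<tau>. (if k < n then lam (k + 1) \<tau> else 0) + eta k \<tau> * sgn (x k \<tau>)) has_integral I) {t1..t2}"
    "((\<lambda>\<tau>. mu k \<tau> * sgn (x k \<tau>)) has_sum J) {t1<..t2}" "lam k t2 - lam k t1 = - I + J"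
    using lam_eq[OF k t] by blast
  have "((\<lambda>\<tau>. mu k \<tau> * sgn (x k \<tau>)) has_sum 0) {t1<..t2}"
    by (rule has_sum_0) (use no_contact(2)[OF k _ c] t in auto)
  then have "J = 0" using IJ(2) has_sum_unique by blast
  moreover have "((\<lambda>\<tau>. if k < n then lam (k + 1) \<tau> else 0) has_integral I) {t1..t2}"
    by (rule has_integral_eq[OF _ IJ(1)]) (use no_contact(1)[OF k _ c] t in auto)
  moreover have "I = lam k t1 - lam k t2" using IJ(3) \<open>J = 0\<close> by simp
  ultimately show ?thesis by simp
qed

text \<open>By the definition of \<open>switch\<close>, \<open>u\<close> is locally constant up to
  null sets, so \<open>x 1\<close> has a locally constant derivative, and connectedness makes it
  constant.\<close>

lemma no_switch_affine:
  assumes pq: "0 < p" "p < q" "q < tf" and ns: "\<And>t. t \<in> {p<..<q} \<Longrightarrow> \<not> switch u t"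
  obtains c where "\<And>t. t \<in> {p..q} \<Longrightarrow> x 1 t = x 1 p + c * (t - p)"
proof -
  have loc: "\<exists>c e. 0 < e \<and> (\<forall>t'\<in>{t - e<..<t + e}. (x 1 has_real_derivative c) (at t'))"
    if t: "t \<in> {p<..<q}" for t
  proof -
    obtain c e' where e': "0 < e'" "AE \<tau> in lebesgue_on {t - e'<..<t + e'}. u \<tau> = c"
      using ns[OF t] by (auto simp: switch_def)
    obtain Z where Z: "negligible Z" "\<And>\<tau>. \<tau> \<in> {t - e'<..<t + e'} - Z \<Longrightarrow> u \<tau> = c"
      by (rule AE_lebesgue_onE[OF e'(2)]) auto
    define e where "e = min e' (min (t - p) (q - t))"
    have e: "0 < e" "e \<le> e'" "e \<le> t - p" "e \<le> q - t" using e' t by (auto simp: e_def)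
    have int: "((\<lambda>_. c) has_integral x 1 t2 - x 1 t1) {t1..t2}"
      if "t - e < t1" "t1 \<le> t2" "t2 < t + e" for t1 t2
      by (rule has_integral_spike[OF Z(1) _ u_integral]) (use Z(2) that e pq in force)+
    have "(x 1 has_real_derivative c) (at t')" if "t' \<in> {t - e<..<t + e}" for t'
      by (rule primitive_has_derivative[OF int _ that]) auto
    then show ?thesis using e(1) by blast
  qed
  have der: "(x 1 has_real_derivative deriv (x 1) t) (at t)" if t: "t \<in> {p<..<q}" for t
  proof -
    obtain c e where "0 < e" "\<forall>t'\<in>{t - e<..<t + e}. (x 1 has_real_derivative c) (at t')"
      using loc[OF t] by blast
    then have "(x 1 has_real_derivative c) (at t)" by auto
    then show ?thesis using DERIV_imp_deriv by blast
  qed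
  define c where "c = deriv (x 1) ((p + q) / 2)"
  have const: "deriv (x 1) t = c" if "t \<in> {p<..<q}" for t
    unfolding c_def
  proof (rule connected_local_const[OF connected_Ioo[of p q] that])
    show "(p + q) / 2 \<in> {p<..<q}" using pq by auto
    show "\<forall>a\<in>{p<..<q}. \<forall>\<^sub>F b in at a within {p<..<q}. deriv (x 1) a = deriv (x 1) b"
    proof
      fix t assume "t \<in> {p<..<q}"
      then obtain c e where e: "0 < e" "\<And>t'. t' \<in> {t - e<..<t + e} \<Longrightarrow> (x 1 has_real_derivative c) (at t')"
        using loc[of t] by blast
      have "\<forall>\<^sub>F b in at t within {p<..<q}. b \<in> {t - e<..<t + e}"
        unfolding eventually_at_topological
        by (rule exI[of _ "{t - e<..<t + e}"]) (use e in auto)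
      then show "\<forall>\<^sub>F b in at t within {p<..<q}. deriv (x 1) t = deriv (x 1) b"
        by eventually_elim (use e(1) DERIV_imp_deriv[OF e(2)] in simp)
    qed
  qed
  have "x 1 t - c * t = x 1 p - c * p" if "t \<in> {p..q}" for t
  proof (rule DERIV_isconst2[of p q "\<lambda>t. x 1 t - c * t"])
    show "continuous_on {p..q} (\<lambda>t. x 1 t - c * t)"
      by (intro continuous_intros continuous_on_subset[OF x_cont]) (use n pq in auto)
    show "DERIV (\<lambda>t. x 1 t - c * t) t :> 0" if "p < t" "t < q" for t
    proof -
      have "(x 1 has_real_derivative c) (at t)" using der[of t] const[of t] that by simp
      then show ?thesis by (auto intro!: derivative_eq_intros)
    qed
  qed (use that pq in auto)
  then show thesis by (intro that[of c]) (simp add: algebra_simps)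
qed

lemma finite_switches:
  assumes "0 < e"
  shows "finite {s. e < s \<and> s < d0 \<and> switch u (phi s)}"
proof (cases "e < d0")
  case True
  then have e: "psi tb > e" by (simp add: d0_def)
  then have "phi e \<in> open_segment tb tinf"
    using open_segment_phi[of "psi tb" 0] assms by (auto simp: open_segment_eq_real_ivl)
  then have "finite {\<tau> \<in> open_segment tb (phi e). switch u \<tau>}"
    using chatter by (auto simp: chattering_from_def)
  moreover have "phi ` {s. e < s \<and> s < d0 \<and> switch u (phi s)} \<subseteq> {\<tau> \<in> open_segment tb (phi e). switch u \<tau>}"
    using open_segment_phi[of "psi tb" e] e by (auto simp: open_segment_eq_real_ivl d0_def)
  ultimately have "finite (phi ` {s. e < s \<and> s < d0 \<and> switch u (phi s)})" by (rule finite_subset[rotated])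
  then show ?thesis by (rule finite_imageD) (auto simp: inj_on_def)
next
  case False
  then have *: "{s. e < s \<and> s < d0 \<and> switch u (phi s)} = {}" by auto
  show ?thesis unfolding * by simp
qed

lemma ex_switch:
  assumes e: "0 < e" "e \<le> d0"
  shows "\<exists>s. 0 < s \<and> s < e \<and> switch u (phi s)"
proof (rule ccontr)
  assume no: "\<not> ?thesis"
  have p: "0 < e / 2" "e / 2 < psi tb" using e by (auto simp: d0_def)
  then have "phi (e / 2) \<in> open_segment tb tinf"
    using open_segment_phi[of "psi tb" 0] by (auto simp: open_segment_eq_real_ivl)
  then have "finite {\<tau> \<in> open_segment tb (phi (e / 2)). switch u \<tau>}"
    using chatter by (auto simp: chattering_from_def)
  moreover have "{\<tau> \<in> open_segment tb tinf. switch u \<tau>} \<subseteq> insert (phi (e / 2)) {\<tau> \<in> open_segment tb (phi (e / 2)). switch u \<tau>}"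
  proof
    fix t assume t: "t \<in> {\<tau> \<in> open_segment tb tinf. switch u \<tau>}"
    define s where "s = psi t"
    have ts: "t = phi s" by (simp add: s_def)
    have "0 < s" "s < psi tb" using t open_segment_phi[of "psi tb" 0] p ts
      by (auto simp: open_segment_eq_real_ivl)
    moreover have "\<not> s < e" using no t ts \<open>0 < s\<close> by auto
    ultimately show "t \<in> insert (phi (e / 2)) {\<tau> \<in> open_segment tb (phi (e / 2)). switch u \<tau>}"
      using t open_segment_phi[of "psi tb" "e / 2"] e ts by (auto simp: open_segment_eq_real_ivl)
  qed
  ultimately have "finite {\<tau> \<in> open_segment tb tinf. switch u \<tau>}"
    by (meson finite.insertI finite_subset)
  then show False using chatter by (simp add: chattering_from_def)
qed

text \<open>A constant sign of \<open>lam 1\<close> off a countable set makes \<open>u\<close>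
  constant almost everywhere there, which leaves no switch, while chattering provides one in every
  neighbourhood of the limit.\<close>

lemma lam1_not_const:
  assumes N: "countable N" and e: "0 < e" "e \<le> d0"
    and c: "\<And>s. s \<in> {0<..<e} - N \<Longrightarrow> sgn (lam 1 (phi s)) = c"
  shows False
proof -
  obtain s where s: "0 < s" "s < e" "switch u (phi s)" using ex_switch[OF e] by blast
  define r where "r = min s (e - s)"
  have r: "0 < r" "r \<le> s" "r \<le> e - s" using s by (auto simp: r_def)
  have in_e: "psi t \<in> {0<..<e}" if "t \<in> {phi s - r<..<phi s + r}" for t
    using that r sg by (auto simp: phi_def psi_def)
  have sub: "{phi s - r<..<phi s + r} \<subseteq> {0<..<tf}"
  proof
    fix t assume "t \<in> {phi s - r<..<phi s + r}"
    from in_e[OF this] show "t \<in> {0<..<tf}" using phi_in[of "psi t"] e by simp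
  qed
  obtain Z where Z: "negligible Z" "\<And>t. t \<in> {0<..<tf} - Z \<Longrightarrow> u t = - M0 * sgn (lam 1 t)"
    by (rule AE_lebesgue_onE[OF u_eq]) auto
  have "AE t in lebesgue_on {phi s - r<..<phi s + r}. u t = - M0 * c"
  proof (rule AE_lebesgue_onI)
    show "negligible (Z \<union> phi ` N)" using Z(1) N by (auto intro: negligible_countable)
    fix t assume t: "t \<in> {phi s - r<..<phi s + r} - (Z \<union> phi ` N)"
    have "psi t \<notin> N" using t by (simp add: in_image_phi)
    then show "u t = - M0 * c" using Z(2)[of t] t sub in_e[of t] c[of "psi t"] by auto
  qed auto
  then show False using s(3) r(1) unfolding switch_def by blast
qed

text \<open>By continuity a nonzero \<open>lam 1\<close> keeps its sign nearby, and so the control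
  keeps its value. This transfers the count of roots to switches.\<close>

lemma switch_imp_zero:
  assumes t: "t \<in> {0<..<tf}" and s: "switch u t"
  shows "lam 1 t = 0"
proof (rule ccontr)
  assume nz: "lam 1 t \<noteq> 0"
  have "isCont (lam 1) t" using lam1_cont t by (simp add: continuous_on_eq_continuous_at)
  then have "\<forall>\<^sub>F \<tau> in nhds t. dist (lam 1 \<tau>) (lam 1 t) < \<bar>lam 1 t\<bar>"
    using nz by (intro tendstoD) (auto simp: isCont_def tendsto_at_iff_tendsto_nhds)
  moreover have "\<forall>\<^sub>F \<tau> in nhds t. \<tau> \<in> {0<..<tf}" using t by (intro eventually_nhds_in_open) auto
  ultimately have "\<forall>\<^sub>F \<tau> in nhds t. sgn (lam 1 \<tau>) = sgn (lam 1 t) \<and> \<tau> \<in> {0<..<tf}"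
    by eventually_elim (auto simp: sgn_if dist_real_def abs_if split: if_splits)
  then obtain e where e: "0 < e" "\<And>\<tau>. dist \<tau> t < e \<Longrightarrow> sgn (lam 1 \<tau>) = sgn (lam 1 t) \<and> \<tau> \<in> {0<..<tf}"
    unfolding eventually_nhds_metric by blast
  obtain Z where Z: "negligible Z" "\<And>t. t \<in> {0<..<tf} - Z \<Longrightarrow> u t = - M0 * sgn (lam 1 t)"
    by (rule AE_lebesgue_onE[OF u_eq]) auto
  have "AE \<tau> in lebesgue_on {t - e<..<t + e}. u \<tau> = - M0 * sgn (lam 1 t)"
  proof (rule AE_lebesgue_onI[OF Z(1)])
    fix \<tau> assume \<tau>: "\<tau> \<in> {t - e<..<t + e} - Z"
    then have "dist \<tau> t < e" by (auto simp: dist_real_def)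
    then show "u \<tau> = - M0 * sgn (lam 1 t)" using e(2)[of \<tau>] Z(2)[of \<tau>] \<tau> by auto
  qed auto
  then show False using s e(1) unfolding switch_def by blast
qed

text \<open>The hypothesis is phrased through \<open>psi\<close> so that it can be checked for both
  orientations without ordering \<open>phi e\<close> and \<open>phi d\<close>.\<close>

lemma has_integral_phi:
  assumes int: "\<And>t1 t2. t1 \<le> t2 \<Longrightarrow> (\<And>t. t \<in> {t1..t2} \<Longrightarrow> psi t \<in> {e<..<d}) \<Longrightarrow>
      (g has_integral F t2 - F t1) {t1..t2}"
    and ab: "e < a" "a \<le> b" "b < d"
  shows "((\<lambda>s. g (phi s)) has_integral sg * (F (phi b) - F (phi a))) {a..b}"
  unfolding phi_def
proof (rule has_integral_signed[OF sg, where l = "min (phi e) (phi d)" and h = "max (phi e) (phi d)"])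
  fix t1 t2 assume t: "min (phi e) (phi d) < t1" "t1 \<le> t2" "t2 < max (phi e) (phi d)"
  show "(g has_integral F t2 - F t1) {t1..t2}"
  proof (rule int[OF t(2)])
    fix t assume "t \<in> {t1..t2}"
    then have "min (phi e) (phi d) < t" "t < max (phi e) (phi d)" using t by auto
    then show "psi t \<in> {e<..<d}"
      using sg ab by (auto simp: phi_def psi_def min_def max_def split: if_splits)
  qed
qed (use sg ab in \<open>auto simp: phi_def min_def max_def\<close>)

lemma phi_tendsto: "(phi \<longlongrightarrow> tinf) (at_right 0)"
proof -
  have "(phi \<longlongrightarrow> tinf + sg * 0) (at_right 0)"
    unfolding phi_def[abs_def] by (intro tendsto_intros)
  then show ?thesis by simp
qed

lemma lam_int_phi:
  assumes k: "k \<in> {1..n}" and d: "d \<le> d0" and c: "\<And>s. 0 < s \<Longrightarrow> s < d \<Longrightarrow> \<not> contact k (phi s)"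
    and ab: "0 < a" "a \<le> b" "b < d"
  shows "((\<lambda>s. if k < n then lam (k + 1) (phi s) else 0) has_integral
    - sg * (lam k (phi b) - lam k (phi a))) {a..b}"
proof -
  have "((\<lambda>s. if k < n then lam (k + 1) (phi s) else 0) has_integral
    sg * (- lam k (phi b) - - lam k (phi a))) {a..b}"
  proof (rule has_integral_phi[OF _ ab])
    fix t1 t2 assume t: "t1 \<le> t2" "\<And>t. t \<in> {t1..t2} \<Longrightarrow> psi t \<in> {0<..<d}"
    have tf: "t \<in> {0<..<tf}" if "t \<in> {t1..t2}" for t
      using phi_in[of "psi t"] t(2)[OF that] d by simp
    have "\<not> contact k t" if "t \<in> {t1..t2}" for t using c[of "psi t"] t(2)[OF that] by simp
    then show "((\<lambda>t. if k < n then lam (k + 1) t else 0) has_integral - lam k t2 - - lam k t1) {t1..t2}"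
      using lam_int[OF k, of t1 t2] t(1) tf[of t1] tf[of t2] by simp
  qed
  then show ?thesis by (simp add: algebra_simps)
qed

lemma x_int_phi:
  assumes k: "k \<in> {1<..n}" and ab: "- d0 < a" "a \<le> b" "b < d0"
  shows "((\<lambda>s. x (k - 1) (phi s)) has_integral sg * (x k (phi b) - x k (phi a))) {a..b}"
proof (rule has_integral_phi[OF _ ab])
  fix t1 t2 assume t: "t1 \<le> t2" "\<And>t. t \<in> {t1..t2} \<Longrightarrow> psi t \<in> {- d0<..<d0}"
  have tf: "t \<in> {0<..<tf}" if "t \<in> {t1..t2}" for t
    using phi_in[of "psi t"] t(2)[OF that] by simp
  show "(x (k - 1) has_integral x k t2 - x k t1) {t1..t2}"
    using x_int[OF k, of t1 t2] t(1) tf[of t1] tf[of t2] by simp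
qed

lemma x1_int_phi:
  assumes ab: "- d0 < a" "a \<le> b" "b < d0"
  shows "((\<lambda>s. - M0 * sgn (lam 1 (phi s))) has_integral sg * (x 1 (phi b) - x 1 (phi a))) {a..b}"
proof (rule has_integral_phi[OF _ ab])
  fix t1 t2 assume t: "t1 \<le> t2" "\<And>t. t \<in> {t1..t2} \<Longrightarrow> psi t \<in> {- d0<..<d0}"
  have tf: "t \<in> {0<..<tf}" if "t \<in> {t1..t2}" for t
    using phi_in[of "psi t"] t(2)[OF that] by simp
  show "((\<lambda>t. - M0 * sgn (lam 1 t)) has_integral x 1 t2 - x 1 t1) {t1..t2}"
    using x1_int[of t1 t2] t(1) tf[of t1] tf[of t2] by simp
qed

section \<open>Signs and contacts near the limit time\<close>

lemma eventually_d0: "\<forall>\<^sub>F s in at_right 0. 0 < s \<and> s < d0"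
  using d0 unfolding eventually_at_right_field by blast

text \<open>Downward induction from \<open>lam n\<close>, which is constant in the absence of
  contacts. Each step integrates the next higher costate, so only the indices from \<open>j\<close>
  on must be free of contacts.\<close>

lemma lam_eventually_const_sgn:
  assumes nc: "\<And>k. k \<in> {j..n} \<Longrightarrow> \<forall>\<^sub>F s in at_right 0. \<not> contact k (phi s)"
    and j: "1 \<le> j" and k: "j \<le> k" "k \<le> n"
  shows "eventually_const_sgn (\<lambda>s. lam k (phi s))"
  using k(2,1)
proof (induction k rule: inc_induct)
  case base
  obtain e where e: "0 < e" "e \<le> d0" "\<And>s. 0 < s \<Longrightarrow> s < e \<Longrightarrow> \<not> contact n (phi s)"
    using eventually_conj[OF eventually_d0 nc[of n]] base unfolding eventually_at_right_field
    by (metis atLeastAtMost_iff linorder_not_less order_refl d0 min_less_iff_conj min.cobounded1 min_less_iff_disj)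
  show ?case
    by (rule eventually_const_sgn_primitive[of e "{}" "\<lambda>_. 0" 0 "- sg"])
      (use lam_int_phi[of n e] e n sg in auto)
next
  case (step k)
  then have "eventually_const_sgn (\<lambda>s. lam (Suc k) (phi s))" by simp
  then obtain c where "\<forall>\<^sub>F s in at_right 0. sgn (lam (Suc k) (phi s)) = c"
    by (auto simp: eventually_const_sgn_def)
  then have "\<forall>\<^sub>F s in at_right 0. (0 < s \<and> s < d0) \<and> \<not> contact k (phi s) \<and> sgn (lam (Suc k) (phi s)) = c"
    using nc[of k] step.prems step.hyps by (intro eventually_conj eventually_d0) auto
  then obtain e where e: "0 < e" "\<And>s. 0 < s \<Longrightarrow> s < e \<Longrightarrow>
      (0 < s \<and> s < d0) \<and> \<not> contact k (phi s) \<and> sgn (lam (Suc k) (phi s)) = c"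
    unfolding eventually_at_right_field by blast
  show ?case
    by (rule eventually_const_sgn_primitive[of "min e d0" "{}" "\<lambda>s. lam (Suc k) (phi s)" c "- sg"])
      (use lam_int_phi[of k "min e d0"] e d0 step j sg in auto)
qed

lemma ex_contact:
  obtains m where "m \<in> {1..n}" "\<exists>\<^sub>F s in at_right 0. contact m (phi s)"
proof -
  have "\<exists>m\<in>{1..n}. \<exists>\<^sub>F s in at_right 0. contact m (phi s)"
  proof (rule ccontr)
    assume "\<not> ?thesis"
    then have "eventually_const_sgn (\<lambda>s. lam 1 (phi s))"
      by (intro lam_eventually_const_sgn[of 1]) (use n in \<open>auto simp: not_frequently\<close>)
    then obtain c e where "0 < e" "\<And>s. 0 < s \<Longrightarrow> s < e \<Longrightarrow> sgn (lam 1 (phi s)) = c"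
      by (elim eventually_const_sgnE) blast
    then show False using lam1_not_const[of "{}" "min e d0" c] d0 by auto
  qed
  then show thesis using that by blast
qed

text \<open>The contacts accumulate on at least one of the two levels \<open>r\<close> and
  \<open>- r\<close>, and this determines \<open>a\<close>.\<close>

lemma contact_limit:
  assumes m: "m \<in> {1..n}" and fr: "\<exists>\<^sub>F s in at_right 0. contact m (phi s)"
  obtains a r where "a = 1 \<or> a = -1" "M m = ereal r" "0 < r" "x m tinf = a * r"
    "\<And>k. k \<in> {1..<m} \<Longrightarrow> x k tinf = 0"
proof -
  obtain s0 where "contact m (phi s0)" using frequently_ex[OF fr] by blast
  then obtain r where r: "M m = ereal r" by (metis contact_def)
  then have "0 < r" using M_pos[OF m] by simp
  have inf: "tinf islimpt {t \<in> {0<..<tf}. \<bar>x m t\<bar> = r}"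
    unfolding islimpt_approachable
  proof (intro allI impI)
    fix e :: real assume "0 < e"
    then have "\<forall>\<^sub>F s in at_right 0. 0 < s \<and> s < min e d0"
      using d0 unfolding eventually_at_right_field by (intro exI[of _ "min e d0"]) auto
    then obtain s where s: "contact m (phi s)" "0 < s" "s < e" "s < d0"
      using frequently_ex[OF frequently_eventually_frequently[OF fr]] by fastforce
    then show "\<exists>t\<in>{t \<in> {0<..<tf}. \<bar>x m t\<bar> = r}. t \<noteq> tinf \<and> dist t tinf < e"
      using phi_in[of s] sg by (intro bexI[of _ "phi s"]) (auto simp: contact_def r phi_def dist_real_def)
  qed
  have "{t \<in> {0<..<tf}. \<bar>x m t\<bar> = r} = {t \<in> {0<..<tf}. x m t = r} \<union> {t \<in> {0<..<tf}. x m t = - r}"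
    using \<open>0 < r\<close> by (auto simp: abs_if split: if_splits)
  with inf have "tinf islimpt {t \<in> {0<..<tf}. x m t = r} \<or> tinf islimpt {t \<in> {0<..<tf}. x m t = - r}"
    by (simp add: islimpt_Un)
  then obtain a where a: "a = 1 \<or> a = -1" "tinf islimpt {t \<in> {0<..<tf}. x m t = a * r}" by force
  have p: "tinf \<in> {0<..<tf}" using tinf by simp
  have der: "(x k has_real_derivative x (k - 1) t) (at t)" if "k \<in> {2..m}" "t \<in> {0<..<tf}" for k t
    using x_deriv[of k t] that m by auto
  have c: "continuous_on {0<..<tf} (x 1)" using x_cont n by simp
  have m1: "1 \<le> m" using m by simp
  show thesis
    by (rule that[OF a(1) r \<open>0 < r\<close>])
      (use derivative_chain_islimpt[OF p m1 der c a(2)] in auto)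
qed

lemma x_eventually_sgn:
  assumes m: "m \<in> {1..n}" "x m tinf \<noteq> 0"
  shows "\<forall>\<^sub>F s in at_right 0. sgn (x m (phi s)) = sgn (x m tinf)"
proof -
  have "isCont (x m) tinf" using x_cont[OF m(1)] tinf by (simp add: continuous_on_eq_continuous_at)
  then have "((\<lambda>s. x m (phi s)) \<longlongrightarrow> x m tinf) (at_right 0)"
    by (rule isCont_tendsto_compose[OF _ phi_tendsto])
  then have "((\<lambda>s. sgn (x m (phi s))) \<longlongrightarrow> sgn (x m tinf)) (at_right 0)"
    by (rule tendsto_sgn) (use m in simp)
  then have "\<forall>\<^sub>F s in at_right 0. dist (sgn (x m (phi s))) (sgn (x m tinf)) < 1" by (rule tendstoD) simp
  then show ?thesis
    by eventually_elim (auto simp: sgn_if dist_real_def split: if_splits)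
qed

lemma x_eventually_const_sgn:
  assumes m: "m \<in> {1..n}" "x m tinf \<noteq> 0" and k: "m \<le> k" "k \<le> n"
  shows "eventually_const_sgn (\<lambda>s. x k (phi s))"
  using k
proof (induction k rule: nat_induct_at_least)
  case base
  show ?case using x_eventually_sgn[OF m] unfolding eventually_const_sgn_def by blast
next
  case (Suc k)
  then have "eventually_const_sgn (\<lambda>s. x k (phi s))" by simp
  then obtain c e where e: "0 < e" "\<And>s. 0 < s \<Longrightarrow> s < e \<Longrightarrow> sgn (x k (phi s)) = c"
    by (elim eventually_const_sgnE) blast
  show ?case
    by (rule eventually_const_sgn_primitive[of "min e d0" "{}" "\<lambda>s. x k (phi s)" c sg])
      (use x_int_phi[of "Suc k"] e d0 Suc m sg in auto)
qed

lemma no_switch_affine_phi: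
  assumes ab: "0 < a" "a < b" "b < d0" and ns: "\<And>s. s \<in> {a<..<b} \<Longrightarrow> \<not> switch u (phi s)"
  shows "\<exists>c. \<forall>s\<in>{a..b}. \<forall>t\<in>{a..b}. x 1 (phi t) = x 1 (phi s) + c * (t - s)"
proof -
  define p where "p = min (phi a) (phi b)"
  define q where "q = max (phi a) (phi b)"
  have pq: "0 < p" "p < q" "q < tf"
    using phi_in[of a] phi_in[of b] ab sg by (auto simp: p_def q_def phi_def)
  have psi_in: "psi t \<in> {a<..<b}" if "t \<in> {p<..<q}" for t
    using that sg ab by (auto simp: p_def q_def phi_def psi_def min_def max_def split: if_splits)
  have in_pq: "phi s \<in> {p..q}" if "s \<in> {a..b}" for s
    using that sg ab by (auto simp: p_def q_def phi_def min_def max_def)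
  obtain c where c: "\<And>t. t \<in> {p..q} \<Longrightarrow> x 1 t = x 1 p + c * (t - p)"
  proof (rule no_switch_affine[OF pq])
    fix t assume "t \<in> {p<..<q}"
    then show "\<not> switch u t" using ns[OF psi_in] by simp
  qed (rule that)
  show ?thesis
  proof (intro exI ballI)
    fix s t assume "s \<in> {a..b}" "t \<in> {a..b}"
    then show "x 1 (phi t) = x 1 (phi s) + (c * sg) * (t - s)"
      using c[OF in_pq[of s]] c[OF in_pq[of t]] by (simp add: phi_def algebra_simps)
  qed
qed

text \<open>Away from contacts each costate is a primitive of the next one, and a bounded derivative
  on a bounded interval bounds the function. For \<open>lam (m + 1)\<close> this provides the
  Lipschitz constant of \<open>G\<close>.\<close>

lemma lam_bounded:
  assumes nc: "\<And>k. k \<in> {j..n} \<Longrightarrow> \<forall>\<^sub>F s in at_right 0. \<not> contact k (phi s)"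
    and j: "1 \<le> j" and k: "j \<le> k" "k \<le> n"
  shows "\<exists>C. \<forall>\<^sub>F s in at_right 0. \<bar>lam k (phi s)\<bar> \<le> C"
proof -
  have bound: "\<exists>C. \<forall>\<^sub>F s in at_right 0. \<bar>lam k (phi s)\<bar> \<le> C"
    if k: "j \<le> k" "k \<le> n"
      and bd: "\<forall>\<^sub>F s in at_right 0. \<bar>if k < n then lam (k + 1) (phi s) else 0\<bar> \<le> B" for k B
  proof -
    have "\<forall>\<^sub>F s in at_right 0. (0 < s \<and> s < d0) \<and> \<not> contact k (phi s) \<and>
        \<bar>if k < n then lam (k + 1) (phi s) else 0\<bar> \<le> B"
      using nc[of k] k bd by (intro eventually_conj eventually_d0) auto
    then obtain e where e: "0 < e" "\<And>s. 0 < s \<Longrightarrow> s < e \<Longrightarrow>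
        (0 < s \<and> s < d0) \<and> \<not> contact k (phi s) \<and> \<bar>if k < n then lam (k + 1) (phi s) else 0\<bar> \<le> B"
      unfolding eventually_at_right_field by blast
    define e' where "e' = min e d0"
    have e': "0 < e'" "e' \<le> d0" "e' \<le> e" using e d0 by (auto simp: e'_def)
    have "0 \<le> B" using e(2)[of "e' / 2"] e' by (smt (verit) abs_ge_zero field_sum_of_halves)
    have "\<bar>lam k (phi s)\<bar> \<le> \<bar>lam k (phi (e' / 2))\<bar> + B * e'" if s: "0 < s" "s < e' / 2" for s
    proof -
      have "norm (- sg * (lam k (phi (e' / 2)) - lam k (phi s))) \<le> B * measure lborel {s..e' / 2}"
      proof (rule has_integral_bound_real[of _ "{}"])
        show "((\<lambda>s. if k < n then lam (k + 1) (phi s) else 0) has_integral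
            - sg * (lam k (phi (e' / 2)) - lam k (phi s))) {s..e' / 2}"
          by (rule lam_int_phi[of k e']) (use e' e(2) s j k in auto)
        show "norm (if k < n then lam (k + 1) (phi t) else 0) \<le> B" if "t \<in> {s..e' / 2} - {}" for t
          using e(2)[of t] that s e' by (auto split: if_splits)
      qed (use \<open>0 \<le> B\<close> in auto)
      also have "\<dots> \<le> B * e'" using s \<open>0 \<le> B\<close> by (intro mult_left_mono) auto
      finally have "\<bar>lam k (phi (e' / 2)) - lam k (phi s)\<bar> \<le> B * e'" using sg by (auto simp: abs_mult)
      then show ?thesis by linarith
    qed
    then show ?thesis unfolding eventually_at_right_field using e'
      by (intro exI[of _ "\<bar>lam k (phi (e' / 2))\<bar> + B * e'"] exI[of _ "e' / 2"]) auto
  qed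
  show ?thesis
    using k(2,1)
  proof (induction k rule: inc_induct)
    case base
    show ?case by (rule bound[of n 0]) (use base in auto)
  next
    case (step k)
    then obtain B where "\<forall>\<^sub>F s in at_right 0. \<bar>lam (Suc k) (phi s)\<bar> \<le> B" by auto
    then show ?case by (intro bound[of k B]) (use step in auto)
  qed
qed

end

text \<open>The properties that hold eventually near the limit are collected on one interval of
  length \<open>d\<close>, on which \<open>m\<close> is the only index with contacts and
  \<open>a\<close> the sign of \<open>x m\<close>.\<close>

locale extremal_contact = extremal +
  fixes m :: nat and a r d C :: real
  assumes m: "m \<in> {1..n}" and a: "a = 1 \<or> a = -1" and Mm: "M m = ereal r" and r: "0 < r"
    and xm_tinf: "x m tinf = a * r" and x_tinf: "\<And>k. k \<in> {1..<m} \<Longrightarrow> x k tinf = 0"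
    and d: "0 < d" "d \<le> d0"
    and ex_contact_m: "\<And>e. 0 < e \<Longrightarrow> \<exists>s. 0 < s \<and> s < e \<and> contact m (phi s)"
    and only_m: "\<And>k s. k \<in> {1..n} \<Longrightarrow> k \<noteq> m \<Longrightarrow> 0 < s \<Longrightarrow> s < d \<Longrightarrow> \<not> contact k (phi s)"
    and xm_sgn: "\<And>s. 0 < s \<Longrightarrow> s < d \<Longrightarrow> sgn (x m (phi s)) = a"
    and x_sgn: "\<And>k. k \<in> {m<..n} \<Longrightarrow> \<exists>c. \<forall>s\<in>{0<..<d}. sgn (x k (phi s)) = c"
    and lam_sgn: "\<And>k. k \<in> {m<..n} \<Longrightarrow> \<exists>c. \<forall>s\<in>{0<..<d}. sgn (lam k (phi s)) = c"
    and lam_bound: "\<And>s. m < n \<Longrightarrow> 0 < s \<Longrightarrow> s < d \<Longrightarrow> \<bar>lam (m + 1) (phi s)\<bar> \<le> C"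
begin

text \<open>The exponent of \<open>sg\<close> changes by one with the index, which cancels the
  factor \<open>sg\<close> from differentiating along \<open>phi\<close>, so the equations agree on
  both sides. For \<open>k = m\<close> a single \<open>sg\<close> remains: it turns the jumps, which
  would go up in reversed time, into drops.\<close>

definition L :: "nat \<Rightarrow> real \<Rightarrow> real" where
  "L k s = a * sg ^ (m + k + 1) * lam k (phi s)"

text \<open>\<open>Y 0\<close> is defined by the sign law instead of by \<open>u\<close>, which
  obeys it only almost everywhere. Subtracting \<open>r\<close> places the contacts at the level
  zero.\<close>

definition Y :: "nat \<Rightarrow> real \<Rightarrow> real" where
  "Y k s = (if k = 0 then - M0 * sgn (L 1 s)
     else a * sg ^ (m + k) * x k (phi s) - (if k = m then r else 0))"

text \<open>The negative of the derivative of \<open>lam m\<close> without multipliers and jumps;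
  zero for \<open>m = n\<close>, where no higher costate exists.\<close>

definition h :: "real \<Rightarrow> real" where "h t = (if m < n then lam (m + 1) t else 0)"

text \<open>The base point lies inside the interval, because \<open>h\<close> is shown to be
  integrable only on compact parts of the open interval.\<close>

definition Q :: "real \<Rightarrow> real" where
  "Q t = (if phi (d / 2) \<le> t then integral {phi (d / 2)..t} h else - integral {t..phi (d / 2)} h)"

definition G :: "real \<Rightarrow> real" where "G s = - a * sg * Q (phi s)"

lemma sg_sg [simp]: "sg * sg = 1" "sg * (sg * y) = y" and aa [simp]: "a * a = 1" "a * (a * y) = y"
  using sg a by auto

lemma sg_even [simp]: "sg ^ (k + k) = 1"
  by (simp add: power_add flip: power_mult_distrib)

lemma abs_sg_power [simp]: "\<bar>sg ^ k\<bar> = 1" and abs_a [simp]: "\<bar>a\<bar> = 1"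
  and sgn_sg [simp]: "sgn sg = sg" and sgn_a [simp]: "sgn a = a"
  using sg a by (auto simp: power_abs)

lemma sgn_sg_power: "sgn (sg ^ k) = sg ^ k"
  by (induction k) (simp_all add: sgn_mult)

lemma Ym: "Y m s = a * x m (phi s) - r"
  using m by (simp add: Y_def)

lemma Lm: "L m s = a * sg * lam m (phi s)"
  using m by (simp add: L_def)

lemma phi_in_d: "0 \<le> s \<Longrightarrow> s < d \<Longrightarrow> phi s \<in> {0<..<tf}"
  using phi_in[of s] d d0 by simp

lemma a_xm_le: "0 < s \<Longrightarrow> s < d \<Longrightarrow> a * x m (phi s) \<le> r"
  using x_le[OF m phi_in_d[of s]] a by (auto simp: Mm)

lemma contact_m_iff:
  assumes s: "0 < s" "s < d"
  shows "contact m (phi s) \<longleftrightarrow> Y m s = 0"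
proof -
  have "\<bar>x m (phi s)\<bar> = a * x m (phi s)"
    using xm_sgn[OF s] a by (auto simp: sgn_if split: if_splits)
  then show ?thesis by (simp add: contact_def Mm Ym)
qed

text \<open>Without contacts of index \<open>m + 1\<close>, \<open>lam (m + 1)\<close> is a
  primitive, hence continuous and integrable.\<close>

lemma h_int:
  assumes "min tinf (phi d) < t1" "t1 \<le> t2" "t2 < max tinf (phi d)"
  shows "(h has_integral Q t2 - Q t1) {t1..t2}"
proof (rule integral_from_base[of "min tinf (phi d)" "max tinf (phi d)", OF _ _ _ Q_def assms])
  fix t1 t2 assume t: "min tinf (phi d) < t1" "t1 \<le> t2" "t2 < max tinf (phi d)"
  show "h integrable_on {t1..t2}"
  proof (cases "m < n")
    case True
    have pos: "psi t \<in> {0<..<d}" "0 < t" "t < tf" if "t \<in> {t1..t2}" for t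
    proof -
      show "psi t \<in> {0<..<d}"
        using that t sg d by (auto simp: phi_def psi_def min_def max_def split: if_splits)
      then show "0 < t" "t < tf" using phi_in_d[of "psi t"] by auto
    qed
    have k: "m + 1 \<in> {1..n}" using True by simp
    have "continuous_on {t1..t2} (\<lambda>t. - lam (m + 1) t)"
    proof (rule primitive_continuous_on)
      fix p q assume pq: "t1 \<le> p" "p \<le> q" "q \<le> t2"
      have "\<not> contact (m + 1) t" if "t \<in> {p..q}" for t
        using only_m[OF k, of "psi t"] pos(1)[of t] pq that by simp
      then have "((\<lambda>t. if m + 1 < n then lam (m + 1 + 1) t else 0) has_integral
          lam (m + 1) p - lam (m + 1) q) {p..q}"
        by (intro lam_int[OF k]) (use pos(2,3) pq t in auto)
      then show "((\<lambda>t. if m + 1 < n then lam (m + 1 + 1) t else 0) has_integral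
          - lam (m + 1) q - - lam (m + 1) p) {p..q}"
        by simp
    qed
    then have "continuous_on {t1..t2} (lam (m + 1))"
      using continuous_on_minus[of "{t1..t2}" "\<lambda>t. - lam (m + 1) t"] by simp
    then show ?thesis using True by (simp add: h_def[abs_def] integrable_continuous_real)
  qed (simp add: h_def[abs_def] integrable_0)
qed (use sg d in \<open>auto simp: phi_def min_def max_def\<close>)

text \<open>Multiplied by \<open>a = sgn (x m t)\<close>, the multiplier term becomes
  \<open>eta m\<close> and the jump term \<open>mu m\<close>, whose signs are known; both push
  \<open>a * lam m\<close> below its regular part.\<close>

lemma lam_m_le:
  assumes t: "min tinf (phi d) < t1" "t1 \<le> t2" "t2 < max tinf (phi d)"
  shows "a * (lam m t2 - lam m t1) \<le> - a * (Q t2 - Q t1)"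
    and "(\<And>t. t \<in> {t1..t2} \<Longrightarrow> \<not> contact m t) \<Longrightarrow> a * (lam m t2 - lam m t1) = - a * (Q t2 - Q t1)"
proof -
  have pos: "psi t \<in> {0<..<d}" "t \<in> {0<..<tf}" if "t \<in> {t1..t2}" for t
  proof -
    show "psi t \<in> {0<..<d}"
      using that t sg d by (auto simp: phi_def psi_def min_def max_def split: if_splits)
    then show "t \<in> {0<..<tf}" using phi_in_d[of "psi t"] by auto
  qed
  have t12: "0 < t1" "t2 < tf" using pos(2)[of t1] pos(2)[of t2] t by auto
  have sgn: "sgn (x m t) = a" if "t \<in> {t1..t2}" for t
    using xm_sgn[of "psi t"] pos(1)[OF that] by simp
  obtain I J where IJ: "((\<lambda>\<tau>. h \<tau> + eta m \<tau> * sgn (x m \<tau>)) has_integral I) {t1..t2}"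
    "((\<lambda>\<tau>. mu m \<tau> * sgn (x m \<tau>)) has_sum J) {t1<..t2}" "lam m t2 - lam m t1 = - I + J"
    using lam_eq[OF m t12(1) t(2) t12(2)] unfolding h_def by blast
  have "((\<lambda>\<tau>. a * (eta m \<tau> * sgn (x m \<tau>))) has_integral a * (I - (Q t2 - Q t1))) {t1..t2}"
    using has_integral_mult_right[OF has_integral_diff[OF IJ(1) h_int[OF t]], of a] by simp
  then have "0 \<le> a * (I - (Q t2 - Q t1))"
  proof (rule has_integral_nonneg)
    fix t assume "t \<in> {t1..t2}"
    then show "0 \<le> a * (eta m t * sgn (x m t))"
      using sgn[of t] eta[OF m pos(2)[of t]] by (simp add: mult.left_commute[of a])
  qed
  moreover have "((\<lambda>\<tau>. - a * (mu m \<tau> * sgn (x m \<tau>))) has_sum - a * J) {t1<..t2}"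
    by (rule has_sum_cmult_right[OF IJ(2)])
  then have "0 \<le> - a * J"
  proof (rule has_sum_nonneg)
    fix t assume "t \<in> {t1<..t2}"
    then show "0 \<le> - a * (mu m t * sgn (x m t))"
      using sgn[of t] mu[OF m pos(2)[of t]] by (simp add: mult.left_commute[of a])
  qed
  ultimately show "a * (lam m t2 - lam m t1) \<le> - a * (Q t2 - Q t1)"
    unfolding IJ(3) by (simp add: algebra_simps)
  assume c: "\<And>t. t \<in> {t1..t2} \<Longrightarrow> \<not> contact m t"
  have "((\<lambda>\<tau>. if m < n then lam (m + 1) \<tau> else 0) has_integral lam m t1 - lam m t2) {t1..t2}"
    by (rule lam_int[OF m t12(1) t(2) t12(2) c])
  then have "lam m t1 - lam m t2 = Q t2 - Q t1"
    using h_int[OF t] has_integral_unique unfolding h_def[abs_def] by blast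
  then have "lam m t2 - lam m t1 = - (Q t2 - Q t1)" by simp
  then show "a * (lam m t2 - lam m t1) = - a * (Q t2 - Q t1)" by (simp only: mult_minus_left mult_minus_right)
qed

lemma G_int:
  assumes "0 < p" "p \<le> q" "q < d"
  shows "((\<lambda>s. - a * h (phi s)) has_integral G q - G p) {p..q}"
proof -
  have "((\<lambda>s. h (phi s)) has_integral sg * (Q (phi q) - Q (phi p))) {p..q}"
  proof (rule has_integral_phi[OF _ assms])
    fix t1 t2 assume t: "t1 \<le> t2" "\<And>t. t \<in> {t1..t2} \<Longrightarrow> psi t \<in> {0<..<d}"
    have "psi t1 \<in> {0<..<d}" "psi t2 \<in> {0<..<d}" using t by auto
    then show "(h has_integral Q t2 - Q t1) {t1..t2}"
      using sg t(1) by (intro h_int) (auto simp: phi_def psi_def)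
  qed
  from has_integral_mult_right[OF this, of "- a"] show ?thesis by (simp add: G_def algebra_simps)
qed

lemma phi_range: "0 < s \<Longrightarrow> s < d \<Longrightarrow> min tinf (phi d) < phi s \<and> phi s < max tinf (phi d)"
  using sg by (auto simp: phi_def)

text \<open>On the left side the direction of time and the factor \<open>sg\<close> both reverse the
  inequality, so it keeps its form.\<close>

lemma L_m_le:
  assumes p: "0 < p" "p \<le> q" "q < d"
  shows "L m q - L m p \<le> G q - G p"
    and "(\<And>s. s \<in> {p..q} \<Longrightarrow> Y m s < 0) \<Longrightarrow> L m q - L m p = G q - G p"
proof -
  have range: "min tinf (phi d) < phi p" "phi p < max tinf (phi d)"
    "min tinf (phi d) < phi q" "phi q < max tinf (phi d)"
    using phi_range[of p] phi_range[of q] p by auto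
  have "(L m q - L m p \<le> G q - G p) \<and>
    ((\<forall>s\<in>{p..q}. Y m s < 0) \<longrightarrow> L m q - L m p = G q - G p)"
    using sg
  proof
    assume s: "sg = 1"
    have sv: "a * sg * v = a * v" "- a * sg * v = - a * v" for v using s by auto
    have le: "phi p \<le> phi q" unfolding phi_def using p s by simp
    have nc: "\<not> contact m t" if "\<forall>s\<in>{p..q}. Y m s < 0" "t \<in> {phi p..phi q}" for t
    proof -
      have "psi t \<in> {p..q}" using that(2) unfolding phi_def psi_def using s by auto
      then show ?thesis using contact_m_iff[of "psi t"] that(1) p by fastforce
    qed
    show ?thesis
      using lam_m_le[OF range(1) le range(4)] nc unfolding Lm G_def sv by (auto simp: algebra_simps)
  next
    assume s: "sg = -1"
    have sv: "a * sg * v = - (a * v)" "- a * sg * v = a * v" for v using s by auto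
    have le: "phi q \<le> phi p" unfolding phi_def using p s by simp
    have nc: "\<not> contact m t" if "\<forall>s\<in>{p..q}. Y m s < 0" "t \<in> {phi q..phi p}" for t
    proof -
      have "psi t \<in> {p..q}" using that(2) unfolding phi_def psi_def using s by auto
      then show ?thesis using contact_m_iff[of "psi t"] that(1) p by fastforce
    qed
    show ?thesis
      using lam_m_le[OF range(3) le range(2)] nc unfolding Lm G_def sv by (auto simp: algebra_simps)
  qed
  then show "L m q - L m p \<le> G q - G p"
    "(\<And>s. s \<in> {p..q} \<Longrightarrow> Y m s < 0) \<Longrightarrow> L m q - L m p = G q - G p"
    by auto
qed

lemma G_lipschitz:
  assumes p: "0 < p" "p \<le> q" "q < d"
  shows "\<bar>G q - G p\<bar> \<le> \<bar>C\<bar> * (q - p)"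
proof -
  have "norm (G q - G p) \<le> \<bar>C\<bar> * measure lborel {p..q}"
  proof (rule has_integral_bound_real[OF _ _ G_int[OF p]])
    show "norm (- a * h (phi s)) \<le> \<bar>C\<bar>" if "s \<in> {p..q} - {}" for s
      using lam_bound[of s] that p by (auto simp: h_def abs_mult)
  qed auto
  then show ?thesis using p by simp
qed

lemma G_monotone:
  "(\<forall>p q. 0 < p \<longrightarrow> p < q \<longrightarrow> q < d \<longrightarrow> G p < G q) \<or>
   (\<forall>p q. 0 < p \<longrightarrow> p < q \<longrightarrow> q < d \<longrightarrow> G q \<le> G p)"
proof -
  obtain c where c: "\<And>s. s \<in> {0<..<d} \<Longrightarrow> sgn (h (phi s)) = c"
    using lam_sgn[of "m + 1"] by (cases "m < n") (auto simp: h_def)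
  show ?thesis
  proof (cases "0 < - a * c")
    case True
    have "G p < G q" if "0 < p" "p < q" "q < d" for p q
    proof -
      have "0 < G q - G p"
      proof (rule has_integral_pos[OF G_int[of p q] _ negligible_empty])
        show "0 < - a * h (phi t)" if "t \<in> {p<..<q} - {}" for t
          using c[of t] that \<open>0 < p\<close> \<open>q < d\<close> True a by (auto simp: sgn_if split: if_splits)
      qed (use that in auto)
      then show ?thesis by simp
    qed
    then show ?thesis by blast
  next
    case False
    have "G q \<le> G p" if "0 < p" "p < q" "q < d" for p q
    proof -
      have "0 \<le> - (G q - G p)"
      proof (rule has_integral_nonneg[OF has_integral_neg[OF G_int[of p q]]])
        show "0 \<le> - (- a * h (phi t))" if "t \<in> {p..q}" for t
          using c[of t] that \<open>0 < p\<close> \<open>q < d\<close> False a by (auto simp: sgn_if split: if_splits)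
      qed (use that in auto)
      then show ?thesis by simp
    qed
    then show ?thesis by blast
  qed
qed

lemma Y_integral:
  assumes k: "k \<in> {1..m}" and p: "0 \<le> p" "p \<le> q" "q < d"
  shows "(Y (k - 1) has_integral Y k q - Y k p) {p..q}"
proof (cases "k = 1")
  case True
  have "((\<lambda>s. - M0 * sgn (lam 1 (phi s))) has_integral sg * (x 1 (phi q) - x 1 (phi p))) {p..q}"
    by (rule x1_int_phi) (use p d d0 in auto)
  from has_integral_mult_right[OF this, of "a * sg ^ m"]
  have "((\<lambda>s. a * sg ^ m * (- M0 * sgn (lam 1 (phi s)))) has_integral Y k q - Y k p) {p..q}"
    using True by (simp add: Y_def algebra_simps)
  moreover have "a * sg ^ m * (- M0 * sgn (lam 1 (phi s))) = Y (k - 1) s" for s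
    using True by (simp add: Y_def L_def sgn_mult sgn_sg_power algebra_simps)
  ultimately show ?thesis by simp
next
  case False
  then obtain j where j: "k = Suc j" "j \<noteq> 0" using k by (cases k) auto
  have "((\<lambda>s. x (k - 1) (phi s)) has_integral sg * (x k (phi q) - x k (phi p))) {p..q}"
    by (rule x_int_phi) (use p d d0 False k m in auto)
  from has_integral_mult_right[OF this, of "a * sg ^ (m + (k - 1))"]
  have "((\<lambda>s. a * sg ^ (m + (k - 1)) * x (k - 1) (phi s)) has_integral Y k q - Y k p) {p..q}"
    using j by (simp add: Y_def algebra_simps)
  moreover have "a * sg ^ (m + (k - 1)) * x (k - 1) (phi s) = Y (k - 1) s" for s
    using j k by (simp add: Y_def)
  ultimately show ?thesis by simp
qed

lemma L_integral:
  assumes k: "k \<in> {1..<m}" and p: "0 < p" "p \<le> q" "q < d"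
  shows "(L (Suc k) has_integral L k p - L k q) {p..q}"
proof -
  have "((\<lambda>s. if k < n then lam (k + 1) (phi s) else 0) has_integral
      - sg * (lam k (phi q) - lam k (phi p))) {p..q}"
    by (rule lam_int_phi[OF _ d(2) only_m p]) (use k m in auto)
  then have "((\<lambda>s. lam (k + 1) (phi s)) has_integral - sg * (lam k (phi q) - lam k (phi p))) {p..q}"
    using k m by simp
  from has_integral_mult_right[OF this, of "a * sg ^ (m + k + 2)"] show ?thesis
    by (simp add: L_def[abs_def] algebra_simps)
qed

text \<open>Only finitely many switches lie away from the limit, so \<open>s\<close> has a punctured
  neighbourhood free of them.\<close>

lemma Y1_pieces:
  assumes s: "0 < s" "s < d"
  shows "\<exists>e>0. \<exists>c c'. (\<forall>t\<in>{s..s + e}. Y 1 t = Y 1 s + c * (t - s)) \<and>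
    (\<forall>t\<in>{s - e..s}. Y 1 t = Y 1 s + c' * (t - s))"
proof -
  obtain e1 where e1: "0 < e1" "\<And>t. s / 2 < t \<Longrightarrow> t < d0 \<Longrightarrow> switch u (phi t) \<Longrightarrow> t \<noteq> s \<Longrightarrow> e1 \<le> dist s t"
    using finite_set_avoid[OF finite_switches[of "s / 2"], of s] s by auto
  define e where "e = min e1 (min (s / 2) (d - s)) / 2"
  have e: "0 < e" "e < e1" "e < s / 2" "s + e < d" using e1 s by (auto simp: e_def min_def field_simps)
  have ns: "\<not> switch u (phi t)" if "t \<in> {s - e<..<s + e}" "t \<noteq> s" for t
  proof
    assume sw: "switch u (phi t)"
    have "s / 2 < t" "t < d0" using that e(3,4) d(2) by auto
    then have "e1 \<le> dist s t" using e1(2)[OF _ _ sw that(2)] by simp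
    moreover have "dist s t < e" using that(1) by (simp add: dist_real_def abs_less_iff)
    ultimately show False using e(2) by simp
  qed
  have r: "s < s + e" "s + e < d0" and l: "0 < s - e" "s - e < s" "s < d0"
    using e s(1) d(2) by linarith+
  obtain c where c: "\<And>p t. p \<in> {s..s + e} \<Longrightarrow> t \<in> {s..s + e} \<Longrightarrow> x 1 (phi t) = x 1 (phi p) + c * (t - p)"
  proof -
    have "\<exists>c. \<forall>p\<in>{s..s + e}. \<forall>t\<in>{s..s + e}. x 1 (phi t) = x 1 (phi p) + c * (t - p)"
      by (rule no_switch_affine_phi[OF s(1) r]) (rule ns; use e(1) in simp)
    then show thesis using that by blast
  qed
  obtain c' where c': "\<And>p t. p \<in> {s - e..s} \<Longrightarrow> t \<in> {s - e..s} \<Longrightarrow> x 1 (phi t) = x 1 (phi p) + c' * (t - p)"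
  proof -
    have "\<exists>c. \<forall>p\<in>{s - e..s}. \<forall>t\<in>{s - e..s}. x 1 (phi t) = x 1 (phi p) + c * (t - p)"
      by (rule no_switch_affine_phi[OF l]) (rule ns; use e(1) in simp)
    then show thesis using that by blast
  qed
  have "Y 1 t = Y 1 s + (a * sg ^ (m + 1) * c) * (t - s)" if "t \<in> {s..s + e}" for t
  proof -
    have eq: "x 1 (phi t) = x 1 (phi s) + c * (t - s)" using c[of s t] that e(1) by simp
    show ?thesis unfolding Y_def eq by (simp add: algebra_simps)
  qed
  moreover have "Y 1 t = Y 1 s + (a * sg ^ (m + 1) * c') * (t - s)" if "t \<in> {s - e..s}" for t
  proof -
    have eq: "x 1 (phi t) = x 1 (phi s) + c' * (t - s)" using c'[of s t] that e(1) by simp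
    show ?thesis unfolding Y_def eq by (simp add: algebra_simps)
  qed
  ultimately show ?thesis using e(1) by blast
qed

sublocale local_chattering m M0 d "\<bar>C\<bar>" Y L G
proof
  show "Y 0 t = - M0 * sgn (L 1 t)" for t by (simp add: Y_def)
  show "Y k 0 = 0" if "k \<in> {1..m}" for k
    using that x_tinf[of k] xm_tinf by (auto simp: Y_def)
  show "Y m s \<le> 0" if "0 < s" "s < d" for s using a_xm_le[OF that] by (simp add: Ym)
  show "continuous_on {0<..<d} (L 1)"
    unfolding L_def[abs_def]
  proof (intro continuous_intros continuous_on_compose2[OF lam1_cont])
    show "continuous_on {0<..<d} phi" unfolding phi_def[abs_def] by (intro continuous_intros)
    show "phi ` {0<..<d} \<subseteq> {0<..<tf}" using phi_in_d by auto
  qed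
  show "\<exists>s. 0 < s \<and> s < e \<and> s < d \<and> Y m s = 0" if "0 < e" for e
    using ex_contact_m[of "min e d"] that d contact_m_iff by auto
  show False if "countable N" "0 < e" "e \<le> d" and c: "\<And>s. s \<in> {0<..<e} - N \<Longrightarrow> sgn (L 1 s) = c"
    for N e c
  proof (rule lam1_not_const[OF that(1,2)])
    fix s assume "s \<in> {0<..<e} - N"
    then have "a * sg ^ m * sgn (lam 1 (phi s)) = c"
      using c[of s] by (simp add: L_def sgn_mult sgn_sg_power)
    then have "a * sg ^ m * (a * sg ^ m * sgn (lam 1 (phi s))) = a * sg ^ m * c" by simp
    moreover have "(a * sg ^ m) * (a * sg ^ m) = 1"
      using sg_even[of m] by (simp add: power_add mult_ac)
    ultimately show "sgn (lam 1 (phi s)) = a * sg ^ m * c" by (metis mult.assoc mult_1)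
  qed (use that d in auto)
qed (use m M0 d Y_integral L_integral L_m_le G_lipschitz G_monotone Y1_pieces in auto)

end

section \<open>Transport back to the original time\<close>

context extremal_contact
begin

text \<open>For \<open>m = n\<close> the regular part of the derivative is zero, so \<open>G\<close>
  would be constant.\<close>

lemma m_less_n: "m < n"
proof (rule ccontr)
  assume "\<not> m < n"
  then have "h t = 0" for t by (simp add: h_def)
  then have "G (d / 2) = G (d / 3)"
    using G_int[of "d / 3" "d / 2"] d by simp
  then show False using G_strict_mono[of "d / 3" "d / 2"] d by simp
qed

text \<open>Since \<open>M\<close> is positive, a constraint can be active only with the sign of the
  state itself.\<close>

lemma active_contact:
  assumes s: "s \<in> state_constraints n" and act: "active M x s t"
  shows "contact (fst s) t" "snd s * \<bar>x (fst s) t\<bar> = x (fst s) t" "M (fst s) = ereal \<bar>x (fst s) t\<bar>"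
proof -
  have k: "fst s \<in> {1..n}" "snd s = 1 \<or> snd s = -1" using s by (auto simp: state_constraints_def)
  have pos: "0 < snd s * x (fst s) t" using M_pos[OF k(1)] act unfolding active_def by (metis ereal_less(2))
  then have eq: "snd s * x (fst s) t = \<bar>x (fst s) t\<bar>" using k(2) by auto
  show "contact (fst s) t" "M (fst s) = ereal \<bar>x (fst s) t\<bar>"
    using act unfolding active_def eq contact_def by simp_all
  show "snd s * \<bar>x (fst s) t\<bar> = x (fst s) t" using k(2) unfolding eq[symmetric] by auto
qed

lemma active_m_iff: "active M x (m, a) (phi s) \<longleftrightarrow> Y m s = 0"
  by (auto simp: active_def Mm Ym)

lemma active_unique:
  assumes s': "s' \<in> state_constraints n" and s: "0 < s" "s < d" and act: "active M x s' (phi s)"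
  shows "s' = (m, a)"
proof -
  have "fst s' \<in> {1..n}" using s' by (auto simp: state_constraints_def)
  then have "fst s' = m" using only_m[OF _ _ s] active_contact(1)[OF s' act] by blast
  moreover have "snd s' * \<bar>x m (phi s)\<bar> = x m (phi s)" using active_contact(2)[OF s' act] calculation by simp
  moreover have "a * \<bar>x m (phi s)\<bar> = x m (phi s)" using xm_sgn[OF s] mult_sgn_abs by metis
  moreover have "x m (phi s) \<noteq> 0" using xm_sgn[OF s] a by auto
  ultimately have "snd s' = a" "fst s' = m" by (metis abs_eq_0 mult_right_cancel, simp)
  then show ?thesis by (simp add: prod_eq_iff)
qed

text \<open>Below \<open>m\<close> the states vanish at the limit, so no constraint is active. At
  index \<open>m + 1\<close>, activity would make \<open>tinf\<close> an extremum of
  \<open>x (m + 1)\<close>, whose derivative \<open>x m tinf\<close> is not zero.\<close>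

lemma active_unique_tinf:
  assumes s': "s' \<in> state_constraints n" and act: "active M x s' tinf" and le: "fst s' \<le> m + 1"
  shows "s' = (m, a)"
proof -
  have k: "fst s' \<in> {1..n}" and a': "snd s' = 1 \<or> snd s' = -1" using s' by (auto simp: state_constraints_def)
  have M: "M (fst s') = ereal \<bar>x (fst s') tinf\<bar>" by (rule active_contact(3)[OF s' act])
  then have nz: "x (fst s') tinf \<noteq> 0" using M_pos[OF k] by auto
  then have "\<not> fst s' < m" using x_tinf[of "fst s'"] k by auto
  moreover have "fst s' \<noteq> m + 1"
  proof
    assume m1: "fst s' = m + 1"
    have "DERIV (\<lambda>t. snd s' * x (m + 1) t) tinf :> snd s' * x m tinf"
      using x_deriv[of "m + 1" tinf] k m1 m tinf by (auto intro!: derivative_eq_intros)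
    then have "snd s' * x m tinf = 0"
    proof (rule DERIV_local_max)
      show "0 < min tinf (tf - tinf)" using tinf by simp
      show "\<forall>t. \<bar>tinf - t\<bar> < min tinf (tf - tinf) \<longrightarrow> snd s' * x (m + 1) t \<le> snd s' * x (m + 1) tinf"
      proof (intro allI impI)
        fix t assume "\<bar>tinf - t\<bar> < min tinf (tf - tinf)"
        then have "t \<in> {0<..<tf}" by auto
        then have "\<bar>x (m + 1) t\<bar> \<le> \<bar>x (m + 1) tinf\<bar>" using x_le[of "m + 1" t] k m1 M by simp
        moreover have "snd s' * x (m + 1) t \<le> \<bar>x (m + 1) t\<bar>" using a' by auto
        moreover have "snd s' * x (m + 1) tinf = \<bar>x (m + 1) tinf\<bar>"
          using active_contact(2)[OF s' act] m1 a' by auto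
        ultimately show "snd s' * x (m + 1) t \<le> snd s' * x (m + 1) tinf" by linarith
      qed
    qed
    then show False using a' xm_tinf a r by auto
  qed
  ultimately have "fst s' = m" using le by simp
  moreover have "snd s' * \<bar>a * r\<bar> = a * r"
    using active_contact(2)[OF s' act] xm_tinf calculation by simp
  then have "snd s' = a" using r by (simp add: abs_mult)
  ultimately show ?thesis by (simp add: prod_eq_iff)
qed

lemma open_segment_tinf: "0 \<le> s \<Longrightarrow> open_segment (phi s) tinf = phi ` {0<..<s}"
  using open_segment_phi[of s 0] by (simp add: open_segment_eq_real_ivl)

lemma closed_segment_tinf: "0 \<le> s \<Longrightarrow> closed_segment (phi s) tinf = phi ` {0..s}"
  using closed_segment_phi[of s 0] by (simp add: closed_segment_eq_real_ivl)

lemma at_tinf_within: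
  assumes e: "0 < e"
  shows "at tinf within phi ` {0<..<e} = filtermap phi (at_right 0)"
proof -
  have "at 0 within {0<..<e} = at_right (0::real)"
    by (rule at_within_nhd[of _ "{..<e}"]) (use e in auto)
  then show ?thesis using filtermap_signed[OF sg, of tinf 0 "{0<..<e}"]
    by (simp add: phi_def[abs_def])
qed

lemma sg_phi: "sg * phi s = sg * tinf + s"
  by (simp add: phi_def algebra_simps)

lemma lam_phi: "lam m (phi s) = a * sg * L m s"
  by (simp add: Lm algebra_simps)

lemma abs_sg [simp]: "\<bar>sg\<bar> = 1"
  using sg by auto

lemma L_eq_0_iff: "L k s = 0 \<longleftrightarrow> lam k (phi s) = 0"
  using sg a by (auto simp: L_def)

lemma abs_L: "\<bar>L k s\<bar> = \<bar>lam k (phi s)\<bar>"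
  by (simp add: L_def abs_mult)

lemma crosses_zero_phi: "crosses_zero (lam k) (phi s) \<longleftrightarrow> crosses_zero (L k) s"
  using crosses_zero_signed[OF sg, of "lam k" tinf s] crosses_zero_mult[of "a * sg ^ (m + k + 1)"] sg a
  unfolding L_def[abs_def] phi_def by auto

text \<open>Contacts are isolated, so every active time is inactive on both sides and thus a
  junction.\<close>

lemma junction_iff:
  assumes s: "0 < s" "s < d"
  shows "(\<exists>s'\<in>state_constraints n. junction M x s' (phi s)) \<longleftrightarrow> Y m s = 0"
proof
  assume "\<exists>s'\<in>state_constraints n. junction M x s' (phi s)"
  then obtain s' where s': "s' \<in> state_constraints n" "active M x s' (phi s)" by (auto simp: junction_def)
  then show "Y m s = 0" using active_unique[OF s'(1) s s'(2)] active_m_iff by simp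
next
  assume z: "Y m s = 0"
  obtain e where e: "0 < e" "\<And>t. t \<in> {s - e..s + e} \<Longrightarrow> t \<noteq> s \<Longrightarrow> Y m t < 0"
    by (rule active_isolated[OF s], rule that)
  have "\<forall>\<^sub>F t in at s. t \<in> {s - e<..<s + e}" using e(1) by (intro eventually_at_in_open') auto
  moreover have "\<forall>\<^sub>F t in at s. t \<noteq> s" by (simp add: eventually_at_filter)
  ultimately have "\<forall>\<^sub>F t in at s. \<not> active M x (m, a) (phi t)"
  proof eventually_elim
    case (elim t)
    then show ?case using e(2)[of t] by (simp add: active_m_iff)
  qed
  then have "\<forall>\<^sub>F t in filtermap phi (at s). \<not> active M x (m, a) t"
    unfolding eventually_filtermap .
  moreover have "filtermap phi (at s) = at (phi s)"
  proof -
    have "surj phi" by (rule surjI[of phi psi]) simp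
    then show ?thesis
      using filtermap_signed[OF sg, of tinf s UNIV] unfolding phi_def[abs_def] by simp
  qed
  ultimately have "\<forall>\<^sub>F t in at (phi s). \<not> active M x (m, a) t" by simp
  then have "\<forall>\<^sub>F t in at_left (phi s). \<not> active M x (m, a) t" by (simp add: eventually_at_split)
  moreover have "(m, a) \<in> state_constraints n" using m a by (auto simp: state_constraints_def)
  ultimately show "\<exists>s'\<in>state_constraints n. junction M x s' (phi s)"
    using z active_m_iff[of s] unfolding junction_def by blast
qed

text \<open>For \<open>sg = -1\<close> the one-sided limits exchange their roles, and the factor
  \<open>sg\<close> reverses their order again.\<close>

lemma lam_m_limits:
  assumes s: "0 < s" "s < d"
  shows "\<exists>l r. (lam m \<longlongrightarrow> l) (at_left (phi s)) \<and> (lam m \<longlongrightarrow> r) (at_right (phi s)) \<and> a * r \<le> a * l"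
proof -
  obtain l r where lr: "(L m \<longlongrightarrow> l) (at_left s)" "(L m \<longlongrightarrow> r) (at_right s)" "r \<le> l"
    by (rule Lm_limits[OF s], rule that)
  have lim: "((\<lambda>s. lam m (phi s)) \<longlongrightarrow> a * sg * l) (at_left s)" "((\<lambda>s. lam m (phi s)) \<longlongrightarrow> a * sg * r) (at_right s)"
    unfolding lam_phi by (intro tendsto_intros lr)+
  show ?thesis
    using sg
  proof
    assume s1: "sg = 1"
    then have ph: "phi = (\<lambda>s. tinf + s)" unfolding phi_def[abs_def] by simp
    have "(lam m \<longlongrightarrow> a * sg * l) (at_left (phi s))" "(lam m \<longlongrightarrow> a * sg * r) (at_right (phi s))"
      using lim unfolding ph filtermap_pos[symmetric] filterlim_filtermap by simp_all
    then show ?thesis using lr(3) s1 by (intro exI[of _ "a * sg * l"] exI[of _ "a * sg * r"]) simp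
  next
    assume s1: "sg = -1"
    then have ph: "phi = (\<lambda>s. tinf - s)" unfolding phi_def[abs_def] by simp
    have "(lam m \<longlongrightarrow> a * sg * r) (at_left (phi s))" "(lam m \<longlongrightarrow> a * sg * l) (at_right (phi s))"
      using lim unfolding ph filtermap_neg[symmetric] filterlim_filtermap by simp_all
    then show ?thesis using lr(3) s1 by (intro exI[of _ "a * sg * r"] exI[of _ "a * sg * l"]) simp
  qed
qed

lemma x_dist:
  assumes k: "k \<in> {1..m}" and s: "0 \<le> s" "s < d"
  shows "\<bar>x k (phi s) - x k tinf\<bar> \<le> M0 * s ^ k"
proof -
  have "Y k s - Y k 0 = a * sg ^ (m + k) * (x k (phi s) - x k tinf)"
    using k by (simp add: Y_def algebra_simps)
  then have "\<bar>x k (phi s) - x k tinf\<bar> = \<bar>Y k s - Y k 0\<bar>" by (simp add: abs_mult)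
  then show ?thesis using Y_bound[of k s] Y_zero[OF k] k s by simp
qed

lemma x_tendsto:
  assumes "k \<in> {1..n}"
  shows "(x k \<longlongrightarrow> x k tinf) (at tinf within S)"
proof -
  have "isCont (x k) tinf" using x_cont[OF assms] tinf by (simp add: continuous_on_eq_continuous_at)
  then show ?thesis unfolding isCont_def by (rule tendsto_within_subset) simp
qed

text \<open>The bound increases with \<open>s\<close>, so it passes from the points to the supremum
  over the segment towards the limit.\<close>

lemma sup_bigo:
  assumes e: "0 < e" and bd: "\<And>s. 0 \<le> s \<Longrightarrow> s \<le> e \<Longrightarrow> \<bar>f (phi s)\<bar> \<le> B * s ^ k" and B: "0 \<le> B"
  shows "t \<in> phi ` {0<..<e} \<Longrightarrow> bdd_above ((\<lambda>\<tau>. \<bar>f \<tau>\<bar>) ` closed_segment t tinf)"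
    and "(\<lambda>t. SUP \<tau>\<in>closed_segment t tinf. \<bar>f \<tau>\<bar>) \<in> O[filtermap phi (at_right 0)](\<lambda>t. \<bar>tinf - t\<bar> ^ k)"
proof -
  have le: "\<bar>f \<tau>\<bar> \<le> B * s ^ k" if "0 < s" "s \<le> e" "\<tau> \<in> closed_segment (phi s) tinf" for s \<tau>
  proof -
    have "\<tau> \<in> phi ` {0..s}" using that closed_segment_tinf[of s] by simp
    then obtain s' where s': "\<tau> = phi s'" "0 \<le> s'" "s' \<le> s" by auto
    then have "\<bar>f \<tau>\<bar> \<le> B * s' ^ k" using bd[of s'] that by simp
    also have "\<dots> \<le> B * s ^ k" using s' B by (intro mult_left_mono power_mono) auto
    finally show ?thesis .
  qed
  show "bdd_above ((\<lambda>\<tau>. \<bar>f \<tau>\<bar>) ` closed_segment t tinf)" if t: "t \<in> phi ` {0<..<e}"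
  proof -
    obtain s where "t = phi s" "0 < s" "s \<le> e" using t by auto
    then show ?thesis using le by (intro bdd_aboveI2[of _ _ "B * s ^ k"]) auto
  qed
  have "\<bar>SUP \<tau>\<in>closed_segment (phi s) tinf. \<bar>f \<tau>\<bar>\<bar> \<le> B * s ^ k" if s: "0 < s" "s < e" for s
    by (rule cSup_abs_le) (use le[of s] s in auto)
  moreover have "\<bar>tinf - phi s\<bar> = \<bar>s\<bar>" for s using sg by (auto simp: phi_def)
  ultimately show "(\<lambda>t. SUP \<tau>\<in>closed_segment t tinf. \<bar>f \<tau>\<bar>) \<in> O[filtermap phi (at_right 0)](\<lambda>t. \<bar>tinf - t\<bar> ^ k)"
    using e by (intro bigoI[of _ B]) (auto simp: eventually_filtermap eventually_at_right_field)
qed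

text \<open>The length \<open>e\<close> comes from \<open>L_order\<close>, so the costate bounds
  hold up to it; being smaller than \<open>d\<close>, it keeps the sign statements valid at the
  closed end \<open>phi e\<close>.\<close>

lemma chattering_structure_contact:
  obtains e f where "0 < e" "e < d" "\<And>i. f (Suc i) < f i"
    "only_active n M x tinf (phi e) (m, a)"
    "chattering_structure n M x u lam tinf (phi e) (m, a) (\<lambda>i. phi (f i))"
proof -
  obtain B e where B: "0 < B" and e: "0 < e" "e < d"
    and L_bd: "\<And>k s. k \<in> {1..m} \<Longrightarrow> 0 < s \<Longrightarrow> s \<le> e \<Longrightarrow> \<bar>L k s\<bar> \<le> B * s ^ (m - k + 1)"
    by (rule L_order, rule that)
  define A where "A = {s \<in> {0<..<e}. Y m s = 0}"
  \<comment> \<open>The contacts are listed from the outermost one inwards, so that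
    \<open>phi (f i)\<close> approaches \<open>tinf\<close> monotonically from its side.\<close>
  obtain f :: "nat \<Rightarrow> real" where f_dec: "\<And>i. f (Suc i) < f i" and f_range: "range f = A"
    and f_lim: "f \<longlonglongrightarrow> 0" and f_gap: "\<And>i t. t \<in> A \<Longrightarrow> t < f i \<Longrightarrow> t \<le> f (Suc i)"
  proof (rule enumerate_decreasing[of A])
    show "0 < s" if "s \<in> A" for s using that by (simp add: A_def)
    show "finite {t \<in> A. s \<le> t}" if "0 < s" for s
      by (rule finite_subset[OF _ finite_active[OF that e(2)]]) (auto simp: A_def)
    show "\<exists>s\<in>A. s < e'" if "0 < e'" for e'
      using accumulate[of "min e e'"] e that by (auto simp: A_def)
  qed (rule that)
  have f_in: "0 < f i" "f i < e" "f i < d" "Y m (f i) = 0" for i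
  proof -
    have "f i \<in> A" using f_range by blast
    then show "0 < f i" "f i < e" "f i < d" "Y m (f i) = 0" using e by (auto simp: A_def)
  qed
  define T where "T = open_segment (phi e) tinf"
  define F where "F = at tinf within T"
  define lam_end where "lam_end k = (lam k)(tinf := Lim F (lam k))" for k
  have T: "T = phi ` {0<..<e}" unfolding T_def by (rule open_segment_tinf) (use e in simp)
  have F: "F = filtermap phi (at_right 0)" unfolding F_def T by (rule at_tinf_within[OF e(1)])
  have T_elim: "\<exists>s. t = phi s \<and> 0 < s \<and> s < e \<and> s < d" if "t \<in> T" for t
    using that e unfolding T by auto
  have gap: "open_segment (phi (f i)) (phi (f (Suc i))) = phi ` {f (Suc i)<..<f i}" for i
    using open_segment_phi f_dec[of i] by (simp add: open_segment_eq_real_ivl)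
  have free: "Y m t < 0" if "t \<in> {f (Suc i)<..<f i}" for i t
  proof -
    have t: "0 < t" "t < e" using that f_in[of i] f_in[of "Suc i"] by auto
    have "t \<notin> A" using f_gap[of t i] that by auto
    then show ?thesis using t e Y_le[of t] by (auto simp: A_def less_le)
  qed
  have img: "{t \<in> phi ` I. P t} = phi ` {s \<in> I. P (phi s)}" for I P by auto
  have inj: "inj_on phi I" for I by (auto simp: inj_on_def)
  have lam_lim: "(lam k \<longlongrightarrow> 0) F" if k: "k \<in> {1..m}" for k
    unfolding F filterlim_filtermap
  proof (rule Lim_null_comparison)
    have "\<bar>lam k (phi s)\<bar> \<le> B * s ^ (m - k + 1)" if "0 < s" "s < e" for s
      using L_bd[OF k, of s] that by (simp add: abs_L)
    then show "\<forall>\<^sub>F s in at_right 0. norm (lam k (phi s)) \<le> B * s ^ (m - k + 1)"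
      using e(1) unfolding eventually_at_right_field by (intro exI[of _ e]) auto
    have "((\<lambda>s. B * s ^ (m - k + 1)) \<longlongrightarrow> B * 0 ^ (m - k + 1)) (at_right 0)" by (intro tendsto_intros)
    then show "((\<lambda>s. B * s ^ (m - k + 1)) \<longlongrightarrow> 0) (at_right 0)" by simp
  qed
  have "F \<noteq> bot" unfolding F by (simp add: filtermap_bot_iff trivial_limit_at_right_real)
  then have lam_end_tinf: "lam_end k tinf = 0" if "k \<in> {1..m}" for k
    using tendsto_Lim[OF _ lam_lim[OF that]] by (simp add: lam_end_def)
  \<comment> \<open>\<open>lam_end\<close> differs from \<open>lam\<close> only at
    \<open>s = 0\<close>, where the limit value zero satisfies the bound trivially.\<close>
  have lam_end_bd: "\<bar>lam_end k (phi s)\<bar> \<le> B * s ^ (m - k + 1)" if k: "k \<in> {1..m}" and s: "0 \<le> s" "s \<le> e" for k s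
  proof (cases "s = 0")
    case False
    then have "phi s \<noteq> tinf" by (metis phi_0 phi_eq_iff)
    then show ?thesis using L_bd[OF k, of s] False s by (simp add: lam_end_def abs_L)
  qed (use lam_end_tinf[OF k] in simp)
  have "(\<lambda>i. tinf + sg * f i) \<longlonglongrightarrow> tinf + sg * 0" by (intro tendsto_intros f_lim)
  then have ts_lim: "(\<lambda>i. phi (f i)) \<longlonglongrightarrow> tinf" by (simp add: phi_def)
  have zeros: "finite {t \<in> phi ` {f (Suc i)<..<f i}. lam k t = 0} \<and>
      card {t \<in> phi ` {f (Suc i)<..<f i}. lam k t = 0} \<le> m - k + 1" if k: "k \<in> {1..m}" for i k
  proof -
    have "finite {s \<in> {f (Suc i)<..<f i}. L k s = 0}" "card {s \<in> {f (Suc i)<..<f i}. L k s = 0} \<le> m - k + 1"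
      using card_zeros_L[OF _ f_dec[of i] _ free k] f_in[of i] f_in[of "Suc i"] by auto
    then show ?thesis unfolding img by (simp add: card_image[OF inj] L_eq_0_iff)
  qed
  \<comment> \<open>Switches in the gap are roots of \<open>lam 1\<close>, and for
    \<open>k = 1\<close> the root bound \<open>m - k + 1\<close> equals \<open>m\<close>.\<close>
  have switches: "finite {t \<in> phi ` {f (Suc i)<..<f i}. switch u t} \<and>
      card {t \<in> phi ` {f (Suc i)<..<f i}. switch u t} \<le> m" for i
  proof -
    have "{t \<in> phi ` {f (Suc i)<..<f i}. switch u t} \<subseteq> {t \<in> phi ` {f (Suc i)<..<f i}. lam 1 t = 0}"
    proof clarify
      fix s assume s: "s \<in> {f (Suc i)<..<f i}" "switch u (phi s)"
      have "phi s \<in> {0<..<tf}" by (rule phi_in_d) (use s f_in[of i] f_in[of "Suc i"] in auto)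
      then have "lam 1 (phi s) = 0" using s(2) by (rule switch_imp_zero)
      then show "phi s \<in> phi ` {f (Suc i)<..<f i} \<and> lam 1 (phi s) = 0" using s(1) by blast
    qed
    moreover have "finite {t \<in> phi ` {f (Suc i)<..<f i}. lam 1 t = 0}"
      "card {t \<in> phi ` {f (Suc i)<..<f i}. lam 1 t = 0} \<le> m"
      using zeros[of 1 i] m by auto
    ultimately show ?thesis by (meson card_mono finite_subset order_trans)
  qed
  have mono: "strict_mono_on (phi ` {f (Suc i)<..<f i}) (\<lambda>t. a * lam m t)" for i
  proof (rule strict_mono_onI)
    fix t t' assume t: "t \<in> phi ` {f (Suc i)<..<f i}" "t' \<in> phi ` {f (Suc i)<..<f i}" "t < t'"
    then obtain s s' where s: "t = phi s" "t' = phi s'" "s \<in> {f (Suc i)<..<f i}" "s' \<in> {f (Suc i)<..<f i}"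
      by auto
    have lt: "L m p < L m q" if "p \<in> {f (Suc i)<..<f i}" "q \<in> {f (Suc i)<..<f i}" "p < q" for p q
      by (rule Lm_strict_mono) (use that f_in[of i] f_in[of "Suc i"] in \<open>auto intro!: free[of _ i]\<close>)
    have al: "a * lam m (phi s) = sg * L m s" for s by (simp add: lam_phi mult.assoc)
    \<comment> \<open>\<open>phi\<close> reverses the order if \<open>sg = -1\<close>; the factor
      \<open>sg\<close> in \<open>al\<close> does the same, so \<open>lt\<close> applies with
      \<open>s\<close> and \<open>s'\<close> in the matching order.\<close>
    have "sg * (s' - s) > 0" using t(3) unfolding s phi_def by (simp add: algebra_simps)
    then show "a * lam m t < a * lam m t'"
      unfolding s al using lt[OF s(3,4)] lt[OF s(4,3)] sg by auto
  qed
  have ts_range: "range (\<lambda>i. phi (f i)) = phi ` A" by (simp add: f_range[symmetric] image_image)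
  have active_T: "{t \<in> T. active M x (m, a) t} = range (\<lambda>i. phi (f i))"
    unfolding T img active_m_iff ts_range A_def ..
  have junction_T: "{t \<in> T. \<exists>s'\<in>state_constraints n. junction M x s' t} = range (\<lambda>i. phi (f i))"
  proof -
    have "{s \<in> {0<..<e}. \<exists>s'\<in>state_constraints n. junction M x s' (phi s)} = A"
      unfolding A_def
    proof (rule Collect_cong, rule conj_cong[OF refl])
      fix s assume "s \<in> {0<..<e}"
      then show "(\<exists>s'\<in>state_constraints n. junction M x s' (phi s)) \<longleftrightarrow> Y m s = 0"
        using e by (intro junction_iff) auto
    qed
    then show ?thesis unfolding T img ts_range by simp
  qed
  have crossings: "infinite {\<tau> \<in> open_segment t tinf. crosses_zero (lam k) \<tau>}"
    if k: "k \<in> {1..m}" and t: "t \<in> T" for k t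
  proof -
    obtain s where s: "t = phi s" "0 < s" "s < d" using T_elim[OF t] by blast
    have "infinite {s' \<in> {0<..<s}. crosses_zero (L k) s'}" by (rule infinite_crossings[OF k]) (use s in auto)
    then have "infinite (phi ` {s' \<in> {0<..<s}. crosses_zero (L k) s'})"
      by (metis (no_types, lifting) finite_imageD inj)
    moreover have "0 \<le> s" using s by simp
    ultimately show ?thesis unfolding s(1) by (simp only: open_segment_tinf img crosses_zero_phi not_False_eq_True)
  qed
  have sgn_closed: "sgn (x m t) = a" if "t \<in> closed_segment (phi e) tinf" for t
  proof -
    have "t \<in> phi ` {0..e}" using that closed_segment_tinf[of e] e by simp
    then obtain s where s: "t = phi s" "0 \<le> s" "s \<le> e" by auto
    show ?thesis
    proof (cases "s = 0")
      case True
      then show ?thesis using s xm_tinf r by (simp add: sgn_mult)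
    qed (use s xm_sgn[of s] e in auto)
  qed
  have const: "(\<lambda>t. sgn (x k t)) constant_on T" "(\<lambda>t. sgn (lam k t)) constant_on T" if k: "k \<in> {m<..n}" for k
  proof -
    obtain c c' where "\<And>s. s \<in> {0<..<d} \<Longrightarrow> sgn (x k (phi s)) = c" "\<And>s. s \<in> {0<..<d} \<Longrightarrow> sgn (lam k (phi s)) = c'"
      using x_sgn[OF k] lam_sgn[OF k] by blast
    then show "(\<lambda>t. sgn (x k t)) constant_on T" "(\<lambda>t. sgn (lam k t)) constant_on T"
      unfolding T constant_on_def using e by auto
  qed
  have x_bigo: "t \<in> T \<Longrightarrow> bdd_above ((\<lambda>\<tau>. \<bar>x k \<tau> - x k tinf\<bar>) ` closed_segment t tinf)"
    "(\<lambda>t. SUP \<tau>\<in>closed_segment t tinf. \<bar>x k \<tau> - x k tinf\<bar>) \<in> O[F](\<lambda>t. \<bar>tinf - t\<bar> ^ k)"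
    if k: "k \<in> {1..m}" for k t
  proof -
    have bd: "\<bar>x k (phi s) - x k tinf\<bar> \<le> M0 * s ^ k" if "0 \<le> s" "s \<le> e" for s
      by (rule x_dist[OF k]) (use that e in auto)
    note * = sup_bigo[where f = "\<lambda>t. x k t - x k tinf", OF e(1) bd less_imp_le[OF M0]]
    show "t \<in> T \<Longrightarrow> bdd_above ((\<lambda>\<tau>. \<bar>x k \<tau> - x k tinf\<bar>) ` closed_segment t tinf)"
      unfolding T by (rule *(1))
    show "(\<lambda>t. SUP \<tau>\<in>closed_segment t tinf. \<bar>x k \<tau> - x k tinf\<bar>) \<in> O[F](\<lambda>t. \<bar>tinf - t\<bar> ^ k)"
      unfolding F by (rule *(2))
  qed
  have lam_bigo: "t \<in> T \<Longrightarrow> bdd_above ((\<lambda>\<tau>. \<bar>lam_end k \<tau>\<bar>) ` closed_segment t tinf)"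
    "(\<lambda>t. SUP \<tau>\<in>closed_segment t tinf. \<bar>lam_end k \<tau>\<bar>) \<in> O[F](\<lambda>t. \<bar>tinf - t\<bar> ^ (m - k + 1))"
    if k: "k \<in> {1..m}" for k t
  proof -
    note * = sup_bigo[where f = "lam_end k", OF e(1) lam_end_bd[OF k] less_imp_le[OF B]]
    show "t \<in> T \<Longrightarrow> bdd_above ((\<lambda>\<tau>. \<bar>lam_end k \<tau>\<bar>) ` closed_segment t tinf)"
      unfolding T by (rule *(1))
    show "(\<lambda>t. SUP \<tau>\<in>closed_segment t tinf. \<bar>lam_end k \<tau>\<bar>) \<in> O[F](\<lambda>t. \<bar>tinf - t\<bar> ^ (m - k + 1))"
      unfolding F by (rule *(2))
  qed
  have range_T: "range (\<lambda>i. phi (f i)) \<subseteq> T" using active_T by blast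
  have x_lim: "(x k \<longlongrightarrow> 0) F \<and> x k tinf = 0" if "k \<in> {1..<m}" for k
    using x_tendsto[of k T] x_tinf[OF that] that m unfolding F_def by auto
  have xm_lim: "(x m \<longlongrightarrow> real_of_ereal (M m) * a) F \<and> x m tinf = real_of_ereal (M m) * a"
    using x_tendsto[OF m, of T] xm_tinf unfolding F_def Mm by (simp add: mult.commute)
  have only: "only_active n M x tinf (phi e) (m, a)"
    unfolding only_active_def
  proof (intro conjI ballI impI)
    show "(m, a) \<in> state_constraints n" using m a by (auto simp: state_constraints_def)
    have "active M x (m, a) tinf" using active_m_iff[of 0] Y_zero[of m] m by simp
    then show "\<exists>t\<in>closed_segment (phi e) tinf. active M x (m, a) t" by auto
    fix s' t assume s': "s' \<in> state_constraints n" and t: "t \<in> closed_segment (phi e) tinf"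
      and act: "active M x s' t \<and> (t \<noteq> tinf \<or> fst s' \<le> fst (m, a) + 1)"
    have "t \<in> phi ` {0..e}" using t closed_segment_tinf[of e] e by simp
    then obtain s where s: "t = phi s" "0 \<le> s" "s \<le> e" by auto
    show "s' = (m, a)"
    proof (cases "s = 0")
      case True
      then show ?thesis using active_unique_tinf[OF s'] act s by simp
    next
      case False
      then show ?thesis using active_unique[OF s', of s] act s e by simp
    qed
  qed
  have struct: "chattering_structure n M x u lam tinf (phi e) (m, a) (\<lambda>i. phi (f i))"
    unfolding chattering_structure_def Let_def fst_conv snd_conv T_def[symmetric] F_def[symmetric]
      lam_end_def[symmetric] gap
  proof (intro conjI ballI allI)
    show "1 < m" using m_ge_2 by simp
    show "m < n" by (rule m_less_n)
    show "range (\<lambda>i. phi (f i)) \<subseteq> T" by (rule range_T)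
    show "(\<lambda>i. phi (f i)) \<longlonglongrightarrow> tinf" by (rule ts_lim)
    show "{t \<in> T. active M x (m, a) t} = range (\<lambda>i. phi (f i))" by (rule active_T)
    show "{t \<in> T. \<exists>s'\<in>state_constraints n. junction M x s' t} = range (\<lambda>i. phi (f i))"
      by (rule junction_T)
    show "sgn (x m t) = a" if "t \<in> closed_segment (phi e) tinf" for t by (rule sgn_closed[OF that])
    show "(\<lambda>t. sgn (x k t)) constant_on T" "(\<lambda>t. sgn (lam k t)) constant_on T" if "k \<in> {m<..n}" for k
      by (rule const[OF that])+
    show "finite {t \<in> phi ` {f (Suc i)<..<f i}. lam k t = 0}"
      "card {t \<in> phi ` {f (Suc i)<..<f i}. lam k t = 0} \<le> m - k + 1" if "k \<in> {1..m}" for i k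
      using zeros[OF that] by blast+
    show "finite {t \<in> phi ` {f (Suc i)<..<f i}. switch u t}"
      "card {t \<in> phi ` {f (Suc i)<..<f i}. switch u t} \<le> m" for i
      using switches by blast+
    show "infinite {\<tau> \<in> open_segment t tinf. crosses_zero (lam k) \<tau>}"
      if "k \<in> {1..m}" "t \<in> T" for k t
      by (rule crossings[OF that])
    show "strict_mono_on (phi ` {f (Suc i)<..<f i}) (\<lambda>t. a * lam m t)" for i by (rule mono)
    show "\<exists>l r. (lam m \<longlongrightarrow> l) (at_left (phi (f i))) \<and> (lam m \<longlongrightarrow> r) (at_right (phi (f i))) \<and> a * r \<le> a * l"
      for i by (rule lam_m_limits[OF f_in(1,3)])
    show "bdd_above ((\<lambda>\<tau>. \<bar>x k \<tau> - x k tinf\<bar>) ` closed_segment t tinf)"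
      "bdd_above ((\<lambda>\<tau>. \<bar>lam_end k \<tau>\<bar>) ` closed_segment t tinf)" if "k \<in> {1..m}" "t \<in> T" for k t
      by (rule x_bigo(1)[OF that] lam_bigo(1)[OF that])+
    show "(\<lambda>t. SUP \<tau>\<in>closed_segment t tinf. \<bar>x k \<tau> - x k tinf\<bar>) \<in> O[F](\<lambda>t. \<bar>tinf - t\<bar> ^ k)"
      "(\<lambda>t. SUP \<tau>\<in>closed_segment t tinf. \<bar>lam_end k \<tau>\<bar>) \<in> O[F](\<lambda>t. \<bar>tinf - t\<bar> ^ (m - k + 1))"
      if "k \<in> {1..m}" for k
      by (rule x_bigo(2)[OF that] lam_bigo(2)[OF that])+
    show "(x k \<longlongrightarrow> 0) F" "x k tinf = 0" if "k \<in> {1..<m}" for k using x_lim[OF that] by blast+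
    show "(x m \<longlongrightarrow> real_of_ereal (M m) * a) F" "x m tinf = real_of_ereal (M m) * a"
      using xm_lim by blast+
    show "(lam k \<longlongrightarrow> 0) F" "lam_end k tinf = 0" if "k \<in> {1..m}" for k
      by (rule lam_lim[OF that] lam_end_tinf[OF that])+
  qed
  show thesis by (rule that[OF e f_dec only struct])
qed

end

lemma (in extremal) ex_extremal_contact:
  "\<exists>m a r d C. extremal_contact n M0 tf tinf sg tb M x lam eta mu u m a r d C"
proof -
  obtain m where m: "m \<in> {1..n}" and fr: "\<exists>\<^sub>F s in at_right 0. contact m (phi s)"
    by (rule ex_contact)
  obtain a r where a: "a = 1 \<or> a = -1" and r: "M m = ereal r" "0 < r" and xm: "x m tinf = a * r"
    and x0: "\<And>k. k \<in> {1..<m} \<Longrightarrow> x k tinf = 0"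
    by (rule contact_limit[OF m fr], rule that)
  have nz: "x m tinf \<noteq> 0" using xm a r by auto
  have nc: "\<forall>\<^sub>F s in at_right 0. \<not> contact k (phi s)" if k: "k \<in> {1..n}" "k \<noteq> m" for k
  proof (rule ccontr)
    assume "\<not> ?thesis"
    then have "\<exists>\<^sub>F s in at_right 0. contact k (phi s)" by (simp add: not_eventually)
    then obtain a' r' where a': "a' = 1 \<or> a' = -1" "0 < r'" "x k tinf = a' * r'"
      and x0': "\<And>j. j \<in> {1..<k} \<Longrightarrow> x j tinf = 0"
      by (rule contact_limit[OF k(1)]) (rule that)
    show False
    proof (cases "k < m")
      case True
      then show ?thesis using x0[of k] a' k by auto
    next
      case False
      then show ?thesis using x0'[of m] nz k m by auto
    qed
  qed
  have sgn_a: "sgn (x m tinf) = a" using xm a r by (auto simp: sgn_mult)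
  have "\<forall>k\<in>{m<..n}. \<exists>c. \<forall>\<^sub>F s in at_right 0. sgn (x k (phi s)) = c"
    using x_eventually_const_sgn[OF m nz] unfolding eventually_const_sgn_def by auto
  then obtain cx where cx: "\<And>k. k \<in> {m<..n} \<Longrightarrow> \<forall>\<^sub>F s in at_right 0. sgn (x k (phi s)) = cx k"
    by metis
  have "\<forall>k\<in>{m<..n}. \<exists>c. \<forall>\<^sub>F s in at_right 0. sgn (lam k (phi s)) = c"
    using lam_eventually_const_sgn[of "m + 1"] nc unfolding eventually_const_sgn_def by auto
  then obtain cl where cl: "\<And>k. k \<in> {m<..n} \<Longrightarrow> \<forall>\<^sub>F s in at_right 0. sgn (lam k (phi s)) = cl k"
    by metis
  have "\<exists>C. m < n \<longrightarrow> (\<forall>\<^sub>F s in at_right 0. \<bar>lam (m + 1) (phi s)\<bar> \<le> C)"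
    using lam_bounded[of "m + 1" "m + 1"] nc by auto
  then obtain C where C: "m < n \<Longrightarrow> \<forall>\<^sub>F s in at_right 0. \<bar>lam (m + 1) (phi s)\<bar> \<le> C" by blast
  have C': "\<forall>\<^sub>F s in at_right 0. m < n \<longrightarrow> \<bar>lam (m + 1) (phi s)\<bar> \<le> C"
    using C by (cases "m < n") auto
  \<comment> \<open>There are finitely many indices, so all eventual properties hold together on one
    interval.\<close>
  have "\<forall>\<^sub>F s in at_right 0. (0 < s \<and> s < d0) \<and> (\<forall>k\<in>{1..n} - {m}. \<not> contact k (phi s)) \<and>
      sgn (x m (phi s)) = sgn (x m tinf) \<and> (\<forall>k\<in>{m<..n}. sgn (x k (phi s)) = cx k) \<and>
      (\<forall>k\<in>{m<..n}. sgn (lam k (phi s)) = cl k) \<and> (m < n \<longrightarrow> \<bar>lam (m + 1) (phi s)\<bar> \<le> C)"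
    by (intro eventually_conj eventually_d0 x_eventually_sgn m nz C' eventually_ball_finite ballI cx cl)
      (use nc in auto)
  then obtain e where e: "0 < e" "\<And>s. 0 < s \<Longrightarrow> s < e \<Longrightarrow>
      (0 < s \<and> s < d0) \<and> (\<forall>k\<in>{1..n} - {m}. \<not> contact k (phi s)) \<and>
      sgn (x m (phi s)) = sgn (x m tinf) \<and> (\<forall>k\<in>{m<..n}. sgn (x k (phi s)) = cx k) \<and>
      (\<forall>k\<in>{m<..n}. sgn (lam k (phi s)) = cl k) \<and> (m < n \<longrightarrow> \<bar>lam (m + 1) (phi s)\<bar> \<le> C)"
    unfolding eventually_at_right_field by blast
  define d where "d = min e d0"
  have d: "0 < d" "d \<le> d0" "d \<le> e" using e(1) d0 by (auto simp: d_def)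
  have near: "\<exists>s. 0 < s \<and> s < e' \<and> contact m (phi s)" if "0 < e'" for e'
  proof -
    have "\<forall>\<^sub>F s in at_right 0. 0 < s \<and> s < e'"
      using that unfolding eventually_at_right_field by (intro exI[of _ e']) auto
    then show ?thesis using frequently_ex[OF frequently_eventually_frequently[OF fr]] by fastforce
  qed
  have "extremal_contact n M0 tf tinf sg tb M x lam eta mu u m a r d C"
  proof unfold_locales
    show "\<exists>s. 0 < s \<and> s < e' \<and> contact m (phi s)" if "0 < e'" for e' by (rule near[OF that])
    show "\<not> contact k (phi s)" if "k \<in> {1..n}" "k \<noteq> m" "0 < s" "s < d" for k s
      using e(2)[of s] that d by auto
    show "sgn (x m (phi s)) = a" if "0 < s" "s < d" for s using e(2)[of s] that d sgn_a by auto
    show "\<exists>c. \<forall>s\<in>{0<..<d}. sgn (x k (phi s)) = c" if "k \<in> {m<..n}" for k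
      using e(2) that d by (intro exI[of _ "cx k"]) auto
    show "\<exists>c. \<forall>s\<in>{0<..<d}. sgn (lam k (phi s)) = c" if "k \<in> {m<..n}" for k
      using e(2) that d by (intro exI[of _ "cl k"]) auto
    show "\<bar>lam (m + 1) (phi s)\<bar> \<le> C" if "m < n" "0 < s" "s < d" for s
      using e(2)[of s] that d by auto
  qed (use m a r xm x0 d in auto)
  then show ?thesis by blast
qed

lemma (in extremal) one_sided_structure:
  "\<exists>t0 s ts. 0 < sg * (t0 - tinf) \<and> 0 \<le> t0 \<and> t0 \<le> tf \<and> only_active n M x tinf t0 s \<and>
    (\<forall>i. sg * ts (Suc i) < sg * ts i) \<and> chattering_structure n M x u lam tinf t0 s ts"
proof -
  obtain m a r d C where ec: "extremal_contact n M0 tf tinf sg tb M x lam eta mu u m a r d C"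
    using ex_extremal_contact by blast
  interpret extremal_contact n M0 tf tinf sg tb M x lam eta mu u m a r d C by (rule ec)
  obtain e f where e: "0 < e" "e < d" and f: "\<And>i. f (Suc i) < (f i :: real)"
    and act: "only_active n M x tinf (phi e) (m, a)"
    and struct: "chattering_structure n M x u lam tinf (phi e) (m, a) (\<lambda>i. phi (f i))"
    by (rule chattering_structure_contact, rule that)
  have "phi e \<in> {0<..<tf}" by (rule phi_in_d) (use e in auto)
  moreover have "0 < sg * (phi e - tinf)" using e by (simp add: phi_def)
  ultimately show ?thesis
    using act struct f by (intro exI[of _ "phi e"] exI[of _ "(m, a)"] exI[of _ "\<lambda>i. phi (f i)"])
      (auto simp: sg_phi)
qed

theorem theorem1:
  fixes n :: nat and M0 tf tinf :: real and M :: "nat \<Rightarrow> ereal" and x0 xf :: "nat \<Rightarrow> real"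
    and x lam :: "nat \<Rightarrow> real \<Rightarrow> real" and u :: "real \<Rightarrow> real"
  assumes "n \<ge> 1" and "0 < M0" and "\<And>k. k \<in> {1..n} \<Longrightarrow> 0 < M k"
    and "optimal n M0 M x0 xf tf x u"
    and "costates n M0 M tf x u lam"
    and "0 < tinf" and "tinf < tf"
  shows "(chattering_left u tinf \<longrightarrow>
           (\<exists>t0 s ts. 0 \<le> t0 \<and> t0 < tinf \<and> only_active n M x tinf t0 s \<and>
              strict_mono ts \<and> chattering_structure n M x u lam tinf t0 s ts)) \<and>
         (chattering_right u tinf \<longrightarrow>
           (\<exists>t0 s ts. tinf < t0 \<and> t0 \<le> tf \<and> only_active n M x tinf t0 s \<and>
              (\<forall>i j. i < j \<longrightarrow> ts j < ts i) \<and> chattering_structure n M x u lam tinf t0 s ts))"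
proof -
  have feas: "feasible n M0 M x0 xf tf x u" using assms(4) by (simp add: optimal_def)
  obtain eta mu where
    eta: "\<forall>k\<in>{1..n}. \<forall>t\<in>{0<..<tf}.
      0 \<le> eta k t \<and> ereal (eta k t) * (ereal \<bar>x k t\<bar> - M k) = 0"
    and mu: "\<forall>k\<in>{1..n}. \<forall>t\<in>{0<..<tf}. mu k t \<le> 0 \<and> (mu k t \<noteq> 0 \<longrightarrow> may_jump M x k t)"
    and lam_eq: "\<forall>k\<in>{1..n}. \<forall>a b. 0 < a \<and> a \<le> b \<and> b < tf \<longrightarrow>
      (\<exists>I J. ((\<lambda>\<tau>. (if k < n then lam (k + 1) \<tau> else 0) + eta k \<tau> * sgn (x k \<tau>))
          has_integral I) {a..b} \<and>
        ((\<lambda>\<tau>. mu k \<tau> * sgn (x k \<tau>)) has_sum J) {a<..b} \<and> lam k b - lam k a = - I + J)"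
    and lam1: "continuous_on {0<..<tf} (lam 1)"
    and u_eq: "AE t in lebesgue_on {0<..<tf}. u t = - M0 * sgn (lam 1 t)"
    using assms(5) unfolding costates_def by blast
  have extremal: "extremal n M0 tf tinf sg tb M x lam eta mu u"
    if sg: "sg = 1 \<or> sg = -1" and tb: "0 < sg * (tb - tinf)" "chattering_from u tb tinf" for sg tb
  proof
    fix k :: nat and t :: real
    show "(u has_integral x 1 t - x 1 0) {0..t}" if "t \<in> {0..tf}"
      using feas that by (simp add: feasible_def)
    show "(x k has_real_derivative x (k - 1) t) (at t)" if "k \<in> {1<..n}" "t \<in> {0<..<tf}"
    proof -
      have "(x k has_real_derivative x (k - 1) t) (at t within {0..tf})"
        using feas that by (simp add: feasible_def)
      then show ?thesis using that at_within_interior[of t "{0..tf}"] by simp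
    qed
    show "ereal \<bar>x k t\<bar> \<le> M k" if "k \<in> {1..n}" "t \<in> {0<..<tf}"
      using feas that by (simp add: feasible_def)
  qed (use assms sg tb eta mu lam_eq lam1 u_eq in auto)
  show ?thesis
  proof (intro conjI impI)
    assume "chattering_left u tinf"
    then obtain tb where "tb < tinf" "chattering_from u tb tinf" by (auto simp: chattering_left_def)
    then have "extremal n M0 tf tinf (-1) tb M x lam eta mu u" by (intro extremal) auto
    from extremal.one_sided_structure[OF this]
    show "\<exists>t0 s ts. 0 \<le> t0 \<and> t0 < tinf \<and> only_active n M x tinf t0 s \<and>
        strict_mono ts \<and> chattering_structure n M x u lam tinf t0 s ts"
      by (auto simp: strict_mono_Suc_iff)
  next
    assume "chattering_right u tinf"
    then obtain tb where "tinf < tb" "chattering_from u tb tinf" by (auto simp: chattering_right_def)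
    then have "extremal n M0 tf tinf 1 tb M x lam eta mu u" by (intro extremal) auto
    from extremal.one_sided_structure[OF this]
    obtain t0 s ts where s: "tinf < t0" "t0 \<le> tf" "only_active n M x tinf t0 s"
      "\<And>i. ts (Suc i) < ts i" "chattering_structure n M x u lam tinf t0 s ts"
      by auto
    have "ts j < ts i" if "i < j" for i j
      using lift_Suc_mono_less[of "\<lambda>i. - ts i" i j] s(4) that by simp
    then show "\<exists>t0 s ts. tinf < t0 \<and> t0 \<le> tf \<and> only_active n M x tinf t0 s \<and>
        (\<forall>i j. i < j \<longrightarrow> ts j < ts i) \<and> chattering_structure n M x u lam tinf t0 s ts"
      using s by blast
  qed
qed

end
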